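(* Let $F:\bar{\mathcal C}\to\mathcal C$ be an essentially surjective, full additive functor between linear categories with $\mathrm{Ker}(F)^2=0$, and let $K(F):K(\bar{\mathcal C})\to K(\mathcal C)$ be the induced functor between homotopy categories of cochain complexes. Let $(C^\cdot,d)$ be a cochain complex in $K(\mathcal C)$. For any graded lift $\bar C^\cdot$ of $C^\cdot$ along $F$, let $\mathbf C^\cdot$ be the cochain complex with $\mathbf C^n=\{h\in\mathrm{Hom}^n(\bar C^\cdot,\bar C^\cdot):F(h)=0\}$ and differential $\delta_{\bar d,\bar d}$, for an arbitrary graded lift $\bar d$ of $d$. (1) There is an obstruction $o(C^\cdot,d)\in H^2\mathbf C$ with $o(C^\cdot,d)=0$ if and only if $L_{K(F)}(C^\cdot,d)\neq\varnothing$. (2) If $o(C^\cdot,d)=0$, then $\mathrm{Sk}(L_{K(F)}(C^\cdot,d))$ is affine over $H^1\mathbf C^\cdot$.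
   Context: A linear category is a category enriched over the modules over some commutative ring. $\mathrm{Ker}(F)^2=0$ means: $gf=0$ for all composable morphisms $f,g$ of $\bar{\mathcal C}$ with $F(f)=0=F(g)$. Graded objects are families $C^\cdot=(C^i)_{i\in\mathbb Z}$; $\mathrm{Hom}^n(C^\cdot,D^\cdot)=\prod_i\mathcal C(C^i,D^{i+n})$; for degree-one graded endomorphisms $d_C,d_D$ put $\delta_{d_C,d_D}(f)=d_Df-(-1)^nfd_C$ for $f\in\mathrm{Hom}^n(C^\cdot,D^\cdot)$. A graded lift of $C^\cdot$ is a graded object $\bar C^\cdot$ of $\bar{\mathcal C}$ with an isomorphism $c:C^\cdot\cong F(\bar C^\cdot)$ of graded objects. A graded lift of $d$ is a degree-one graded map $\bar d:\bar C^\cdot\to\bar C^\cdot[1]$ with $F(\bar d)c=c\,d$ (not necessarily of square zero). The differential of $\mathbf C^\cdot$ does not depend on the choice of $\bar d$. For a functor $G:\mathcal A\to\mathcal B$ and $B\in\mathcal B$, a lift of $B$ along $G$ is a pair $(\bar B,b)$ with $\bar B\in\mathcal A$ and $b:B\cong G(\bar B)$ an isomorphism. $L_G(B)$ is the groupoid of lifts, with morphisms $(\bar B,b)\to(\bar B',b')$ the isomorphisms $u:\bar B\to\bar B'$ in $\mathcal A$ with $G(u)b=b'$. $\mathrm{Sk}$ denotes the class of isomorphism classes of objects. "Affine over an abelian group $A$" means equipped with a simply transitive action of $A$. *)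

theory Defs
  imports "HOL-Algebra.Module" "HOL-Algebra.Group_Action"
begin

section \<open>Categories, functors, lifts\<close>

text \<open>
  The sets \<open>Arr C X Y\<close> need not be disjoint for different pairs of objects, so composition
  and the arrow part of a functor take the objects as arguments:
  \<open>Comp C X Y Z g f\<close> is the composite of \<open>f : X \<rightarrow> Y\<close> and \<open>g : Y \<rightarrow> Z\<close>.
\<close>

record ('o, 'm) cat =
  Obj :: "'o set"
  Arr :: "'o \<Rightarrow> 'o \<Rightarrow> 'm set"
  Ident :: "'o \<Rightarrow> 'm"
  Comp :: "'o \<Rightarrow> 'o \<Rightarrow> 'o \<Rightarrow> 'm \<Rightarrow> 'm \<Rightarrow> 'm"

locale category =
  fixes C :: "('o, 'm, 'z) cat_scheme"
  assumes Ident_closed: "X \<in> Obj C \<Longrightarrow> Ident C X \<in> Arr C X X"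
    and Comp_closed:
      "\<lbrakk>X \<in> Obj C; Y \<in> Obj C; Z \<in> Obj C; f \<in> Arr C X Y; g \<in> Arr C Y Z\<rbrakk>
        \<Longrightarrow> Comp C X Y Z g f \<in> Arr C X Z"
    and Ident_left:
      "\<lbrakk>X \<in> Obj C; Y \<in> Obj C; f \<in> Arr C X Y\<rbrakk> \<Longrightarrow> Comp C X Y Y (Ident C Y) f = f"
    and Ident_right:
      "\<lbrakk>X \<in> Obj C; Y \<in> Obj C; f \<in> Arr C X Y\<rbrakk> \<Longrightarrow> Comp C X X Y f (Ident C X) = f"
    and Comp_assoc:
      "\<lbrakk>W \<in> Obj C; X \<in> Obj C; Y \<in> Obj C; Z \<in> Obj C;
        f \<in> Arr C W X; g \<in> Arr C X Y; h \<in> Arr C Y Z\<rbrakk>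
        \<Longrightarrow> Comp C W Y Z h (Comp C W X Y g f) = Comp C W X Z (Comp C X Y Z h g) f"

definition isos :: "('o, 'm, 'z) cat_scheme \<Rightarrow> 'o \<Rightarrow> 'o \<Rightarrow> 'm set" where
  "isos C X Y = {f \<in> Arr C X Y. \<exists>g \<in> Arr C Y X.
     Comp C X Y X g f = Ident C X \<and> Comp C Y X Y f g = Ident C Y}"

definition iso_rel :: "('o, 'm, 'z) cat_scheme \<Rightarrow> ('o \<times> 'o) set" where
  "iso_rel C = {(X, Y). X \<in> Obj C \<and> Y \<in> Obj C \<and> isos C X Y \<noteq> {}}"

definition Sk :: "('o, 'm, 'z) cat_scheme \<Rightarrow> 'o set set" where
  "Sk C = Obj C // iso_rel C"

record ('o, 'm, 'p, 'n) fctr =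
  fobj :: "'o \<Rightarrow> 'p"
  farr :: "'o \<Rightarrow> 'o \<Rightarrow> 'm \<Rightarrow> 'n"

locale cat_functor =
  fixes A :: "('o, 'm, 'y) cat_scheme" and B :: "('p, 'n, 'z) cat_scheme"
    and F :: "('o, 'm, 'p, 'n) fctr"
  assumes fobj_closed: "X \<in> Obj A \<Longrightarrow> fobj F X \<in> Obj B"
    and farr_closed:
      "\<lbrakk>X \<in> Obj A; Y \<in> Obj A; f \<in> Arr A X Y\<rbrakk>
        \<Longrightarrow> farr F X Y f \<in> Arr B (fobj F X) (fobj F Y)"
    and farr_Ident: "X \<in> Obj A \<Longrightarrow> farr F X X (Ident A X) = Ident B (fobj F X)"
    and farr_Comp:
      "\<lbrakk>X \<in> Obj A; Y \<in> Obj A; Z \<in> Obj A; f \<in> Arr A X Y; g \<in> Arr A Y Z\<rbrakk>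
        \<Longrightarrow> farr F X Z (Comp A X Y Z g f) =
            Comp B (fobj F X) (fobj F Y) (fobj F Z) (farr F Y Z g) (farr F X Y f)"

definition full_functor ::
  "('o, 'm, 'y) cat_scheme \<Rightarrow> ('p, 'n, 'z) cat_scheme \<Rightarrow> ('o, 'm, 'p, 'n) fctr \<Rightarrow> bool" where
  "full_functor A B F \<longleftrightarrow> (\<forall>X \<in> Obj A. \<forall>Y \<in> Obj A.
     farr F X Y ` Arr A X Y = Arr B (fobj F X) (fobj F Y))"

definition essentially_surjective ::
  "('o, 'm, 'y) cat_scheme \<Rightarrow> ('p, 'n, 'z) cat_scheme \<Rightarrow> ('o, 'm, 'p, 'n) fctr \<Rightarrow> bool" where
  "essentially_surjective A B F \<longleftrightarrow> (\<forall>Y \<in> Obj B. \<exists>X \<in> Obj A. isos B Y (fobj F X) \<noteq> {})"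

definition lift_groupoid ::
  "('o, 'm, 'y) cat_scheme \<Rightarrow> ('p, 'n, 'z) cat_scheme \<Rightarrow> ('o, 'm, 'p, 'n) fctr \<Rightarrow> 'p
    \<Rightarrow> ('o \<times> 'n, 'm) cat" where
  "lift_groupoid A B G Y = \<lparr>
     Obj = {(X, b). X \<in> Obj A \<and> b \<in> isos B Y (fobj G X)},
     Arr = (\<lambda>(X, b) (X', b').
       {u \<in> isos A X X'. Comp B Y (fobj G X) (fobj G X') (farr G X X' u) b = b'}),
     Ident = (\<lambda>(X, b). Ident A X),
     Comp = (\<lambda>(X, _) (X', _) (X'', _). Comp A X X' X'')\<rparr>"

section \<open>Linear categories and additive functors\<close>

record ('o, 'm, 'k) lincat = "('o, 'm) cat" +
  Hmod :: "'o \<Rightarrow> 'o \<Rightarrow> ('k, 'm) module"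

locale linear_category = category C
  for R :: "'k ring" and C :: "('o, 'm, 'k) lincat" +
  assumes base_ring: "cring R"
    and Hmod_module: "\<lbrakk>X \<in> Obj C; Y \<in> Obj C\<rbrakk> \<Longrightarrow> module R (Hmod C X Y)"
    and carrier_Hmod: "\<lbrakk>X \<in> Obj C; Y \<in> Obj C\<rbrakk> \<Longrightarrow> carrier (Hmod C X Y) = Arr C X Y"
    and Comp_add_left:
      "\<lbrakk>X \<in> Obj C; Y \<in> Obj C; Z \<in> Obj C; f \<in> Arr C X Y; g \<in> Arr C Y Z; g' \<in> Arr C Y Z\<rbrakk>
        \<Longrightarrow> Comp C X Y Z (g \<oplus>\<^bsub>Hmod C Y Z\<^esub> g') f =
            Comp C X Y Z g f \<oplus>\<^bsub>Hmod C X Z\<^esub> Comp C X Y Z g' f"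
    and Comp_add_right:
      "\<lbrakk>X \<in> Obj C; Y \<in> Obj C; Z \<in> Obj C; f \<in> Arr C X Y; f' \<in> Arr C X Y; g \<in> Arr C Y Z\<rbrakk>
        \<Longrightarrow> Comp C X Y Z g (f \<oplus>\<^bsub>Hmod C X Y\<^esub> f') =
            Comp C X Y Z g f \<oplus>\<^bsub>Hmod C X Z\<^esub> Comp C X Y Z g f'"
    and Comp_smult_left:
      "\<lbrakk>a \<in> carrier R; X \<in> Obj C; Y \<in> Obj C; Z \<in> Obj C; f \<in> Arr C X Y; g \<in> Arr C Y Z\<rbrakk>
        \<Longrightarrow> Comp C X Y Z (a \<odot>\<^bsub>Hmod C Y Z\<^esub> g) f = a \<odot>\<^bsub>Hmod C X Z\<^esub> Comp C X Y Z g f"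
    and Comp_smult_right:
      "\<lbrakk>a \<in> carrier R; X \<in> Obj C; Y \<in> Obj C; Z \<in> Obj C; f \<in> Arr C X Y; g \<in> Arr C Y Z\<rbrakk>
        \<Longrightarrow> Comp C X Y Z g (a \<odot>\<^bsub>Hmod C X Y\<^esub> f) = a \<odot>\<^bsub>Hmod C X Z\<^esub> Comp C X Y Z g f"

locale additive_functor = cat_functor A B F
  for A :: "('o, 'm, 'k) lincat" and B :: "('p, 'n, 'l) lincat"
    and F :: "('o, 'm, 'p, 'n) fctr" +
  assumes farr_add:
    "\<lbrakk>X \<in> Obj A; Y \<in> Obj A; f \<in> Arr A X Y; g \<in> Arr A X Y\<rbrakk>
      \<Longrightarrow> farr F X Y (f \<oplus>\<^bsub>Hmod A X Y\<^esub> g) =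
          farr F X Y f \<oplus>\<^bsub>Hmod B (fobj F X) (fobj F Y)\<^esub> farr F X Y g"

definition square_zero_kernel ::
  "('o, 'm, 'k) lincat \<Rightarrow> ('p, 'n, 'l) lincat \<Rightarrow> ('o, 'm, 'p, 'n) fctr \<Rightarrow> bool" where
  "square_zero_kernel A B F \<longleftrightarrow>
     (\<forall>X \<in> Obj A. \<forall>Y \<in> Obj A. \<forall>Z \<in> Obj A. \<forall>f \<in> Arr A X Y. \<forall>g \<in> Arr A Y Z.
        farr F X Y f = \<zero>\<^bsub>Hmod B (fobj F X) (fobj F Y)\<^esub> \<longrightarrow>
        farr F Y Z g = \<zero>\<^bsub>Hmod B (fobj F Y) (fobj F Z)\<^esub> \<longrightarrow>
        Comp A X Y Z g f = \<zero>\<^bsub>Hmod A X Z\<^esub>)"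

section \<open>Graded objects and graded maps\<close>

definition gobjs :: "('o, 'm, 'z) cat_scheme \<Rightarrow> (int \<Rightarrow> 'o) set" where
  "gobjs C = {X. \<forall>i. X i \<in> Obj C}"

definition ghom ::
  "('o, 'm, 'z) cat_scheme \<Rightarrow> (int \<Rightarrow> 'o) \<Rightarrow> (int \<Rightarrow> 'o) \<Rightarrow> int \<Rightarrow> (int \<Rightarrow> 'm) set" where
  "ghom C X Y n = {f. \<forall>i. f i \<in> Arr C (X i) (Y (i + n))}"

text \<open>Composite of \<open>f : X \<rightarrow> Y[p]\<close> and \<open>g : Y \<rightarrow> Z[q]\<close>.\<close>

definition gcomp ::
  "('o, 'm, 'z) cat_scheme \<Rightarrow> (int \<Rightarrow> 'o) \<Rightarrow> (int \<Rightarrow> 'o) \<Rightarrow> (int \<Rightarrow> 'o) \<Rightarrow> int \<Rightarrow> int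
    \<Rightarrow> (int \<Rightarrow> 'm) \<Rightarrow> (int \<Rightarrow> 'm) \<Rightarrow> int \<Rightarrow> 'm" where
  "gcomp C X Y Z p q g f = (\<lambda>i. Comp C (X i) (Y (i + p)) (Z (i + p + q)) (g (i + p)) (f i))"

definition gident :: "('o, 'm, 'z) cat_scheme \<Rightarrow> (int \<Rightarrow> 'o) \<Rightarrow> int \<Rightarrow> 'm" where
  "gident C X = (\<lambda>i. Ident C (X i))"

definition graded_cat :: "('o, 'm, 'z) cat_scheme \<Rightarrow> (int \<Rightarrow> 'o, int \<Rightarrow> 'm) cat" where
  "graded_cat C = \<lparr>
     Obj = gobjs C,
     Arr = (\<lambda>X Y. ghom C X Y 0),
     Ident = gident C,
     Comp = (\<lambda>X Y Z. gcomp C X Y Z 0 0)\<rparr>"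

definition gobj_map :: "('o, 'm, 'p, 'n) fctr \<Rightarrow> (int \<Rightarrow> 'o) \<Rightarrow> int \<Rightarrow> 'p" where
  "gobj_map F X = (\<lambda>i. fobj F (X i))"

definition garr_map ::
  "('o, 'm, 'p, 'n) fctr \<Rightarrow> (int \<Rightarrow> 'o) \<Rightarrow> (int \<Rightarrow> 'o) \<Rightarrow> int \<Rightarrow> (int \<Rightarrow> 'm) \<Rightarrow> int \<Rightarrow> 'n" where
  "garr_map F X Y n f = (\<lambda>i. farr F (X i) (Y (i + n)) (f i))"

text \<open>
  \<open>Hom\<^sup>n(X, Y)\<close> as an abelian group; it is written multiplicatively, as all groups in
  HOL-Algebra, but its operation is pointwise addition.
\<close>

definition ghom_group ::
  "('o, 'm, 'k) lincat \<Rightarrow> (int \<Rightarrow> 'o) \<Rightarrow> (int \<Rightarrow> 'o) \<Rightarrow> int \<Rightarrow> (int \<Rightarrow> 'm) monoid" where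
  "ghom_group C X Y n = \<lparr>
     carrier = ghom C X Y n,
     monoid.mult = (\<lambda>f g i. f i \<oplus>\<^bsub>Hmod C (X i) (Y (i + n))\<^esub> g i),
     one = (\<lambda>i. \<zero>\<^bsub>Hmod C (X i) (Y (i + n))\<^esub>)\<rparr>"

text \<open>\<open>\<delta>(f) = dY f - (-1)^n f dX\<close> for \<open>f\<close> of degree \<open>n\<close>.\<close>

definition gdiff ::
  "('o, 'm, 'k) lincat \<Rightarrow> (int \<Rightarrow> 'o) \<times> (int \<Rightarrow> 'm) \<Rightarrow> (int \<Rightarrow> 'o) \<times> (int \<Rightarrow> 'm) \<Rightarrow> int
    \<Rightarrow> (int \<Rightarrow> 'm) \<Rightarrow> int \<Rightarrow> 'm" where
  "gdiff C = (\<lambda>(X, dX) (Y, dY) n f i.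
     let M = Hmod C (X i) (Y (i + n + 1));
         df = gcomp C X Y Y n 1 dY f i;
         fd = gcomp C X X Y 1 n f dX i
     in if even n then df \<ominus>\<^bsub>M\<^esub> fd else df \<oplus>\<^bsub>M\<^esub> fd)"

section \<open>Cohomology and the homotopy category\<close>

text \<open>A cochain complex of abelian groups is given by groups \<open>A n\<close> and maps \<open>D n : A n \<rightarrow> A (n + 1)\<close>.\<close>

definition cocycles :: "(int \<Rightarrow> 'a monoid) \<Rightarrow> (int \<Rightarrow> 'a \<Rightarrow> 'a) \<Rightarrow> int \<Rightarrow> 'a set" where
  "cocycles A D n = {x \<in> carrier (A n). D n x = \<one>\<^bsub>A (n + 1)\<^esub>}"

definition coboundaries :: "(int \<Rightarrow> 'a monoid) \<Rightarrow> (int \<Rightarrow> 'a \<Rightarrow> 'a) \<Rightarrow> int \<Rightarrow> 'a set" where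
  "coboundaries A D n = D (n - 1) ` carrier (A (n - 1))"

definition cohomology :: "(int \<Rightarrow> 'a monoid) \<Rightarrow> (int \<Rightarrow> 'a \<Rightarrow> 'a) \<Rightarrow> int \<Rightarrow> 'a set monoid" where
  "cohomology A D n = (A n)\<lparr>carrier := cocycles A D n\<rparr> Mod coboundaries A D n"

definition coh_class :: "(int \<Rightarrow> 'a monoid) \<Rightarrow> (int \<Rightarrow> 'a \<Rightarrow> 'a) \<Rightarrow> int \<Rightarrow> 'a \<Rightarrow> 'a set" where
  "coh_class A D n x = coboundaries A D n #>\<^bsub>A n\<^esub> x"

definition complexes :: "('o, 'm, 'k) lincat \<Rightarrow> ((int \<Rightarrow> 'o) \<times> (int \<Rightarrow> 'm)) set" where
  "complexes C = {(X, d). X \<in> gobjs C \<and> d \<in> ghom C X X 1 \<and>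
     gcomp C X X X 1 1 d d = \<one>\<^bsub>ghom_group C X X 2\<^esub>}"

text \<open>The homotopy class of a chain map, i.e. its class in \<open>H\<^sup>0 Hom(X, Y)\<close>.\<close>

definition hclass ::
  "('o, 'm, 'k) lincat \<Rightarrow> (int \<Rightarrow> 'o) \<times> (int \<Rightarrow> 'm) \<Rightarrow> (int \<Rightarrow> 'o) \<times> (int \<Rightarrow> 'm)
    \<Rightarrow> (int \<Rightarrow> 'm) \<Rightarrow> (int \<Rightarrow> 'm) set" where
  "hclass C X Y = coh_class (ghom_group C (fst X) (fst Y)) (gdiff C X Y) 0"

text \<open>
  The unions run over all representatives; they are unions of equal classes.
\<close>

definition homotopy_cat ::
  "('o, 'm, 'k) lincat \<Rightarrow> ((int \<Rightarrow> 'o) \<times> (int \<Rightarrow> 'm), (int \<Rightarrow> 'm) set) cat" where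
  "homotopy_cat C = \<lparr>
     Obj = complexes C,
     Arr = (\<lambda>X Y. carrier (cohomology (ghom_group C (fst X) (fst Y)) (gdiff C X Y) 0)),
     Ident = (\<lambda>X. hclass C X X (gident C (fst X))),
     Comp = (\<lambda>X Y Z V U.
       \<Union>g \<in> V. \<Union>f \<in> U. hclass C X Z (gcomp C (fst X) (fst Y) (fst Z) 0 0 g f))\<rparr>"

definition complex_map ::
  "('o, 'm, 'p, 'n) fctr \<Rightarrow> (int \<Rightarrow> 'o) \<times> (int \<Rightarrow> 'm) \<Rightarrow> (int \<Rightarrow> 'p) \<times> (int \<Rightarrow> 'n)" where
  "complex_map F = (\<lambda>(X, d). (gobj_map F X, garr_map F X X 1 d))"

definition homotopy_functor ::
  "('p, 'n, 'l) lincat \<Rightarrow> ('o, 'm, 'p, 'n) fctr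
    \<Rightarrow> ((int \<Rightarrow> 'o) \<times> (int \<Rightarrow> 'm), (int \<Rightarrow> 'm) set, (int \<Rightarrow> 'p) \<times> (int \<Rightarrow> 'n), (int \<Rightarrow> 'n) set) fctr"
  where
  "homotopy_functor B F = \<lparr>
     fobj = complex_map F,
     farr = (\<lambda>X Y U.
       \<Union>f \<in> U. hclass B (complex_map F X) (complex_map F Y) (garr_map F (fst X) (fst Y) 0 f))\<rparr>"

section \<open>Graded lifts and the kernel complex\<close>

definition graded_lift ::
  "('o, 'm, 'k) lincat \<Rightarrow> ('p, 'n, 'l) lincat \<Rightarrow> ('o, 'm, 'p, 'n) fctr
    \<Rightarrow> (int \<Rightarrow> 'p) \<Rightarrow> (int \<Rightarrow> 'o) \<Rightarrow> (int \<Rightarrow> 'n) \<Rightarrow> bool" where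
  "graded_lift A B F X X' c \<longleftrightarrow>
     X' \<in> gobjs A \<and> c \<in> isos (graded_cat B) X (gobj_map F X')"

definition graded_map_lift ::
  "('o, 'm, 'k) lincat \<Rightarrow> ('p, 'n, 'l) lincat \<Rightarrow> ('o, 'm, 'p, 'n) fctr
    \<Rightarrow> (int \<Rightarrow> 'p) \<Rightarrow> (int \<Rightarrow> 'n) \<Rightarrow> (int \<Rightarrow> 'o) \<Rightarrow> (int \<Rightarrow> 'n) \<Rightarrow> (int \<Rightarrow> 'm) \<Rightarrow> bool" where
  "graded_map_lift A B F X d X' c d' \<longleftrightarrow>
     d' \<in> ghom A X' X' 1 \<and>
     gcomp B X (gobj_map F X') (gobj_map F X') 0 1 (garr_map F X' X' 1 d') c =
     gcomp B X X (gobj_map F X') 1 0 c d"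

definition kernel_group ::
  "('o, 'm, 'k) lincat \<Rightarrow> ('p, 'n, 'l) lincat \<Rightarrow> ('o, 'm, 'p, 'n) fctr \<Rightarrow> (int \<Rightarrow> 'o) \<Rightarrow> int
    \<Rightarrow> (int \<Rightarrow> 'm) monoid" where
  "kernel_group A B F X n = (ghom_group A X X n)
     \<lparr>carrier := {h \<in> ghom A X X n.
        garr_map F X X n h = \<one>\<^bsub>ghom_group B (gobj_map F X) (gobj_map F X) n\<^esub>}\<rparr>"

abbreviation kernel_cocycles where
  "kernel_cocycles A B F X d n \<equiv> cocycles (kernel_group A B F X) (gdiff A (X, d) (X, d)) n"

abbreviation kernel_cohomology where
  "kernel_cohomology A B F X d n \<equiv> cohomology (kernel_group A B F X) (gdiff A (X, d) (X, d)) n"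

abbreviation kernel_class where
  "kernel_class A B F X d n \<equiv> coh_class (kernel_group A B F X) (gdiff A (X, d) (X, d)) n"

abbreviation complex_lifts where
  "complex_lifts A B F X d \<equiv>
     lift_groupoid (homotopy_cat A) (homotopy_cat B) (homotopy_functor B F) (X, d)"

text \<open>
  If \<open>(X', c)\<close> is a graded lift of \<open>X\<close> and \<open>d'\<close> is a graded lift of \<open>d\<close> of square zero, then
  \<open>((X', d'), [c])\<close> is a lift of the complex \<open>(X, d)\<close>; this is its isomorphism class.
\<close>

definition strict_lift_class ::
  "('o, 'm, 'k) lincat \<Rightarrow> ('p, 'n, 'l) lincat \<Rightarrow> ('o, 'm, 'p, 'n) fctr
    \<Rightarrow> (int \<Rightarrow> 'p) \<Rightarrow> (int \<Rightarrow> 'n) \<Rightarrow> (int \<Rightarrow> 'o) \<Rightarrow> (int \<Rightarrow> 'n) \<Rightarrow> (int \<Rightarrow> 'm)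
    \<Rightarrow> (((int \<Rightarrow> 'o) \<times> (int \<Rightarrow> 'm)) \<times> (int \<Rightarrow> 'n) set) set" where
  "strict_lift_class A B F X d X' c d' =
     iso_rel (complex_lifts A B F X d) ``
       {((X', d'), hclass B (X, d) (complex_map F (X', d')) c)}"

section \<open>Affine sets\<close>

definition affine_over :: "('a, 'b) monoid_scheme \<Rightarrow> 'e set \<Rightarrow> ('a \<Rightarrow> 'e \<Rightarrow> 'e) \<Rightarrow> bool" where
  "affine_over G E \<phi> \<longleftrightarrow> comm_group G \<and> group_action G E \<phi> \<and> E \<noteq> {} \<and>
     (\<forall>x \<in> E. \<forall>y \<in> E. \<exists>!g. g \<in> carrier G \<and> \<phi> g x = y)"

end

theory Submission
  imports Defs
begin

text \<open>
  Write \<open>F : A \<rightarrow> B\<close> for the functor and \<open>Ker(X, Y)\<close> for the graded maps killed by \<open>F\<close>. Since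
  \<open>Ker\<close> is an ideal of square zero, a map acts on it, from either side, only through its
  image under \<open>F\<close>. Two consequences drive everything. First, \<open>\<delta>\<close> squares to zero on
  \<open>Ker(X, Y)\<close> as soon as \<open>X\<close> and \<open>Y\<close> are complexes after applying \<open>F\<close>, and on \<open>Ker\<close> it is the
  same for all lifts of a given differential. Second, a homotopy equivalence in \<open>B\<close> acts
  invertibly on the cohomology of \<open>Ker\<close>: if \<open>a\<close> and \<open>b\<close> lift mutually inverse homotopy
  equivalences then \<open>a b = 1 + \<delta>(s) + k\<close> with \<open>k\<close> in \<open>Ker\<close>, so that \<open>a b x = x + \<delta>(s x)\<close> for
  every cocycle \<open>x\<close> of \<open>Ker\<close> (lemmas \<open>gcomp_left_inverse_mod_kernel\<close> and
  \<open>kerhom_exact_if_gcomp_exact\<close>).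

  The graded lifts of \<open>d\<close> are the maps \<open>db + h\<close> with \<open>h\<close> in \<open>Ker\<close>, and
  \<open>(db + h)\<^sup>2 = db\<^sup>2 + \<delta>(h)\<close> because \<open>h\<^sup>2 = 0\<close>. Hence the class of \<open>db\<^sup>2\<close> in \<open>H\<^sup>2\<close> does not
  depend on the lift, and it vanishes exactly when some lift of \<open>d\<close> on the given graded object
  has square zero. Such a lift of \<open>d\<close> gives a lift of the complex. Conversely, let \<open>(Y, e)\<close> be
  any lift of the complex, and let \<open>b : Xb \<rightarrow> Y\<close> be a graded map lifting the homotopy equivalence
  between the images. Then \<open>\<delta>(\<delta>(b)) = - b db\<^sup>2\<close> with \<open>\<delta>(b)\<close> in \<open>Ker\<close>, so \<open>b\<close> maps the class
  of \<open>db\<^sup>2\<close> to zero, and by invertibility that class is zero (\<open>ex_strict_if_lift\<close>).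

  For the torsor, fix a lift \<open>d0\<close> of square zero and send a cocycle \<open>h\<close> of degree one to the
  class of \<open>(Xb, d0 + h)\<close>. If \<open>h' - h = \<delta>(k)\<close>, then \<open>1 - k\<close> is an isomorphism of lifts from
  \<open>d0 + h\<close> to \<open>d0 + h'\<close>; conversely any isomorphism of lifts is homotopic to one of this form
  (\<open>iso_strict_if_coboundary\<close>, \<open>coboundary_if_iso_strict\<close>). Every lift \<open>(Y, e)\<close> arises: with
  \<open>b\<close> as above, \<open>\<delta>(b)\<close> is a cocycle of \<open>Ker(Xb, Y)\<close>, and by invertibility it has the form
  \<open>b h\<close> up to a coboundary \<open>\<delta>(w)\<close>; then \<open>b + w\<close> is a chain map from \<open>(Xb, d0 + h)\<close> to \<open>(Y, e)\<close>
  (\<open>lift_iso_strict\<close>). It is an isomorphism because the functor on homotopy categories reflects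
  isomorphisms (\<open>isos_reflected\<close>), again by invertibility on the cohomology of \<open>Ker\<close>. The
  bijection from \<open>H\<^sup>1\<close> so obtained transports the translation action, and the result does not
  depend on \<open>d0\<close>.
\<close>

section \<open>Cohomology of a cochain complex of abelian groups\<close>

locale cochain_complex =
  fixes A :: "int \<Rightarrow> 'a monoid" and D :: "int \<Rightarrow> 'a \<Rightarrow> 'a"
  assumes comm_group: "comm_group (A n)"
    and D_hom: "D n \<in> hom (A n) (A (n + 1))"
    and D_D: "x \<in> carrier (A n) \<Longrightarrow> D (n + 1) (D n x) = \<one>\<^bsub>A (n + 1 + 1)\<^esub>"
begin

lemma group_hom_D: "group_hom (A n) (A (n + 1)) (D n)"
  using comm_group D_hom by (simp add: group_hom_def group_hom_axioms_def comm_group.axioms(2))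

lemma cocycles_subgroup: "subgroup (cocycles A D n) (A n)"
proof -
  interpret group_hom "A n" "A (n + 1)" "D n" by (rule group_hom_D)
  have "cocycles A D n = kernel (A n) (A (n + 1)) (D n)"
    by (auto simp: cocycles_def kernel_def)
  then show ?thesis by (simp add: subgroup_kernel)
qed

lemma coboundaries_subset: "coboundaries A D n \<subseteq> cocycles A D n"
proof
  fix x assume "x \<in> coboundaries A D n"
  then obtain y where y: "y \<in> carrier (A (n - 1))" and x: "x = D (n - 1) y"
    by (auto simp: coboundaries_def)
  have "x \<in> carrier (A n)" using D_hom[of "n - 1"] x y by (auto simp: hom_def)
  moreover have "D n x = \<one>\<^bsub>A (n + 1)\<^esub>" using D_D[OF y] x by simp
  ultimately show "x \<in> cocycles A D n" by (simp add: cocycles_def)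
qed

lemma coboundaries_subgroup: "subgroup (coboundaries A D n) (A n)"
proof -
  interpret group_hom "A (n - 1)" "A n" "D (n - 1)" using group_hom_D[of "n - 1"] by simp
  show ?thesis unfolding coboundaries_def by (rule img_is_subgroup)
qed

lemma cocycle_group: "comm_group ((A n)\<lparr>carrier := cocycles A D n\<rparr>)"
proof -
  interpret comm_group "A n" by (rule comm_group)
  show ?thesis
    by (rule group.group_comm_groupI[OF subgroup_imp_group[OF cocycles_subgroup]])
       (auto simp: cocycles_def m_comm)
qed

lemma coboundaries_subgroup_cocycles:
  "subgroup (coboundaries A D n) ((A n)\<lparr>carrier := cocycles A D n\<rparr>)"
  by (rule group.subgroup_incl[OF comm_group.axioms(2)[OF comm_group]
        coboundaries_subgroup cocycles_subgroup coboundaries_subset])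

lemma coboundaries_normal:
  "coboundaries A D n \<lhd> (A n)\<lparr>carrier := cocycles A D n\<rparr>"
  by (rule comm_group.normal_iff_subgroup[OF cocycle_group, THEN iffD2])
     (rule coboundaries_subgroup_cocycles)

lemma cohomology_comm_group: "comm_group (cohomology A D n)"
  unfolding cohomology_def
  by (rule comm_group.abelian_FactGroup[OF cocycle_group coboundaries_subgroup_cocycles])

text \<open>
  Cohomology groups are quotients of the group of cocycles, whereas cohomology classes are
  formed as cosets in the whole group; the two kinds of coset agree.
\<close>

lemma coh_class_r_coset:
  "coh_class A D n x = coboundaries A D n #>\<^bsub>(A n)\<lparr>carrier := cocycles A D n\<rparr>\<^esub> x"
  by (simp add: coh_class_def r_coset_def)

lemma carrier_cohomology: "carrier (cohomology A D n) = coh_class A D n ` cocycles A D n"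
  by (auto simp: cohomology_def FactGroup_def RCOSETS_def coh_class_r_coset)

lemma coh_class_mult:
  assumes "x \<in> cocycles A D n" "y \<in> cocycles A D n"
  shows "coh_class A D n x \<otimes>\<^bsub>cohomology A D n\<^esub> coh_class A D n y
       = coh_class A D n (x \<otimes>\<^bsub>A n\<^esub> y)"
  using normal.rcos_sum[OF coboundaries_normal, of x n y] assms
  by (simp add: cohomology_def FactGroup_def coh_class_r_coset)

lemma coh_class_eq_iff:
  assumes x: "x \<in> cocycles A D n" and y: "y \<in> cocycles A D n"
  shows "coh_class A D n x = coh_class A D n y \<longleftrightarrow>
    (\<exists>z \<in> carrier (A (n - 1)). x = D (n - 1) z \<otimes>\<^bsub>A n\<^esub> y)"
proof -
  interpret comm_group "A n" by (rule comm_group)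
  have c: "x \<in> carrier (A n)" "y \<in> carrier (A n)" using x y by (auto simp: cocycles_def)
  have "coh_class A D n x = coh_class A D n y \<longleftrightarrow> x \<in> coh_class A D n y"
    unfolding coh_class_def using c coboundaries_subgroup
    by (metis repr_independence repr_independenceD)
  also have "\<dots> \<longleftrightarrow> (\<exists>z \<in> carrier (A (n - 1)). x = D (n - 1) z \<otimes>\<^bsub>A n\<^esub> y)"
    by (auto simp: coh_class_def r_coset_def coboundaries_def)
  finally show ?thesis .
qed

lemma mem_coh_class:
  "x \<in> coh_class A D n y \<longleftrightarrow> (\<exists>z \<in> carrier (A (n - 1)). x = D (n - 1) z \<otimes>\<^bsub>A n\<^esub> y)"
  by (auto simp: coh_class_def r_coset_def coboundaries_def)

lemma one_cocycle: "\<one>\<^bsub>A n\<^esub> \<in> cocycles A D n"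
  by (rule subgroup.one_closed[OF cocycles_subgroup])

lemma one_cohomology: "\<one>\<^bsub>cohomology A D n\<^esub> = coh_class A D n \<one>\<^bsub>A n\<^esub>"
proof -
  interpret comm_group "A n" by (rule comm_group)
  have "coboundaries A D n \<subseteq> carrier (A n)"
    using coboundaries_subgroup by (rule subgroup.subset)
  then show ?thesis
    by (simp add: cohomology_def FactGroup_def coh_class_def coset_mult_one)
qed

lemma coh_class_subset: "x \<in> cocycles A D n \<Longrightarrow> coh_class A D n x \<subseteq> cocycles A D n"
  using coboundaries_subset[of n] subgroup.m_closed[OF cocycles_subgroup[of n]]
  by (auto simp: coh_class_def r_coset_def)

lemma coh_class_trivial_iff:
  assumes x: "x \<in> cocycles A D n"
  shows "coh_class A D n x = \<one>\<^bsub>cohomology A D n\<^esub> \<longleftrightarrow>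
    (\<exists>z \<in> carrier (A (n - 1)). x = D (n - 1) z)"
proof -
  interpret comm_group "A n" by (rule comm_group)
  have "D (n - 1) z \<in> carrier (A n)" if "z \<in> carrier (A (n - 1))" for z
    using D_hom[of "n - 1"] that by (auto simp: hom_def)
  then show ?thesis
    unfolding one_cohomology coh_class_eq_iff[OF x one_cocycle] by auto
qed

end

section \<open>Isomorphisms and groupoids of lifts\<close>

context category
begin

lemma isosI:
  "\<lbrakk>f \<in> Arr C X Y; g \<in> Arr C Y X; Comp C X Y X g f = Ident C X; Comp C Y X Y f g = Ident C Y\<rbrakk>
    \<Longrightarrow> f \<in> isos C X Y"
  by (auto simp: isos_def)

lemma isos_Arr: "f \<in> isos C X Y \<Longrightarrow> f \<in> Arr C X Y"
  by (simp add: isos_def)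

lemma isosE:
  assumes "f \<in> isos C X Y"
  obtains g where "g \<in> isos C Y X" "Comp C X Y X g f = Ident C X" "Comp C Y X Y f g = Ident C Y"
  using assms by (auto simp: isos_def)

lemma Ident_isos: "X \<in> Obj C \<Longrightarrow> Ident C X \<in> isos C X X"
  by (rule isosI[of _ _ _ "Ident C X"]) (simp_all add: Ident_closed Ident_left)

lemma Comp_isos:
  assumes XYZ: "X \<in> Obj C" "Y \<in> Obj C" "Z \<in> Obj C"
    and f: "f \<in> isos C X Y" and g: "g \<in> isos C Y Z"
  shows "Comp C X Y Z g f \<in> isos C X Z"
proof -
  obtain f' where f': "f' \<in> Arr C Y X" "Comp C X Y X f' f = Ident C X" "Comp C Y X Y f f' = Ident C Y"
    using f by (auto simp: isos_def)
  obtain g' where g': "g' \<in> Arr C Z Y" "Comp C Y Z Y g' g = Ident C Y" "Comp C Z Y Z g g' = Ident C Z"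
    using g by (auto simp: isos_def)
  have fa: "f \<in> Arr C X Y" and ga: "g \<in> Arr C Y Z" using f g by (auto simp: isos_def)
  note cl = XYZ fa ga f'(1) g'(1)
  show ?thesis
  proof (rule isosI)
    show "Comp C X Y Z g f \<in> Arr C X Z" "Comp C Z Y X f' g' \<in> Arr C Z X"
      using cl by (auto intro: Comp_closed)
    have "Comp C X Z X (Comp C Z Y X f' g') (Comp C X Y Z g f)
        = Comp C X Y X f' (Comp C X Z Y g' (Comp C X Y Z g f))"
      using cl by (intro Comp_assoc[symmetric]) (auto intro: Comp_closed)
    also have "Comp C X Z Y g' (Comp C X Y Z g f) = f"
      using cl g' by (simp add: Comp_assoc Ident_left)
    finally show "Comp C X Z X (Comp C Z Y X f' g') (Comp C X Y Z g f) = Ident C X"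
      using f' by simp
    have "Comp C Z X Z (Comp C X Y Z g f) (Comp C Z Y X f' g')
        = Comp C Z Y Z g (Comp C Z X Y f (Comp C Z Y X f' g'))"
      using cl by (intro Comp_assoc[symmetric]) (auto intro: Comp_closed)
    also have "Comp C Z X Y f (Comp C Z Y X f' g') = g'"
      using cl f' by (simp add: Comp_assoc Ident_left)
    finally show "Comp C Z X Z (Comp C X Y Z g f) (Comp C Z Y X f' g') = Ident C Z"
      using g' by simp
  qed
qed

text \<open>A one-sided inverse on each side suffices, since the two are then equal.\<close>

lemma isos_if_left_right_inverse:
  assumes XY: "X \<in> Obj C" "Y \<in> Obj C" and f: "f \<in> Arr C X Y"
    and l: "l \<in> Arr C Y X" "Comp C X Y X l f = Ident C X"
    and r: "r \<in> Arr C Y X" "Comp C Y X Y f r = Ident C Y"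
  shows "f \<in> isos C X Y"
proof -
  have "l = Comp C Y Y X l (Comp C Y X Y f r)"
    using XY l r by (simp add: Ident_right)
  also have "\<dots> = Comp C Y X X (Comp C X Y X l f) r"
    using XY f l r by (intro Comp_assoc) auto
  also have "\<dots> = r" using XY l r by (simp add: Ident_left)
  finally show ?thesis using f l r by (auto intro: isosI)
qed

text \<open>
  An inverse of each composite turns the other factor into a one-sided inverse.
\<close>

lemma isos_if_composites_isos:
  assumes XY: "X \<in> Obj C" "Y \<in> Obj C" and f: "f \<in> Arr C X Y" and g: "g \<in> Arr C Y X"
    and gf: "Comp C X Y X g f \<in> isos C X X" and fg: "Comp C Y X Y f g \<in> isos C Y Y"
  shows "f \<in> isos C X Y"
proof -
  obtain u where u: "u \<in> Arr C X X" "Comp C X X X u (Comp C X Y X g f) = Ident C X"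
    using gf by (auto simp: isos_def)
  obtain v where v: "v \<in> Arr C Y Y" "Comp C Y Y Y (Comp C Y X Y f g) v = Ident C Y"
    using fg by (auto simp: isos_def)
  show ?thesis
  proof (rule isos_if_left_right_inverse[OF XY f])
    show "Comp C Y X X u g \<in> Arr C Y X" "Comp C Y Y X g v \<in> Arr C Y X"
      using XY g u v by (auto intro: Comp_closed)
    show "Comp C X Y X (Comp C Y X X u g) f = Ident C X"
      using u XY f g by (simp add: Comp_assoc)
    show "Comp C Y X Y f (Comp C Y Y X g v) = Ident C Y"
      using v XY f g by (simp add: Comp_assoc)
  qed
qed

end

text \<open>
  The inverse in \<open>A\<close> of a morphism of lifts is automatically a morphism of lifts, so two lifts
  are isomorphic as soon as an isomorphism of \<open>A\<close> is compatible with their structure maps.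
\<close>

lemma iso_rel_lift_groupoid:
  assumes "category A" "category B" "cat_functor A B G" and Y: "Y \<in> Obj B"
  shows "((X, b), (X', b')) \<in> iso_rel (lift_groupoid A B G Y) \<longleftrightarrow>
    X \<in> Obj A \<and> X' \<in> Obj A \<and> b \<in> isos B Y (fobj G X) \<and> b' \<in> isos B Y (fobj G X') \<and>
    (\<exists>u \<in> isos A X X'. Comp B Y (fobj G X) (fobj G X') (farr G X X' u) b = b')"
    (is "_ \<longleftrightarrow> ?r")
proof
  interpret A: category A by fact
  interpret B: category B by fact
  interpret cat_functor A B G by fact
  show "?r" if "((X, b), (X', b')) \<in> iso_rel (lift_groupoid A B G Y)"
    using that by (auto simp: iso_rel_def lift_groupoid_def isos_def)
  assume r: ?r
  then obtain u where u: "u \<in> isos A X X'"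
    and ub: "Comp B Y (fobj G X) (fobj G X') (farr G X X' u) b = b'" by blast
  obtain v where v: "v \<in> isos A X' X" "Comp A X X' X v u = Ident A X" "Comp A X' X X' u v = Ident A X'"
    using A.isosE[OF u] by blast
  have ob: "X \<in> Obj A" "X' \<in> Obj A" "fobj G X \<in> Obj B" "fobj G X' \<in> Obj B"
    using r fobj_closed by auto
  have ua: "u \<in> Arr A X X'" "v \<in> Arr A X' X" using u v by (auto intro: A.isos_Arr)
  have ba: "b \<in> Arr B Y (fobj G X)" using r B.isos_Arr by auto
  have "Comp B Y (fobj G X') (fobj G X) (farr G X' X v) b' =
    Comp B Y (fobj G X) (fobj G X) (Comp B (fobj G X) (fobj G X') (fobj G X) (farr G X' X v) (farr G X X' u)) b"
    unfolding ub[symmetric] using ob ua ba Y by (intro B.Comp_assoc farr_closed) auto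
  also have "\<dots> = b"
    using ob ua ba Y v by (simp add: B.Ident_left flip: farr_Comp farr_Ident) (simp add: farr_Ident B.Ident_left)
  finally show "((X, b), (X', b')) \<in> iso_rel (lift_groupoid A B G Y)"
    using r u v ub by (auto simp: iso_rel_def lift_groupoid_def isos_def)
qed

lemma equiv_iso_rel_lift_groupoid:
  assumes "category A" "category B" "cat_functor A B G" and Y: "Y \<in> Obj B"
  shows "equiv (Obj (lift_groupoid A B G Y)) (iso_rel (lift_groupoid A B G Y))"
proof -
  interpret A: category A by fact
  interpret B: category B by fact
  interpret cat_functor A B G by fact
  note iff = iso_rel_lift_groupoid[OF assms]
  let ?R = "iso_rel (lift_groupoid A B G Y)"
  show ?thesis
  proof (rule equivI)
    show "?R \<subseteq> Obj (lift_groupoid A B G Y) \<times> Obj (lift_groupoid A B G Y)"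
      by (auto simp: iso_rel_def)
    show "refl_on (Obj (lift_groupoid A B G Y)) ?R"
    proof (rule refl_onI)
      fix P assume "P \<in> Obj (lift_groupoid A B G Y)"
      then show "(P, P) \<in> ?R"
        using Y fobj_closed by (cases P)
          (auto simp: lift_groupoid_def iff[unfolded lift_groupoid_def] farr_Ident
            intro!: bexI[of _ "Ident A (fst P)"] A.Ident_isos B.Ident_left B.isos_Arr)
    qed
    show "sym ?R"
      unfolding iso_rel_def sym_def isos_def by blast
    show "trans ?R"
    proof (rule transI)
      fix P Q S assume "(P, Q) \<in> ?R" "(Q, S) \<in> ?R"
      moreover obtain X b X' b' X'' b'' where e: "P = (X, b)" "Q = (X', b')" "S = (X'', b'')"
        by (cases P; cases Q; cases S)
      ultimately have *: "X \<in> Obj A" "X' \<in> Obj A" "X'' \<in> Obj A" "b \<in> isos B Y (fobj G X)"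
          "b'' \<in> isos B Y (fobj G X'')"
        and "\<exists>u \<in> isos A X X'. Comp B Y (fobj G X) (fobj G X') (farr G X X' u) b = b'"
        and "\<exists>u \<in> isos A X' X''. Comp B Y (fobj G X') (fobj G X'') (farr G X' X'' u) b' = b''"
        by (auto simp: iff)
      then obtain u v where u: "u \<in> isos A X X'" "v \<in> isos A X' X''"
        and c: "Comp B Y (fobj G X) (fobj G X') (farr G X X' u) b = b'"
          "Comp B Y (fobj G X') (fobj G X'') (farr G X' X'' v) b' = b''" by blast
      have "Comp B Y (fobj G X) (fobj G X'') (farr G X X'' (Comp A X X' X'' v u)) b = b''"
        unfolding c(2)[symmetric] c(1)[symmetric] using * u Y
        by (subst B.Comp_assoc)
          (auto simp: A.isos_Arr B.isos_Arr intro!: fobj_closed farr_closed farr_Comp arg_cong2[where f = "Comp B Y _ _"])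
      then show "(P, S) \<in> ?R"
        unfolding e iff using * A.Comp_isos[OF *(1-3) u] by blast
    qed
  qed
qed

section \<open>Affine structures from bijections\<close>

text \<open>
  Transport of the translation action of \<open>G\<close> on itself. The action is restricted to \<open>E\<close>, since
  the group of bijections of \<open>E\<close> consists of functions that are \<open>undefined\<close> outside \<open>E\<close>.
\<close>

lemma affine_over_if_bij_betw:
  assumes G: "comm_group G" and bij: "bij_betw \<psi> (carrier G) E"
  obtains \<phi> where "affine_over G E \<phi>"
    and "\<And>g h. \<lbrakk>g \<in> carrier G; h \<in> carrier G\<rbrakk> \<Longrightarrow> \<phi> g (\<psi> h) = \<psi> (g \<otimes>\<^bsub>G\<^esub> h)"
proof -
  interpret comm_group G by fact
  let ?i = "inv_into (carrier G) \<psi>"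
  define \<phi> where "\<phi> g = (\<lambda>x \<in> E. \<psi> (g \<otimes>\<^bsub>G\<^esub> ?i x))" for g
  have i: "?i x \<in> carrier G" "\<psi> (?i x) = x" if "x \<in> E" for x
    using bij that by (auto simp: bij_betw_def inv_into_into f_inv_into_f)
  have j: "\<psi> g \<in> E" "?i (\<psi> g) = g" if "g \<in> carrier G" for g
    using bij that by (auto simp: bij_betw_def inv_into_f_f)
  have \<phi>: "\<phi> g (\<psi> h) = \<psi> (g \<otimes>\<^bsub>G\<^esub> h)" if "g \<in> carrier G" "h \<in> carrier G" for g h
    using that j by (simp add: \<phi>_def)
  have cl: "\<phi> g x \<in> E" if "g \<in> carrier G" "x \<in> E" for g x
    using that i j by (simp add: \<phi>_def)
  have m: "\<phi> (g \<otimes>\<^bsub>G\<^esub> h) x = \<phi> g (\<phi> h x)" if "g \<in> carrier G" "h \<in> carrier G" "x \<in> E" for g h x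
    using that i j by (simp add: \<phi>_def m_assoc)
  have one: "\<phi> \<one>\<^bsub>G\<^esub> x = x" if "x \<in> E" for x using that i by (simp add: \<phi>_def)
  have b: "bij_betw (\<phi> g) E E" if g: "g \<in> carrier G" for g
  proof (rule bij_betw_byWitness[where f' = "\<phi> (inv\<^bsub>G\<^esub> g)"])
    show "\<forall>x \<in> E. \<phi> (inv\<^bsub>G\<^esub> g) (\<phi> g x) = x" "\<forall>x \<in> E. \<phi> g (\<phi> (inv\<^bsub>G\<^esub> g) x) = x"
      using g one by (simp_all flip: m)
  qed (use cl g in auto)
  have act: "group_action G E \<phi>"
  proof -
    have "\<phi> \<in> hom G (BijGroup E)"
    proof (rule homI)
      show "\<phi> g \<in> carrier (BijGroup E)" if "g \<in> carrier G" for g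
        using b[OF that] by (auto simp: BijGroup_def Bij_def \<phi>_def)
      then show "\<phi> (g \<otimes>\<^bsub>G\<^esub> h) = \<phi> g \<otimes>\<^bsub>BijGroup E\<^esub> \<phi> h" if "g \<in> carrier G" "h \<in> carrier G" for g h
        using that m by (auto simp: BijGroup_def compose_def restrict_def fun_eq_iff) (auto simp: \<phi>_def)
    qed
    then show ?thesis
      by (simp add: group_action_def group_hom_def group_hom_axioms_def group_BijGroup)
  qed
  have "\<exists>!g. g \<in> carrier G \<and> \<phi> g x = y" if xy: "x \<in> E" "y \<in> E" for x y
  proof -
    have "\<phi> g x = y \<longleftrightarrow> g = ?i y \<otimes>\<^bsub>G\<^esub> inv\<^bsub>G\<^esub> ?i x" if g: "g \<in> carrier G" for g
    proof -
      have "\<phi> g x = y \<longleftrightarrow> g \<otimes>\<^bsub>G\<^esub> ?i x = ?i y"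
        using xy g i j by (simp add: \<phi>_def) (metis m_closed)
      also have "\<dots> \<longleftrightarrow> g = ?i y \<otimes>\<^bsub>G\<^esub> inv\<^bsub>G\<^esub> ?i x"
        using xy g i by (metis inv_solve_right inv_closed)
      finally show ?thesis .
    qed
    then show ?thesis using xy i by (intro ex1I[of _ "?i y \<otimes>\<^bsub>G\<^esub> inv\<^bsub>G\<^esub> ?i x"]) auto
  qed
  moreover have "E \<noteq> {}" using bij_betw_imp_surj_on[OF bij] by auto
  ultimately have "affine_over G E \<phi>" using G act by (simp add: affine_over_def)
  then show ?thesis using \<phi> that by blast
qed

section \<open>Graded maps in a linear category\<close>

text \<open>
  The element \<open>(-1)\<^sup>n x\<close> of an abelian group that is written multiplicatively.
\<close>

definition signed :: "('a, 'b) monoid_scheme \<Rightarrow> int \<Rightarrow> 'a \<Rightarrow> 'a" where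
  "signed G n x = (if even n then x else inv\<^bsub>G\<^esub> x)"

lemma carrier_ghom_group [simp]: "carrier (ghom_group C X Y n) = ghom C X Y n"
  by (simp add: ghom_group_def)

lemma ghomD: "f \<in> ghom C X Y n \<Longrightarrow> f i \<in> Arr C (X i) (Y (i + n))"
  by (simp add: ghom_def)

text \<open>
  A composite of degree \<open>p + q\<close> ends in the object with index \<open>i + (p + q)\<close>, its second factor in
  the one with index \<open>(i + p) + q\<close>. This form of the typing rule matches the first.
\<close>

lemma ghomD_add: "f \<in> ghom C X Y n \<Longrightarrow> f (i + m) \<in> Arr C (X (i + m)) (Y (i + (m + n)))"
  using ghomD[of f C X Y n "i + m"] by (simp add: add.assoc)

lemma ghom_mult_apply:
  "(f \<otimes>\<^bsub>ghom_group C X Y n\<^esub> g) i = f i \<oplus>\<^bsub>Hmod C (X i) (Y (i + n))\<^esub> g i"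
  by (simp add: ghom_group_def)

lemma gobjsD: "X \<in> gobjs C \<Longrightarrow> X i \<in> Obj C"
  by (simp add: gobjs_def)

context category
begin

lemma gcomp_closed:
  assumes "X \<in> gobjs C" "Y \<in> gobjs C" "Z \<in> gobjs C"
    "f \<in> ghom C X Y p" "g \<in> ghom C Y Z q" "p + q = n"
  shows "gcomp C X Y Z p q g f \<in> ghom C X Z n"
  unfolding ghom_def gcomp_def assms(6)[symmetric]
  using assms(1-5) ghomD[of g C Y Z q "_ + p"]
  by (auto simp: gobjsD ghomD add.assoc intro!: Comp_closed)

lemma gident_closed: "X \<in> gobjs C \<Longrightarrow> gident C X \<in> ghom C X X 0"
  by (simp add: gident_def ghom_def gobjsD Ident_closed)

lemma gcomp_gident_left:
  "\<lbrakk>X \<in> gobjs C; Y \<in> gobjs C; f \<in> ghom C X Y p\<rbrakk> \<Longrightarrow> gcomp C X Y Y p 0 (gident C Y) f = f"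
  by (simp add: gcomp_def gident_def gobjsD ghomD Ident_left)

lemma gcomp_gident_right:
  "\<lbrakk>X \<in> gobjs C; Y \<in> gobjs C; f \<in> ghom C X Y p\<rbrakk> \<Longrightarrow> gcomp C X X Y 0 p f (gident C X) = f"
  by (simp add: gcomp_def gident_def gobjsD ghomD Ident_right)

text \<open>
  The equation \<open>q + r = m\<close> is a hypothesis, so that the rule also rewrites terms in which the
  simplifier has already evaluated the sum of two degrees. Several rules below take sums of
  degrees in this form for the same reason.
\<close>

lemma gcomp_assoc:
  assumes "W \<in> gobjs C" "X \<in> gobjs C" "Y \<in> gobjs C" "Z \<in> gobjs C"
    "f \<in> ghom C W X p" "g \<in> ghom C X Y q" "h \<in> ghom C Y Z r" "q + r = m"
  shows "gcomp C W X Z p m (gcomp C X Y Z q r h g) f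
       = gcomp C W Y Z (p + q) r h (gcomp C W X Y p q g f)"
proof
  fix i
  have "f i \<in> Arr C (W i) (X (i + p))" "g (i + p) \<in> Arr C (X (i + p)) (Y (i + p + q))"
    "h (i + p + q) \<in> Arr C (Y (i + p + q)) (Z (i + p + q + r))"
    using assms by (auto intro: ghomD)
  then show "gcomp C W X Z p m (gcomp C X Y Z q r h g) f i
       = gcomp C W Y Z (p + q) r h (gcomp C W X Y p q g f) i"
    using assms(1-4) Comp_assoc[of "W i" "X (i + p)" "Y (i + p + q)" "Z (i + p + q + r)"]
    by (simp add: gcomp_def gobjsD add.assoc flip: assms(8))
qed

end

context linear_category
begin

lemma abelian_group_Hmod: "\<lbrakk>X \<in> Obj C; Y \<in> Obj C\<rbrakk> \<Longrightarrow> abelian_group (Hmod C X Y)"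
  using Hmod_module by (rule module.axioms)

lemma comm_group_ghom:
  assumes "X \<in> gobjs C" "Y \<in> gobjs C"
  shows "comm_group (ghom_group C X Y n)"
proof (rule comm_groupI)
  have M: "abelian_group (Hmod C (X i) (Y j))" for i j
    using assms by (simp add: abelian_group_Hmod gobjsD)
  have c: "carrier (Hmod C (X i) (Y j)) = Arr C (X i) (Y j)" for i j
    using assms by (simp add: carrier_Hmod gobjsD)
  note A = abelian_groupE[OF M, unfolded c]
  show "\<one>\<^bsub>ghom_group C X Y n\<^esub> \<in> carrier (ghom_group C X Y n)"
    by (simp add: ghom_group_def ghom_def A(2))
  fix f assume "f \<in> carrier (ghom_group C X Y n)"
  then have f: "f i \<in> Arr C (X i) (Y (i + n))" for i by (auto intro: ghomD)
  show "\<one>\<^bsub>ghom_group C X Y n\<^esub> \<otimes>\<^bsub>ghom_group C X Y n\<^esub> f = f"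
    by (simp add: ghom_group_def A(5) f)
  have "\<forall>i. \<exists>y. y \<in> Arr C (X i) (Y (i + n)) \<and>
      y \<oplus>\<^bsub>Hmod C (X i) (Y (i + n))\<^esub> f i = \<zero>\<^bsub>Hmod C (X i) (Y (i + n))\<^esub>"
    using A(6)[OF f] by blast
  then obtain y where y: "\<And>i. y i \<in> Arr C (X i) (Y (i + n))"
    "\<And>i. y i \<oplus>\<^bsub>Hmod C (X i) (Y (i + n))\<^esub> f i = \<zero>\<^bsub>Hmod C (X i) (Y (i + n))\<^esub>" by metis
  show "\<exists>y \<in> carrier (ghom_group C X Y n). y \<otimes>\<^bsub>ghom_group C X Y n\<^esub> f = \<one>\<^bsub>ghom_group C X Y n\<^esub>"
    by (rule bexI[of _ y]) (simp_all add: ghom_group_def ghom_def y)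
  fix g assume "g \<in> carrier (ghom_group C X Y n)"
  then have g: "g i \<in> Arr C (X i) (Y (i + n))" for i by (auto intro: ghomD)
  show "f \<otimes>\<^bsub>ghom_group C X Y n\<^esub> g \<in> carrier (ghom_group C X Y n)"
    by (simp add: ghom_group_def ghom_def A(1) f g)
  show "f \<otimes>\<^bsub>ghom_group C X Y n\<^esub> g = g \<otimes>\<^bsub>ghom_group C X Y n\<^esub> f"
    by (simp add: ghom_group_def A(4)[of "f _"] f g)
  fix h assume "h \<in> carrier (ghom_group C X Y n)"
  then have h: "h i \<in> Arr C (X i) (Y (i + n))" for i by (auto intro: ghomD)
  show "f \<otimes>\<^bsub>ghom_group C X Y n\<^esub> g \<otimes>\<^bsub>ghom_group C X Y n\<^esub> h =
      f \<otimes>\<^bsub>ghom_group C X Y n\<^esub> (g \<otimes>\<^bsub>ghom_group C X Y n\<^esub> h)"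
    by (simp add: ghom_group_def A(3) f g h)
qed

lemmas group_ghom = comm_group.axioms(2)[OF comm_group_ghom]
lemmas monoid_ghom = group.is_monoid[OF group_ghom]

lemmas ghom_mult_closed = monoid.m_closed[OF monoid_ghom, unfolded carrier_ghom_group]
lemmas ghom_one_closed = monoid.one_closed[OF monoid_ghom, unfolded carrier_ghom_group]
lemmas ghom_inv_closed = group.inv_closed[OF group_ghom, unfolded carrier_ghom_group]
lemmas ghom_closed = ghom_mult_closed ghom_one_closed ghom_inv_closed gcomp_closed gident_closed

lemmas ghom_group_simps =
  monoid.m_assoc[OF monoid_ghom] monoid.l_one[OF monoid_ghom] monoid.r_one[OF monoid_ghom]
  group.l_inv[OF group_ghom] group.r_inv[OF group_ghom] group.inv_inv[OF group_ghom]
  comm_group.inv_mult[OF comm_group_ghom]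
  monoid.inv_one[OF monoid_ghom]

lemma ghom_cancel:
  assumes "X \<in> gobjs C" "Y \<in> gobjs C" "f \<in> ghom C X Y n" "g \<in> ghom C X Y n"
  shows "f \<otimes>\<^bsub>ghom_group C X Y n\<^esub> (inv\<^bsub>ghom_group C X Y n\<^esub> f \<otimes>\<^bsub>ghom_group C X Y n\<^esub> g) = g"
    "inv\<^bsub>ghom_group C X Y n\<^esub> f \<otimes>\<^bsub>ghom_group C X Y n\<^esub> (f \<otimes>\<^bsub>ghom_group C X Y n\<^esub> g) = g"
  using assms
  by (simp_all add: ghom_closed ghom_group_simps(2,4,5) flip: ghom_group_simps(1))

lemmas ghom_m_comm =
  comm_monoid.m_comm[OF comm_group.axioms(1)[OF comm_group_ghom], unfolded carrier_ghom_group]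
lemmas ghom_m_lcomm =
  comm_monoid.m_lcomm[OF comm_group.axioms(1)[OF comm_group_ghom], unfolded carrier_ghom_group]

lemma inv_ghom:
  assumes "X \<in> gobjs C" "Y \<in> gobjs C" "f \<in> ghom C X Y n"
  shows "inv\<^bsub>ghom_group C X Y n\<^esub> f = (\<lambda>i. \<ominus>\<^bsub>Hmod C (X i) (Y (i + n))\<^esub> f i)"
proof (rule group.inv_equality[OF group_ghom[OF assms(1,2)]])
  have M: "abelian_group (Hmod C (X i) (Y j))" for i j
    using assms by (simp add: abelian_group_Hmod gobjsD)
  have c: "f i \<in> carrier (Hmod C (X i) (Y (i + n)))" for i
    using assms by (simp add: carrier_Hmod gobjsD ghomD)
  then show "(\<lambda>i. \<ominus>\<^bsub>Hmod C (X i) (Y (i + n))\<^esub> f i) \<otimes>\<^bsub>ghom_group C X Y n\<^esub> f = \<one>\<^bsub>ghom_group C X Y n\<^esub>"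
    using abelian_group.l_neg[OF M] by (simp add: ghom_group_def)
  have "\<ominus>\<^bsub>Hmod C (X i) (Y (i + n))\<^esub> f i \<in> carrier (Hmod C (X i) (Y (i + n)))" for i
    using abelian_group.a_inv_closed[OF M c] .
  then show "(\<lambda>i. \<ominus>\<^bsub>Hmod C (X i) (Y (i + n))\<^esub> f i) \<in> carrier (ghom_group C X Y n)"
    using assms by (simp add: ghom_def carrier_Hmod gobjsD)
qed (use assms in simp)

lemma gcomp_mult_left:
  assumes "X \<in> gobjs C" "Y \<in> gobjs C" "Z \<in> gobjs C"
    "f \<in> ghom C X Y p" "g \<in> ghom C Y Z q" "g' \<in> ghom C Y Z q"
  shows "gcomp C X Y Z p q (g \<otimes>\<^bsub>ghom_group C Y Z q\<^esub> g') f
       = gcomp C X Y Z p q g f \<otimes>\<^bsub>ghom_group C X Z (p + q)\<^esub> gcomp C X Y Z p q g' f"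
  using assms by (simp add: ghom_group_def gcomp_def Comp_add_left gobjsD ghomD ghomD_add add.assoc)

lemma gcomp_mult_right:
  assumes "X \<in> gobjs C" "Y \<in> gobjs C" "Z \<in> gobjs C"
    "f \<in> ghom C X Y p" "f' \<in> ghom C X Y p" "g \<in> ghom C Y Z q"
  shows "gcomp C X Y Z p q g (f \<otimes>\<^bsub>ghom_group C X Y p\<^esub> f')
       = gcomp C X Y Z p q g f \<otimes>\<^bsub>ghom_group C X Z (p + q)\<^esub> gcomp C X Y Z p q g f'"
  using assms by (simp add: ghom_group_def gcomp_def Comp_add_right gobjsD ghomD ghomD_add add.assoc)

lemma group_hom_gcomp_left:
  assumes "X \<in> gobjs C" "Y \<in> gobjs C" "Z \<in> gobjs C" "f \<in> ghom C X Y p"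
  shows "group_hom (ghom_group C Y Z q) (ghom_group C X Z (p + q)) (\<lambda>g. gcomp C X Y Z p q g f)"
  using assms
  by (auto simp: group_hom_def group_hom_axioms_def group_ghom gcomp_mult_left gcomp_closed intro!: homI)

lemma group_hom_gcomp_right:
  assumes "X \<in> gobjs C" "Y \<in> gobjs C" "Z \<in> gobjs C" "g \<in> ghom C Y Z q"
  shows "group_hom (ghom_group C X Y p) (ghom_group C X Z (p + q)) (gcomp C X Y Z p q g)"
  using assms
  by (auto simp: group_hom_def group_hom_axioms_def group_ghom gcomp_mult_right gcomp_closed intro!: homI)

lemmas gcomp_one_left = group_hom.hom_one[OF group_hom_gcomp_left]
lemmas gcomp_one_right = group_hom.hom_one[OF group_hom_gcomp_right]
lemmas gcomp_inv_left = group_hom.hom_inv[OF group_hom_gcomp_left, unfolded carrier_ghom_group]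
lemmas gcomp_inv_right = group_hom.hom_inv[OF group_hom_gcomp_right, unfolded carrier_ghom_group]

lemmas gcomp_additive = gcomp_mult_left gcomp_mult_right gcomp_one_left gcomp_one_right
  gcomp_inv_left gcomp_inv_right

text \<open>
  The pointwise definition of \<open>\<delta>\<close> as an identity in \<open>Hom\<^sup>n\<^sup>+\<^sup>1\<close>. All later calculations use this
  form together with the bilinearity and associativity of composition.
\<close>

lemma gdiff_eq:
  assumes "X \<in> gobjs C" "Y \<in> gobjs C" "dX \<in> ghom C X X 1" "dY \<in> ghom C Y Y 1" "f \<in> ghom C X Y n"
  shows "gdiff C (X, dX) (Y, dY) n f = gcomp C X Y Y n 1 dY f \<otimes>\<^bsub>ghom_group C X Y (n + 1)\<^esub>
    signed (ghom_group C X Y (n + 1)) (n + 1) (gcomp C X X Y 1 n f dX)"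
proof -
  have "gcomp C X X Y 1 n f dX \<in> ghom C X Y (n + 1)" using assms by (simp add: gcomp_closed)
  then show ?thesis
    using assms
    by (auto simp: gdiff_def signed_def inv_ghom a_minus_def Let_def ghom_mult_apply add.assoc)
qed

lemma gdiff_closed:
  assumes "X \<in> gobjs C" "Y \<in> gobjs C" "dX \<in> ghom C X X 1" "dY \<in> ghom C Y Y 1" "f \<in> ghom C X Y n"
    "n + 1 = m"
  shows "gdiff C (X, dX) (Y, dY) n f \<in> ghom C X Y m"
  using assms by (auto simp: gdiff_eq signed_def ghom_closed)

lemma gdiff_mult:
  assumes "X \<in> gobjs C" "Y \<in> gobjs C" "dX \<in> ghom C X X 1" "dY \<in> ghom C Y Y 1"
    "f \<in> ghom C X Y n" "g \<in> ghom C X Y n"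
  shows "gdiff C (X, dX) (Y, dY) n (f \<otimes>\<^bsub>ghom_group C X Y n\<^esub> g)
    = gdiff C (X, dX) (Y, dY) n f \<otimes>\<^bsub>ghom_group C X Y (n + 1)\<^esub> gdiff C (X, dX) (Y, dY) n g"
  using assms
  by (simp add: gdiff_eq signed_def ghom_closed gcomp_additive ghom_group_simps ghom_m_comm
      ghom_m_lcomm add.commute[of 1])

lemma group_hom_gdiff:
  assumes "X \<in> gobjs C" "Y \<in> gobjs C" "dX \<in> ghom C X X 1" "dY \<in> ghom C Y Y 1"
  shows "group_hom (ghom_group C X Y n) (ghom_group C X Y (n + 1)) (gdiff C (X, dX) (Y, dY) n)"
  using assms
  by (auto simp: group_hom_def group_hom_axioms_def group_ghom gdiff_mult gdiff_closed intro!: homI)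

lemmas gdiff_one = group_hom.hom_one[OF group_hom_gdiff]
lemmas gdiff_inv = group_hom.hom_inv[OF group_hom_gdiff, unfolded carrier_ghom_group]
lemmas gdiff_additive = gdiff_mult gdiff_one gdiff_inv

text \<open>
  The Leibniz rule \<open>\<delta>(g f) = \<delta>(g) f + (-1)\<^sup>q g \<delta>(f)\<close>: the middle terms \<open>g dY f\<close> cancel, whatever
  the endomorphism \<open>dY\<close> is. It therefore applies to lifts of differentials, which need not
  have square zero.
\<close>

lemma gdiff_gcomp:
  assumes "X \<in> gobjs C" "Y \<in> gobjs C" "Z \<in> gobjs C"
    "dX \<in> ghom C X X 1" "dY \<in> ghom C Y Y 1" "dZ \<in> ghom C Z Z 1"
    "f \<in> ghom C X Y p" "g \<in> ghom C Y Z q" "p + q = n"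
  shows "gdiff C (X, dX) (Z, dZ) n (gcomp C X Y Z p q g f) =
    gcomp C X Y Z p (q + 1) (gdiff C (Y, dY) (Z, dZ) q g) f \<otimes>\<^bsub>ghom_group C X Z (n + 1)\<^esub>
    signed (ghom_group C X Z (n + 1)) q (gcomp C X Y Z (p + 1) q g (gdiff C (X, dX) (Y, dY) p f))"
  unfolding assms(9)[symmetric] using assms(1-8)
  by (auto simp: gdiff_eq signed_def ghom_closed gcomp_additive ghom_group_simps ghom_cancel
      gcomp_assoc algebra_simps)

text \<open>
  The mixed terms \<open>dY f dX\<close> occur with opposite signs and cancel; what remains is the curvature
  term \<open>dY\<^sup>2 f - f dX\<^sup>2\<close>, which is where the obstruction class enters.
\<close>

lemma gdiff_gdiff:
  assumes "X \<in> gobjs C" "Y \<in> gobjs C" "dX \<in> ghom C X X 1" "dY \<in> ghom C Y Y 1" "f \<in> ghom C X Y n"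
  shows "gdiff C (X, dX) (Y, dY) (n + 1) (gdiff C (X, dX) (Y, dY) n f) =
    gcomp C X Y Y n 2 (gcomp C Y Y Y 1 1 dY dY) f \<otimes>\<^bsub>ghom_group C X Y (n + 2)\<^esub>
    inv\<^bsub>ghom_group C X Y (n + 2)\<^esub> gcomp C X X Y 2 n f (gcomp C X X X 1 1 dX dX)"
  using assms
  by (auto simp: gdiff_eq signed_def ghom_closed gcomp_additive ghom_group_simps ghom_cancel
      gcomp_assoc algebra_simps)

lemma gdiff_gident:
  assumes "X \<in> gobjs C" "dX \<in> ghom C X X 1"
  shows "gdiff C (X, dX) (X, dX) 0 (gident C X) = \<one>\<^bsub>ghom_group C X X 1\<^esub>"
  using assms
  by (simp add: gdiff_eq signed_def ghom_closed gcomp_gident_left gcomp_gident_right ghom_group_simps)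

end

section \<open>The homotopy category\<close>

definition chain_map ::
  "('o, 'm, 'k) lincat \<Rightarrow> (int \<Rightarrow> 'o) \<times> (int \<Rightarrow> 'm) \<Rightarrow> (int \<Rightarrow> 'o) \<times> (int \<Rightarrow> 'm) \<Rightarrow> (int \<Rightarrow> 'm) \<Rightarrow> bool"
  where "chain_map C P Q f \<longleftrightarrow>
    f \<in> ghom C (fst P) (fst Q) 0 \<and> gdiff C P Q 0 f = \<one>\<^bsub>ghom_group C (fst P) (fst Q) 1\<^esub>"

lemma cocycles_0_eq:
  "cocycles (ghom_group C (fst P) (fst Q)) (gdiff C P Q) 0 = {f. chain_map C P Q f}"
  by (simp add: cocycles_def chain_map_def)

context linear_category
begin

lemma complexesD:
  assumes "(X, dX) \<in> complexes C"
  shows "X \<in> gobjs C" "dX \<in> ghom C X X 1" "gcomp C X X X 1 1 dX dX = \<one>\<^bsub>ghom_group C X X 2\<^esub>"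
  using assms by (auto simp: complexes_def)

lemma gdiff_gdiff_complex:
  assumes P: "(X, dX) \<in> complexes C" and Q: "(Y, dY) \<in> complexes C" and f: "f \<in> ghom C X Y n"
    and "n + 1 = m"
  shows "gdiff C (X, dX) (Y, dY) m (gdiff C (X, dX) (Y, dY) n f) = \<one>\<^bsub>ghom_group C X Y (m + 1)\<^esub>"
  using complexesD[OF P] complexesD[OF Q] f
  by (auto simp: gdiff_gdiff gcomp_additive ghom_group_simps ghom_closed add.commute[of 2]
      simp flip: assms(4))

lemma cochain_complex_ghom:
  assumes P: "P \<in> complexes C" and Q: "Q \<in> complexes C"
  shows "cochain_complex (ghom_group C (fst P) (fst Q)) (gdiff C P Q)"
proof -
  obtain X dX Y dY where e: "P = (X, dX)" "Q = (Y, dY)" by (cases P; cases Q)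
  note D = complexesD[OF P[unfolded e]] complexesD[OF Q[unfolded e]]
  show ?thesis
    using D gdiff_gdiff_complex[OF P[unfolded e] Q[unfolded e]]
    by (intro cochain_complex.intro) (auto simp: e comm_group_ghom gdiff_closed gdiff_mult intro!: homI)
qed

lemma chain_map_gcomp:
  assumes "P \<in> complexes C" "Q \<in> complexes C" "T \<in> complexes C"
    "chain_map C P Q f" "chain_map C Q T g"
  shows "chain_map C P T (gcomp C (fst P) (fst Q) (fst T) 0 0 g f)"
proof -
  obtain X dX Y dY Z dZ where e: "P = (X, dX)" "Q = (Y, dY)" "T = (Z, dZ)"
    by (cases P; cases Q; cases T)
  note D = assms[unfolded e chain_map_def fst_conv]
  show ?thesis
    using complexesD[OF D(1)] complexesD[OF D(2)] complexesD[OF D(3)] D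
    by (simp add: e chain_map_def ghom_closed gdiff_gcomp signed_def gcomp_additive ghom_group_simps)
qed

lemma chain_map_gident: "P \<in> complexes C \<Longrightarrow> chain_map C P P (gident C (fst P))"
  by (cases P) (auto simp: complexes_def chain_map_def gdiff_gident gident_closed)

lemma hclass_eq_iff:
  assumes "P \<in> complexes C" "Q \<in> complexes C" "chain_map C P Q f" "chain_map C P Q g"
  shows "hclass C P Q f = hclass C P Q g \<longleftrightarrow>
    (\<exists>s \<in> ghom C (fst P) (fst Q) (- 1). f = gdiff C P Q (- 1) s \<otimes>\<^bsub>ghom_group C (fst P) (fst Q) 0\<^esub> g)"
  using cochain_complex.coh_class_eq_iff[OF cochain_complex_ghom[OF assms(1,2)], of f 0 g] assms(3,4)
  by (simp add: hclass_def cocycles_0_eq)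

lemma mem_hclass:
  assumes "P \<in> complexes C" "Q \<in> complexes C" "chain_map C P Q f"
  shows "g \<in> hclass C P Q f \<longleftrightarrow> chain_map C P Q g \<and> hclass C P Q g = hclass C P Q f"
proof -
  interpret H: cochain_complex "ghom_group C (fst P) (fst Q)" "gdiff C P Q"
    by (rule cochain_complex_ghom) fact+
  have f: "f \<in> cocycles (ghom_group C (fst P) (fst Q)) (gdiff C P Q) 0"
    using assms by (simp add: cocycles_0_eq)
  show ?thesis
    using H.mem_coh_class[of g 0 f] H.coh_class_eq_iff[OF _ f, of g] H.coh_class_subset[OF f]
    unfolding hclass_def using cocycles_0_eq by blast
qed

lemma Arr_homotopy_cat:
  assumes "P \<in> complexes C" "Q \<in> complexes C"
  shows "Arr (homotopy_cat C) P Q = hclass C P Q ` {f. chain_map C P Q f}"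
  using cochain_complex.carrier_cohomology[OF cochain_complex_ghom[OF assms]]
  by (simp add: homotopy_cat_def hclass_def cocycles_0_eq)

text \<open>
  If \<open>f' = \<delta>(s) + f\<close> and \<open>g' = \<delta>(t) + g\<close> are chain maps, then
  \<open>g' f' - g f = \<delta>(t) f' + g \<delta>(s) = \<delta>(t f' + g s)\<close> by the Leibniz rule.
\<close>

lemma hclass_gcomp_cong:
  assumes "P \<in> complexes C" "Q \<in> complexes C" "T \<in> complexes C"
    and "chain_map C P Q f" "chain_map C P Q f'" "hclass C P Q f' = hclass C P Q f"
    and "chain_map C Q T g" "chain_map C Q T g'" "hclass C Q T g' = hclass C Q T g"
  shows "hclass C P T (gcomp C (fst P) (fst Q) (fst T) 0 0 g' f')
       = hclass C P T (gcomp C (fst P) (fst Q) (fst T) 0 0 g f)"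
proof -
  obtain X dX Y dY Z dZ where e: "P = (X, dX)" "Q = (Y, dY)" "T = (Z, dZ)"
    by (cases P; cases Q; cases T)
  obtain s where s: "s \<in> ghom C X Y (- 1)"
    and f': "f' = gdiff C P Q (- 1) s \<otimes>\<^bsub>ghom_group C X Y 0\<^esub> f"
    using assms hclass_eq_iff[of P Q f' f] by (auto simp: e)
  obtain t where t: "t \<in> ghom C Y Z (- 1)"
    and g': "g' = gdiff C Q T (- 1) t \<otimes>\<^bsub>ghom_group C Y Z 0\<^esub> g"
    using assms hclass_eq_iff[of Q T g' g] by (auto simp: e)
  note D = complexesD[OF assms(1)[unfolded e]] complexesD[OF assms(2)[unfolded e]]
    complexesD[OF assms(3)[unfolded e]]
  \<comment> \<open>A homotopy from \<open>g f\<close> to \<open>g' f'\<close>.\<close>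
  let ?r = "gcomp C X Y Z 0 (- 1) t f' \<otimes>\<^bsub>ghom_group C X Z (- 1)\<^esub> gcomp C X Y Z (- 1) 0 g s"
  have c: "f \<in> ghom C X Y 0" "g \<in> ghom C Y Z 0" "f' \<in> ghom C X Y 0" "g' \<in> ghom C Y Z 0"
    "gdiff C P Q (- 1) s \<in> ghom C X Y 0" "gdiff C Q T (- 1) t \<in> ghom C Y Z 0"
    "gdiff C P Q 0 f' = \<one>\<^bsub>ghom_group C X Y 1\<^esub>" "gdiff C Q T 0 g = \<one>\<^bsub>ghom_group C Y Z 1\<^esub>"
    using assms D s t by (auto simp: e chain_map_def intro!: gdiff_closed)
  have r: "?r \<in> ghom C X Z (- 1)" using D c s t by (simp add: ghom_closed)
  have "gdiff C P T (- 1) ?r = gcomp C X Y Z 0 0 (gdiff C Q T (- 1) t) f'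
      \<otimes>\<^bsub>ghom_group C X Z 0\<^esub> gcomp C X Y Z 0 0 g (gdiff C P Q (- 1) s)"
    using D c[unfolded e] s t
    by (simp add: e gdiff_additive gdiff_gcomp ghom_closed signed_def gcomp_additive ghom_group_simps)
  moreover have "gcomp C X Y Z 0 0 g' f' = gcomp C X Y Z 0 0 (gdiff C Q T (- 1) t) f'
      \<otimes>\<^bsub>ghom_group C X Z 0\<^esub> (gcomp C X Y Z 0 0 g (gdiff C P Q (- 1) s)
      \<otimes>\<^bsub>ghom_group C X Z 0\<^esub> gcomp C X Y Z 0 0 g f)"
  proof -
    have "gcomp C X Y Z 0 0 g' f' = gcomp C X Y Z 0 0 (gdiff C Q T (- 1) t) f'
        \<otimes>\<^bsub>ghom_group C X Z 0\<^esub> gcomp C X Y Z 0 0 g f'"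
      using D c by (simp add: g' gcomp_mult_left)
    also have "gcomp C X Y Z 0 0 g f' = gcomp C X Y Z 0 0 g (gdiff C P Q (- 1) s)
        \<otimes>\<^bsub>ghom_group C X Z 0\<^esub> gcomp C X Y Z 0 0 g f"
      using D c by (simp add: f' gcomp_mult_right)
    finally show ?thesis .
  qed
  ultimately have "gcomp C X Y Z 0 0 g' f' =
      gdiff C P T (- 1) ?r \<otimes>\<^bsub>ghom_group C X Z 0\<^esub> gcomp C X Y Z 0 0 g f"
    using D c by (simp add: ghom_group_simps ghom_closed)
  from this r have "\<exists>s \<in> ghom C (fst P) (fst T) (- 1).
      gcomp C (fst P) (fst Q) (fst T) 0 0 g' f' = gdiff C P T (- 1) s
        \<otimes>\<^bsub>ghom_group C (fst P) (fst T) 0\<^esub> gcomp C (fst P) (fst Q) (fst T) 0 0 g f"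
    unfolding e fst_conv by (rule bexI)
  moreover have "chain_map C P T (gcomp C (fst P) (fst Q) (fst T) 0 0 g' f')"
    "chain_map C P T (gcomp C (fst P) (fst Q) (fst T) 0 0 g f)"
    using chain_map_gcomp[OF assms(1-3)] assms by blast+
  ultimately show ?thesis
    using hclass_eq_iff[OF assms(1,3)] by blast
qed

text \<open>
  The union that defines composition runs over equal classes, so it can be computed on any
  representatives.
\<close>

lemma Comp_homotopy_cat:
  assumes "P \<in> complexes C" "Q \<in> complexes C" "T \<in> complexes C"
    and f: "chain_map C P Q f" and g: "chain_map C Q T g"
  shows "Comp (homotopy_cat C) P Q T (hclass C Q T g) (hclass C P Q f)
       = hclass C P T (gcomp C (fst P) (fst Q) (fst T) 0 0 g f)"
proof -
  have "hclass C P T (gcomp C (fst P) (fst Q) (fst T) 0 0 g' f')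
      = hclass C P T (gcomp C (fst P) (fst Q) (fst T) 0 0 g f)"
    if "g' \<in> hclass C Q T g" "f' \<in> hclass C P Q f" for g' f'
    using that assms by (intro hclass_gcomp_cong[of P Q T f f' g g']) (simp_all add: mem_hclass)
  moreover have "g \<in> hclass C Q T g" "f \<in> hclass C P Q f" using assms by (simp_all add: mem_hclass)
  ultimately have "(\<Union>f' \<in> hclass C P Q f. hclass C P T (gcomp C (fst P) (fst Q) (fst T) 0 0 g' f'))
      = hclass C P T (gcomp C (fst P) (fst Q) (fst T) 0 0 g f)" if "g' \<in> hclass C Q T g" for g'
    using that by (intro UN_constant_eq[of f]) blast+
  then show ?thesis
    unfolding homotopy_cat_def cat.simps
    using \<open>g \<in> hclass C Q T g\<close> by (intro UN_constant_eq[of g]) blast+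
qed

lemma homotopy_cat_simps:
  "Obj (homotopy_cat C) = complexes C"
  "Ident (homotopy_cat C) P = hclass C P P (gident C (fst P))"
  by (simp_all add: homotopy_cat_def)

lemma category_homotopy_cat: "category (homotopy_cat C)"
proof
  fix P Q assume PQ: "P \<in> Obj (homotopy_cat C)" "Q \<in> Obj (homotopy_cat C)"
  then have PQ': "P \<in> complexes C" "Q \<in> complexes C" "fst P \<in> gobjs C" "fst Q \<in> gobjs C"
    by (auto simp: homotopy_cat_simps complexes_def)
  show "Ident (homotopy_cat C) P \<in> Arr (homotopy_cat C) P P"
    using PQ' by (simp add: homotopy_cat_simps Arr_homotopy_cat chain_map_gident)
  {
    fix f assume "f \<in> Arr (homotopy_cat C) P Q"
    then obtain f' where f: "f = hclass C P Q f'" "chain_map C P Q f'"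
      using PQ' by (auto simp: Arr_homotopy_cat)
    then have "f' \<in> ghom C (fst P) (fst Q) 0" by (simp add: chain_map_def)
    then show "Comp (homotopy_cat C) P Q Q (Ident (homotopy_cat C) Q) f = f"
      "Comp (homotopy_cat C) P P Q f (Ident (homotopy_cat C) P) = f"
      using PQ' f
      by (simp_all add: homotopy_cat_simps Comp_homotopy_cat chain_map_gident gcomp_gident_left
          gcomp_gident_right)
  }
  fix T assume T: "T \<in> Obj (homotopy_cat C)"
  then have T': "T \<in> complexes C" "fst T \<in> gobjs C" by (auto simp: homotopy_cat_simps complexes_def)
  show "Comp (homotopy_cat C) P Q T g f \<in> Arr (homotopy_cat C) P T"
    if "f \<in> Arr (homotopy_cat C) P Q" "g \<in> Arr (homotopy_cat C) Q T" for f g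
    using that PQ' T' by (auto simp: Arr_homotopy_cat Comp_homotopy_cat chain_map_gcomp)
  fix S assume "S \<in> Obj (homotopy_cat C)"
  then have S': "S \<in> complexes C" "fst S \<in> gobjs C" by (auto simp: homotopy_cat_simps complexes_def)
  fix f g h
  assume "f \<in> Arr (homotopy_cat C) P Q" "g \<in> Arr (homotopy_cat C) Q T" "h \<in> Arr (homotopy_cat C) T S"
  then obtain f' g' h' where *: "f = hclass C P Q f'" "chain_map C P Q f'"
    "g = hclass C Q T g'" "chain_map C Q T g'" "h = hclass C T S h'" "chain_map C T S h'"
    using PQ' T' S' by (auto simp: Arr_homotopy_cat)
  moreover have "f' \<in> ghom C (fst P) (fst Q) 0" "g' \<in> ghom C (fst Q) (fst T) 0"
    "h' \<in> ghom C (fst T) (fst S) 0" using * by (simp_all add: chain_map_def)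
  ultimately show "Comp (homotopy_cat C) P T S h (Comp (homotopy_cat C) P Q T g f) =
      Comp (homotopy_cat C) P Q S (Comp (homotopy_cat C) Q T S h g) f"
    using PQ' T' S' by (simp add: Comp_homotopy_cat chain_map_gcomp gcomp_assoc)
qed

end

section \<open>Functors on graded maps and on homotopy categories\<close>

locale linear_functor =
  A: linear_category RA A + B: linear_category RB B + additive_functor A B F
  for RA :: "'k ring" and A :: "('o, 'm, 'k) lincat"
    and RB :: "'l ring" and B :: "('p, 'n, 'l) lincat" and F :: "('o, 'm, 'p, 'n) fctr"
begin

lemma gobj_map_closed: "X \<in> gobjs A \<Longrightarrow> gobj_map F X \<in> gobjs B"
  by (simp add: gobjs_def gobj_map_def fobj_closed)

lemma garr_map_closed:
  "\<lbrakk>X \<in> gobjs A; Y \<in> gobjs A; f \<in> ghom A X Y n\<rbrakk>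
    \<Longrightarrow> garr_map F X Y n f \<in> ghom B (gobj_map F X) (gobj_map F Y) n"
  by (simp add: ghom_def garr_map_def gobj_map_def farr_closed gobjsD)

lemma garr_map_gident: "X \<in> gobjs A \<Longrightarrow> garr_map F X X 0 (gident A X) = gident B (gobj_map F X)"
  by (simp add: garr_map_def gident_def gobj_map_def farr_Ident gobjsD)

lemma garr_map_gcomp:
  assumes "X \<in> gobjs A" "Y \<in> gobjs A" "Z \<in> gobjs A" "f \<in> ghom A X Y p" "g \<in> ghom A Y Z q" "p + q = n"
  shows "garr_map F X Z n (gcomp A X Y Z p q g f) =
    gcomp B (gobj_map F X) (gobj_map F Y) (gobj_map F Z) p q (garr_map F Y Z q g) (garr_map F X Y p f)"
  unfolding assms(6)[symmetric] using assms(1-5)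
  by (simp add: garr_map_def gcomp_def gobj_map_def gobjsD ghomD ghomD_add farr_Comp add.assoc)

lemma garr_map_mult:
  assumes "X \<in> gobjs A" "Y \<in> gobjs A" "f \<in> ghom A X Y n" "g \<in> ghom A X Y n"
  shows "garr_map F X Y n (f \<otimes>\<^bsub>ghom_group A X Y n\<^esub> g) =
    garr_map F X Y n f \<otimes>\<^bsub>ghom_group B (gobj_map F X) (gobj_map F Y) n\<^esub> garr_map F X Y n g"
  using assms by (simp add: garr_map_def ghom_group_def gobj_map_def farr_add gobjsD ghomD)

lemma group_hom_garr_map:
  assumes "X \<in> gobjs A" "Y \<in> gobjs A"
  shows "group_hom (ghom_group A X Y n) (ghom_group B (gobj_map F X) (gobj_map F Y) n) (garr_map F X Y n)"
  using assms
  by (auto simp: group_hom_def group_hom_axioms_def A.group_ghom B.group_ghom garr_map_mult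
      gobj_map_closed garr_map_closed intro!: homI)

lemmas garr_map_one = group_hom.hom_one[OF group_hom_garr_map]
lemmas garr_map_inv = group_hom.hom_inv[OF group_hom_garr_map, unfolded carrier_ghom_group]
lemmas garr_map_additive = garr_map_mult garr_map_one garr_map_inv

lemma garr_map_gdiff:
  assumes "X \<in> gobjs A" "Y \<in> gobjs A" "dX \<in> ghom A X X 1" "dY \<in> ghom A Y Y 1" "f \<in> ghom A X Y n"
    "n + 1 = m"
  shows "garr_map F X Y m (gdiff A (X, dX) (Y, dY) n f) =
    gdiff B (complex_map F (X, dX)) (complex_map F (Y, dY)) n (garr_map F X Y n f)"
  unfolding assms(6)[symmetric] using assms(1-5)
  by (simp add: complex_map_def A.gdiff_eq B.gdiff_eq gobj_map_closed garr_map_closed garr_map_additive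
      A.ghom_closed garr_map_gcomp signed_def)

lemma complex_map_closed:
  assumes "P \<in> complexes A"
  shows "complex_map F P \<in> complexes B"
  using assms
  by (auto simp: complexes_def complex_map_def gobj_map_closed garr_map_closed garr_map_one
      simp flip: garr_map_gcomp)

lemma fst_complex_map: "fst (complex_map F P) = gobj_map F (fst P)"
  by (simp add: complex_map_def split: prod.split)

lemma chain_map_garr_map:
  assumes "P \<in> complexes A" "Q \<in> complexes A" "chain_map A P Q f"
  shows "chain_map B (complex_map F P) (complex_map F Q) (garr_map F (fst P) (fst Q) 0 f)"
  using assms
  by (cases P; cases Q)
     (auto simp: complexes_def chain_map_def fst_complex_map garr_map_closed garr_map_one
       simp flip: garr_map_gdiff[where n = 0 and m = 1])

lemma farr_homotopy_functor:
  assumes "P \<in> complexes A" "Q \<in> complexes A" "chain_map A P Q f"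
  shows "farr (homotopy_functor B F) P Q (hclass A P Q f) =
    hclass B (complex_map F P) (complex_map F Q) (garr_map F (fst P) (fst Q) 0 f)"
proof -
  have "hclass B (complex_map F P) (complex_map F Q) (garr_map F (fst P) (fst Q) 0 g)
      = hclass B (complex_map F P) (complex_map F Q) (garr_map F (fst P) (fst Q) 0 f)"
    if g: "chain_map A P Q g" "hclass A P Q g = hclass A P Q f" for g
  proof -
    obtain X dX Y dY where e: "P = (X, dX)" "Q = (Y, dY)" by (cases P; cases Q)
    note D = A.complexesD[OF assms(1)[unfolded e]] A.complexesD[OF assms(2)[unfolded e]]
    obtain s where s: "s \<in> ghom A X Y (- 1)" "g = gdiff A P Q (- 1) s \<otimes>\<^bsub>ghom_group A X Y 0\<^esub> f"
      using A.hclass_eq_iff[of P Q g f] assms g by (auto simp: e)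
    have f: "f \<in> ghom A X Y 0" using assms by (simp add: e chain_map_def)
    have "garr_map F X Y 0 g = gdiff B (complex_map F P) (complex_map F Q) (- 1) (garr_map F X Y (- 1) s)
        \<otimes>\<^bsub>ghom_group B (gobj_map F X) (gobj_map F Y) 0\<^esub> garr_map F X Y 0 f"
      using D s f by (simp add: e garr_map_mult A.gdiff_closed garr_map_gdiff)
    moreover have "garr_map F X Y (- 1) s \<in> ghom B (gobj_map F X) (gobj_map F Y) (- 1)"
      using D s by (simp add: garr_map_closed)
    ultimately have "\<exists>s \<in> ghom B (fst (complex_map F P)) (fst (complex_map F Q)) (- 1).
        garr_map F (fst P) (fst Q) 0 g = gdiff B (complex_map F P) (complex_map F Q) (- 1) s
          \<otimes>\<^bsub>ghom_group B (fst (complex_map F P)) (fst (complex_map F Q)) 0\<^esub> garr_map F (fst P) (fst Q) 0 f"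
      unfolding e fst_complex_map fst_conv by (rule bexI)
    then show ?thesis
      using B.hclass_eq_iff[OF complex_map_closed[OF assms(1)] complex_map_closed[OF assms(2)]]
        chain_map_garr_map[OF assms] chain_map_garr_map[OF assms(1,2) g(1)] by blast
  qed
  then show ?thesis
    unfolding homotopy_functor_def fctr.simps
    using A.mem_hclass[OF assms] assms(3) by (intro UN_constant_eq[of f]) blast+
qed

lemma fobj_homotopy_functor: "fobj (homotopy_functor B F) P = complex_map F P"
  by (simp add: homotopy_functor_def)

lemma cat_functor_homotopy_functor:
  "cat_functor (homotopy_cat A) (homotopy_cat B) (homotopy_functor B F)"
proof
  fix P Q R
  assume "P \<in> Obj (homotopy_cat A)"
  then have P: "P \<in> complexes A" "fst P \<in> gobjs A" by (auto simp: A.homotopy_cat_simps complexes_def)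
  show "fobj (homotopy_functor B F) P \<in> Obj (homotopy_cat B)"
    using P by (simp add: fobj_homotopy_functor B.homotopy_cat_simps complex_map_closed)
  show "farr (homotopy_functor B F) P P (Ident (homotopy_cat A) P) =
      Ident (homotopy_cat B) (fobj (homotopy_functor B F) P)"
    using P by (simp add: A.homotopy_cat_simps B.homotopy_cat_simps farr_homotopy_functor
        A.chain_map_gident garr_map_gident fst_complex_map fobj_homotopy_functor)
  assume "Q \<in> Obj (homotopy_cat A)"
  then have Q: "Q \<in> complexes A" "fst Q \<in> gobjs A" by (auto simp: A.homotopy_cat_simps complexes_def)
  {
    fix f assume "f \<in> Arr (homotopy_cat A) P Q"
    then show "farr (homotopy_functor B F) P Q f \<in>
        Arr (homotopy_cat B) (fobj (homotopy_functor B F) P) (fobj (homotopy_functor B F) Q)"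
      using P Q by (auto simp: A.Arr_homotopy_cat B.Arr_homotopy_cat farr_homotopy_functor
          fobj_homotopy_functor complex_map_closed chain_map_garr_map)
  }
  assume "R \<in> Obj (homotopy_cat A)"
  then have R: "R \<in> complexes A" "fst R \<in> gobjs A" by (auto simp: A.homotopy_cat_simps complexes_def)
  fix f g assume "f \<in> Arr (homotopy_cat A) P Q" "g \<in> Arr (homotopy_cat A) Q R"
  then obtain f' g' where f': "f = hclass A P Q f'" "chain_map A P Q f'"
    and g': "g = hclass A Q R g'" "chain_map A Q R g'"
    using P Q R by (auto simp: A.Arr_homotopy_cat)
  have "f' \<in> ghom A (fst P) (fst Q) 0" "g' \<in> ghom A (fst Q) (fst R) 0"
    using f' g' by (auto simp: chain_map_def)
  then show "farr (homotopy_functor B F) P R (Comp (homotopy_cat A) P Q R g f) =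
      Comp (homotopy_cat B) (fobj (homotopy_functor B F) P) (fobj (homotopy_functor B F) Q)
        (fobj (homotopy_functor B F) R) (farr (homotopy_functor B F) Q R g) (farr (homotopy_functor B F) P Q f)"
    using P Q R f' g'
    by (simp add: A.Comp_homotopy_cat B.Comp_homotopy_cat farr_homotopy_functor fobj_homotopy_functor
        A.chain_map_gcomp complex_map_closed chain_map_garr_map garr_map_gcomp fst_complex_map)
qed

end

section \<open>Square-zero extensions\<close>

locale square_zero_extension = linear_functor RA A RB B F
  for RA :: "'k ring" and A :: "('o, 'm, 'k) lincat"
    and RB :: "'l ring" and B :: "('p, 'n, 'l) lincat" and F :: "('o, 'm, 'p, 'n) fctr" +
  assumes full: "full_functor A B F"
    and square_zero: "square_zero_kernel A B F"
begin

text \<open>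
  The degree \<open>n\<close> part of the ideal \<open>Ker(F)\<close>, as a bimodule over graded maps.
\<close>

definition kerhom :: "(int \<Rightarrow> 'o) \<Rightarrow> (int \<Rightarrow> 'o) \<Rightarrow> int \<Rightarrow> (int \<Rightarrow> 'm) set" where
  "kerhom X Y n =
    {h \<in> ghom A X Y n. garr_map F X Y n h = \<one>\<^bsub>ghom_group B (gobj_map F X) (gobj_map F Y) n\<^esub>}"

lemma kerhom_ghom: "h \<in> kerhom X Y n \<Longrightarrow> h \<in> ghom A X Y n"
  by (simp add: kerhom_def)

lemma kerhom_one: "\<lbrakk>X \<in> gobjs A; Y \<in> gobjs A\<rbrakk> \<Longrightarrow> \<one>\<^bsub>ghom_group A X Y n\<^esub> \<in> kerhom X Y n"
  by (simp add: kerhom_def A.ghom_closed garr_map_one)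

lemma kerhom_mult:
  "\<lbrakk>X \<in> gobjs A; Y \<in> gobjs A; h \<in> kerhom X Y n; k \<in> kerhom X Y n\<rbrakk>
    \<Longrightarrow> h \<otimes>\<^bsub>ghom_group A X Y n\<^esub> k \<in> kerhom X Y n"
  by (simp add: kerhom_def A.ghom_closed garr_map_mult B.ghom_group_simps B.ghom_closed gobj_map_closed)

lemma kerhom_inv:
  "\<lbrakk>X \<in> gobjs A; Y \<in> gobjs A; h \<in> kerhom X Y n\<rbrakk> \<Longrightarrow> inv\<^bsub>ghom_group A X Y n\<^esub> h \<in> kerhom X Y n"
  by (simp add: kerhom_def A.ghom_closed garr_map_inv B.ghom_group_simps gobj_map_closed)

lemma kerhom_gcomp_left:
  "\<lbrakk>X \<in> gobjs A; Y \<in> gobjs A; Z \<in> gobjs A; f \<in> ghom A X Y p; h \<in> kerhom Y Z q; p + q = n\<rbrakk>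
    \<Longrightarrow> gcomp A X Y Z p q h f \<in> kerhom X Z n"
  by (auto simp add: kerhom_def A.ghom_closed garr_map_gcomp B.gcomp_one_left gobj_map_closed garr_map_closed)

lemma kerhom_gcomp_right:
  "\<lbrakk>X \<in> gobjs A; Y \<in> gobjs A; Z \<in> gobjs A; h \<in> kerhom X Y p; g \<in> ghom A Y Z q; p + q = n\<rbrakk>
    \<Longrightarrow> gcomp A X Y Z p q g h \<in> kerhom X Z n"
  by (auto simp add: kerhom_def A.ghom_closed garr_map_gcomp B.gcomp_one_right gobj_map_closed garr_map_closed)

lemma kerhom_gcomp_kerhom:
  assumes "X \<in> gobjs A" "Y \<in> gobjs A" "Z \<in> gobjs A" "h \<in> kerhom X Y p" "k \<in> kerhom Y Z q"
  shows "gcomp A X Y Z p q k h = \<one>\<^bsub>ghom_group A X Z (p + q)\<^esub>"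
proof
  fix i
  have "garr_map F X Y p h i = \<one>\<^bsub>ghom_group B (gobj_map F X) (gobj_map F Y) p\<^esub> i"
    using assms(4) by (simp add: kerhom_def)
  then have h: "h i \<in> Arr A (X i) (Y (i + p))"
    "farr F (X i) (Y (i + p)) (h i) = \<zero>\<^bsub>Hmod B (fobj F (X i)) (fobj F (Y (i + p)))\<^esub>"
    using assms(4) by (auto simp: kerhom_def garr_map_def ghom_group_def gobj_map_def ghom_def)
  have "garr_map F Y Z q k (i + p) = \<one>\<^bsub>ghom_group B (gobj_map F Y) (gobj_map F Z) q\<^esub> (i + p)"
    using assms(5) by (simp add: kerhom_def)
  then have k: "k (i + p) \<in> Arr A (Y (i + p)) (Z (i + p + q))"
    "farr F (Y (i + p)) (Z (i + p + q)) (k (i + p)) = \<zero>\<^bsub>Hmod B (fobj F (Y (i + p))) (fobj F (Z (i + p + q)))\<^esub>"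
    using assms(5) by (auto simp: kerhom_def garr_map_def ghom_group_def gobj_map_def ghom_def)
  show "gcomp A X Y Z p q k h i = \<one>\<^bsub>ghom_group A X Z (p + q)\<^esub> i"
    using square_zero h k assms(1-3)
    by (auto simp: square_zero_kernel_def gcomp_def ghom_group_def gobjsD add.assoc)
qed

lemma kerhom_gdiff:
  assumes "X \<in> gobjs A" "Y \<in> gobjs A" "dX \<in> ghom A X X 1" "dY \<in> ghom A Y Y 1" "h \<in> kerhom X Y n"
    "n + 1 = m"
  shows "gdiff A (X, dX) (Y, dY) n h \<in> kerhom X Y m"
  using assms(1-5) unfolding assms(6)[symmetric]
  by (simp add: A.gdiff_eq kerhom_ghom signed_def kerhom_mult kerhom_inv kerhom_gcomp_left
      kerhom_gcomp_right)

lemmas kerhom_closed = kerhom_one kerhom_mult kerhom_inv kerhom_gcomp_left kerhom_gcomp_right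
  kerhom_gdiff

text \<open>
  Fullness, applied in each degree, with a choice of one preimage for every index.
\<close>

lemma garr_map_surj:
  assumes "X \<in> gobjs A" "Y \<in> gobjs A" "g \<in> ghom B (gobj_map F X) (gobj_map F Y) n"
  obtains f where "f \<in> ghom A X Y n" "garr_map F X Y n f = g"
proof -
  have "\<forall>i. \<exists>x. x \<in> Arr A (X i) (Y (i + n)) \<and> farr F (X i) (Y (i + n)) x = g i"
  proof
    fix i
    have "g i \<in> farr F (X i) (Y (i + n)) ` Arr A (X i) (Y (i + n))"
      using full assms by (auto simp: full_functor_def gobjsD ghom_def gobj_map_def)
    then show "\<exists>x. x \<in> Arr A (X i) (Y (i + n)) \<and> farr F (X i) (Y (i + n)) x = g i" by auto
  qed
  then obtain f where "\<And>i. f i \<in> Arr A (X i) (Y (i + n)) \<and> farr F (X i) (Y (i + n)) (f i) = g i"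
    by metis
  then show ?thesis using that[of f] by (auto simp: ghom_def garr_map_def)
qed

lemma garr_map_eqE:
  assumes "X \<in> gobjs A" "Y \<in> gobjs A" "f \<in> ghom A X Y n" "g \<in> ghom A X Y n"
    "garr_map F X Y n f = garr_map F X Y n g"
  obtains h where "h \<in> kerhom X Y n" "f = g \<otimes>\<^bsub>ghom_group A X Y n\<^esub> h"
proof
  show "f = g \<otimes>\<^bsub>ghom_group A X Y n\<^esub> (inv\<^bsub>ghom_group A X Y n\<^esub> g \<otimes>\<^bsub>ghom_group A X Y n\<^esub> f)"
    using assms by (simp add: A.ghom_cancel)
  show "inv\<^bsub>ghom_group A X Y n\<^esub> g \<otimes>\<^bsub>ghom_group A X Y n\<^esub> f \<in> kerhom X Y n"
    using assms by (simp add: kerhom_def A.ghom_closed garr_map_additive B.ghom_group_simps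
        gobj_map_closed garr_map_closed)
qed

lemma garr_map_mult_kerhom:
  assumes "X \<in> gobjs A" "Y \<in> gobjs A" "f \<in> ghom A X Y n" "h \<in> kerhom X Y n"
  shows "garr_map F X Y n (f \<otimes>\<^bsub>ghom_group A X Y n\<^esub> h) = garr_map F X Y n f"
  using assms by (simp add: kerhom_def garr_map_mult B.ghom_group_simps gobj_map_closed garr_map_closed)

subsection \<open>Complexes modulo the kernel\<close>

text \<open>
  Pairs that become complexes after applying \<open>F\<close>. Graded lifts of a differential give such
  pairs, and the square of their differential, being in the kernel, annihilates the kernel.
\<close>

definition curved_complex :: "(int \<Rightarrow> 'o) \<times> (int \<Rightarrow> 'm) \<Rightarrow> bool" where
  "curved_complex P \<longleftrightarrow> (case P of (X, d) \<Rightarrow>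
    X \<in> gobjs A \<and> d \<in> ghom A X X 1 \<and> gcomp A X X X 1 1 d d \<in> kerhom X X 2)"

lemma curved_complexD:
  assumes "curved_complex (X, d)"
  shows "X \<in> gobjs A" "d \<in> ghom A X X 1" "gcomp A X X X 1 1 d d \<in> kerhom X X 2"
  using assms by (auto simp: curved_complex_def)

lemma curved_complex_if_complex: "P \<in> complexes A \<Longrightarrow> curved_complex P"
  by (auto simp: complexes_def curved_complex_def kerhom_one)

lemma complex_map_curved_complex:
  assumes "curved_complex P"
  shows "complex_map F P \<in> complexes B"
  using assms
  by (auto simp: curved_complex_def kerhom_def complexes_def complex_map_def gobj_map_closed
      garr_map_closed garr_map_gcomp)

text \<open>
  The curvature terms \<open>dY\<^sup>2 h\<close> and \<open>h dX\<^sup>2\<close> are products of two elements of the kernel.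
\<close>

lemma gdiff_gdiff_kerhom:
  assumes P: "curved_complex (X, dX)" and Q: "curved_complex (Y, dY)" and h: "h \<in> kerhom X Y n"
    and "n + 1 = m"
  shows "gdiff A (X, dX) (Y, dY) m (gdiff A (X, dX) (Y, dY) n h) = \<one>\<^bsub>ghom_group A X Y (m + 1)\<^esub>"
  using curved_complexD[OF P] curved_complexD[OF Q] h
  by (auto simp: A.gdiff_gdiff kerhom_ghom kerhom_gcomp_kerhom A.ghom_group_simps A.ghom_closed
      add.commute[of 2] simp flip: assms(4))

lemma gdiff_gcomp_self:
  assumes "X \<in> gobjs A" "d \<in> ghom A X X 1"
  shows "gdiff A (X, d) (X, d) 2 (gcomp A X X X 1 1 d d) = \<one>\<^bsub>ghom_group A X X 3\<^esub>"
  using assms by (simp add: A.gdiff_eq A.ghom_closed signed_def A.gcomp_assoc A.ghom_group_simps)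

subsection \<open>Changing the differential by an element of the kernel\<close>

text \<open>
  On the kernel, \<open>\<delta>\<close> only depends on the images of the differentials under \<open>F\<close>.
\<close>

lemma gdiff_twist:
  assumes "X \<in> gobjs A" "Y \<in> gobjs A" "dX \<in> ghom A X X 1" "dY \<in> ghom A Y Y 1"
    "hX \<in> kerhom X X 1" "hY \<in> kerhom Y Y 1" "k \<in> kerhom X Y n"
  shows "gdiff A (X, dX \<otimes>\<^bsub>ghom_group A X X 1\<^esub> hX) (Y, dY \<otimes>\<^bsub>ghom_group A Y Y 1\<^esub> hY) n k =
    gdiff A (X, dX) (Y, dY) n k"
  using assms
  by (auto simp: A.gdiff_eq kerhom_ghom kerhom_gcomp_kerhom A.gcomp_additive A.ghom_group_simps
      A.ghom_closed signed_def add.commute[of 1])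

lemma gdiff_twist_source:
  assumes "X \<in> gobjs A" "Y \<in> gobjs A" "dX \<in> ghom A X X 1" "dY \<in> ghom A Y Y 1"
    "h \<in> ghom A X X 1" "f \<in> ghom A X Y 0"
  shows "gdiff A (X, dX \<otimes>\<^bsub>ghom_group A X X 1\<^esub> h) (Y, dY) 0 f =
    gdiff A (X, dX) (Y, dY) 0 f \<otimes>\<^bsub>ghom_group A X Y 1\<^esub> inv\<^bsub>ghom_group A X Y 1\<^esub> gcomp A X X Y 1 0 f h"
  using assms
  by (simp add: A.gdiff_eq A.gcomp_additive A.ghom_group_simps A.ghom_closed signed_def)

text \<open>
  Expanding \<open>(d + h)\<^sup>2\<close> gives \<open>d\<^sup>2 + (d h + h d) + h\<^sup>2\<close>, where the bracket is \<open>\<delta>(h)\<close> and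
  \<open>h\<^sup>2 = 0\<close>.
\<close>

lemma gcomp_twist:
  assumes "X \<in> gobjs A" "d \<in> ghom A X X 1" "h \<in> kerhom X X 1"
  shows "gcomp A X X X 1 1 (d \<otimes>\<^bsub>ghom_group A X X 1\<^esub> h) (d \<otimes>\<^bsub>ghom_group A X X 1\<^esub> h) =
    gcomp A X X X 1 1 d d \<otimes>\<^bsub>ghom_group A X X 2\<^esub> gdiff A (X, d) (X, d) 1 h"
  using assms kerhom_gcomp_kerhom[of X X X h 1 h 1]
  by (simp add: A.gdiff_eq A.gcomp_additive A.ghom_group_simps A.ghom_closed signed_def kerhom_ghom
      A.ghom_m_comm A.ghom_m_lcomm)

text \<open>
  The equation \<open>(d + h)(1 + k) - (1 + k) d = h + \<delta>(k)\<close>, in which \<open>h k = 0\<close>: it says when \<open>1 + k\<close>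
  is a chain map between two differentials with the same image.
\<close>

lemma gdiff_unipotent:
  assumes "X \<in> gobjs A" "d \<in> ghom A X X 1" "h \<in> kerhom X X 1" "k \<in> kerhom X X 0"
  shows "gdiff A (X, d) (X, d \<otimes>\<^bsub>ghom_group A X X 1\<^esub> h) 0 (gident A X \<otimes>\<^bsub>ghom_group A X X 0\<^esub> k) =
    h \<otimes>\<^bsub>ghom_group A X X 1\<^esub> gdiff A (X, d) (X, d) 0 k"
proof -
  let ?G = "ghom_group A X X"
  have c: "h \<in> ghom A X X 1" "k \<in> ghom A X X 0" using assms by (simp_all add: kerhom_ghom)
  have "gdiff A (X, d) (X, d \<otimes>\<^bsub>?G 1\<^esub> h) 0 (gident A X \<otimes>\<^bsub>?G 0\<^esub> k) =
      (d \<otimes>\<^bsub>?G 1\<^esub> inv\<^bsub>?G 1\<^esub> d) \<otimes>\<^bsub>?G 1\<^esub> (h \<otimes>\<^bsub>?G 1\<^esub> gdiff A (X, d) (X, d) 0 k)"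
    using assms c kerhom_gcomp_kerhom[of X X X k 0 h 1]
    by (simp add: A.gdiff_eq A.gcomp_additive A.ghom_group_simps(1-4,6-) A.ghom_closed signed_def
        A.ghom_m_comm A.ghom_m_lcomm A.gcomp_gident_left A.gcomp_gident_right)
  then show ?thesis
    using assms c by (simp add: A.ghom_group_simps A.ghom_closed A.gdiff_closed)
qed

lemma gcomp_unipotent:
  assumes "X \<in> gobjs A" "k \<in> kerhom X X 0"
  shows "gcomp A X X X 0 0 (gident A X \<otimes>\<^bsub>ghom_group A X X 0\<^esub> inv\<^bsub>ghom_group A X X 0\<^esub> k)
    (gident A X \<otimes>\<^bsub>ghom_group A X X 0\<^esub> k) = gident A X"
  using assms kerhom_gcomp_kerhom[of X X X k 0 k 0]
  by (simp add: A.gcomp_additive A.ghom_group_simps A.ghom_closed kerhom_ghom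
      A.gcomp_gident_left A.gcomp_gident_right)

text \<open>
  The inverse of \<open>1 + k\<close> is \<open>1 - k\<close> because \<open>k\<^sup>2 = 0\<close>. It is a chain map in the other direction
  by the same criterion, applied to \<open>d + h\<close>, \<open>-h\<close> and \<open>-k\<close>.
\<close>

lemma unipotent_isos:
  assumes P: "(X, d) \<in> complexes A" and Q: "(X, d \<otimes>\<^bsub>ghom_group A X X 1\<^esub> h) \<in> complexes A"
    and h: "h \<in> kerhom X X 1" and k: "k \<in> kerhom X X 0"
    and hk: "h \<otimes>\<^bsub>ghom_group A X X 1\<^esub> gdiff A (X, d) (X, d) 0 k = \<one>\<^bsub>ghom_group A X X 1\<^esub>"
  shows "chain_map A (X, d) (X, d \<otimes>\<^bsub>ghom_group A X X 1\<^esub> h) (gident A X \<otimes>\<^bsub>ghom_group A X X 0\<^esub> k)"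
    and "hclass A (X, d) (X, d \<otimes>\<^bsub>ghom_group A X X 1\<^esub> h) (gident A X \<otimes>\<^bsub>ghom_group A X X 0\<^esub> k)
      \<in> isos (homotopy_cat A) (X, d) (X, d \<otimes>\<^bsub>ghom_group A X X 1\<^esub> h)"
proof -
  let ?G = "ghom_group A X X" and ?d = "d \<otimes>\<^bsub>ghom_group A X X 1\<^esub> h"
  let ?u = "gident A X \<otimes>\<^bsub>?G 0\<^esub> k" and ?v = "gident A X \<otimes>\<^bsub>?G 0\<^esub> inv\<^bsub>?G 0\<^esub> k"
  note D = A.complexesD[OF P] A.complexesD[OF Q]
  note c = kerhom_ghom[OF h] kerhom_ghom[OF k]
  show u: "chain_map A (X, d) (X, ?d) ?u"
    using D h k c hk by (simp add: chain_map_def A.ghom_closed gdiff_unipotent)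
  have d: "?d \<otimes>\<^bsub>?G 1\<^esub> inv\<^bsub>?G 1\<^esub> h = d"
    using D c by (simp add: A.ghom_group_simps A.ghom_closed)
  have "gdiff A (X, ?d) (X, ?d \<otimes>\<^bsub>?G 1\<^esub> inv\<^bsub>?G 1\<^esub> h) 0 ?v
      = inv\<^bsub>?G 1\<^esub> h \<otimes>\<^bsub>?G 1\<^esub> gdiff A (X, ?d) (X, ?d) 0 (inv\<^bsub>?G 0\<^esub> k)"
    using D h k by (intro gdiff_unipotent kerhom_closed) auto
  also have "\<dots> = inv\<^bsub>?G 1\<^esub> (h \<otimes>\<^bsub>?G 1\<^esub> gdiff A (X, d) (X, d) 0 k)"
    using D h k c by (simp add: gdiff_twist kerhom_inv A.gdiff_additive A.ghom_group_simps A.gdiff_closed)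
  finally have v: "chain_map A (X, ?d) (X, d) ?v"
    using D c unfolding d hk by (simp add: chain_map_def A.ghom_closed A.ghom_group_simps)
  have "gcomp A X X X 0 0 ?v ?u = gident A X" using D k by (simp add: gcomp_unipotent)
  moreover have "gcomp A X X X 0 0 ?u ?v = gident A X"
    using gcomp_unipotent[of X "inv\<^bsub>?G 0\<^esub> k"] D k c by (simp add: kerhom_inv A.ghom_group_simps)
  ultimately show "hclass A (X, d) (X, ?d) ?u \<in> isos (homotopy_cat A) (X, d) (X, ?d)"
    using u v P Q
    by (intro category.isosI[OF A.category_homotopy_cat, of _ _ _ "hclass A (X, ?d) (X, d) ?v"])
       (auto simp: A.Arr_homotopy_cat A.Comp_homotopy_cat A.homotopy_cat_simps)
qed

subsection \<open>Homotopy equivalences modulo the kernel\<close>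

text \<open>
  What is left, in the source category, of an equation \<open>a b = 1\<close> in the homotopy category of the
  target once maps and homotopies have been lifted: \<open>a\<close> and \<open>b\<close> are chain maps up to the kernel,
  and \<open>a b = 1 + \<delta>(s) + k\<close> with \<open>k\<close> in the kernel.
\<close>

definition left_inverse_mod_kernel ::
  "(int \<Rightarrow> 'o) \<times> (int \<Rightarrow> 'm) \<Rightarrow> (int \<Rightarrow> 'o) \<times> (int \<Rightarrow> 'm) \<Rightarrow> (int \<Rightarrow> 'm) \<Rightarrow> (int \<Rightarrow> 'm) \<Rightarrow> bool" where
  "left_inverse_mod_kernel P Q a b \<longleftrightarrow>
    a \<in> ghom A (fst Q) (fst P) 0 \<and> gdiff A Q P 0 a \<in> kerhom (fst Q) (fst P) 1 \<and>
    b \<in> ghom A (fst P) (fst Q) 0 \<and> gdiff A P Q 0 b \<in> kerhom (fst P) (fst Q) 1 \<and>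
    (\<exists>s \<in> ghom A (fst P) (fst P) (- 1). \<exists>k \<in> kerhom (fst P) (fst P) 0.
      gcomp A (fst P) (fst Q) (fst P) 0 0 a b = gident A (fst P)
        \<otimes>\<^bsub>ghom_group A (fst P) (fst P) 0\<^esub> (gdiff A P P (- 1) s \<otimes>\<^bsub>ghom_group A (fst P) (fst P) 0\<^esub> k))"

lemma left_inverse_mod_kernelE:
  assumes "left_inverse_mod_kernel (X, dX) (Y, dY) a b"
  obtains s k where "a \<in> ghom A Y X 0" "gdiff A (Y, dY) (X, dX) 0 a \<in> kerhom Y X 1"
    "b \<in> ghom A X Y 0" "gdiff A (X, dX) (Y, dY) 0 b \<in> kerhom X Y 1"
    "s \<in> ghom A X X (- 1)" "k \<in> kerhom X X 0"
    "gcomp A X Y X 0 0 a b = gident A X \<otimes>\<^bsub>ghom_group A X X 0\<^esub>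
      (gdiff A (X, dX) (X, dX) (- 1) s \<otimes>\<^bsub>ghom_group A X X 0\<^esub> k)"
  using assms by (auto simp: left_inverse_mod_kernel_def)

text \<open>
  On a cocycle \<open>x\<close> of the kernel the error term \<open>k\<close> of \<open>a b = 1 + \<delta>(s) + k\<close> acts as zero, and
  \<open>\<delta>(s) x = \<delta>(s x)\<close>. So \<open>a b x\<close> and \<open>x\<close> have the same class, with \<open>w = s x\<close>.
\<close>

lemma gcomp_left_inverse_mod_kernel:
  assumes V: "curved_complex (V, dV)" and P: "curved_complex (X, dX)" and Q: "curved_complex (Y, dY)"
    and inv: "left_inverse_mod_kernel (X, dX) (Y, dY) a b"
    and x: "x \<in> kerhom V X n" "gdiff A (V, dV) (X, dX) n x = \<one>\<^bsub>ghom_group A V X (n + 1)\<^esub>"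
  obtains w where "w \<in> kerhom V X (n - 1)"
    "gcomp A V Y X n 0 a (gcomp A V X Y n 0 b x) = x \<otimes>\<^bsub>ghom_group A V X n\<^esub> gdiff A (V, dV) (X, dX) (n - 1) w"
proof -
  obtain s k where *: "a \<in> ghom A Y X 0" "gdiff A (Y, dY) (X, dX) 0 a \<in> kerhom Y X 1"
    "b \<in> ghom A X Y 0" "gdiff A (X, dX) (Y, dY) 0 b \<in> kerhom X Y 1"
    "s \<in> ghom A X X (- 1)" "k \<in> kerhom X X 0"
    and ab: "gcomp A X Y X 0 0 a b = gident A X \<otimes>\<^bsub>ghom_group A X X 0\<^esub>
      (gdiff A (X, dX) (X, dX) (- 1) s \<otimes>\<^bsub>ghom_group A X X 0\<^esub> k)"
    using inv by (rule left_inverse_mod_kernelE)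
  note D = curved_complexD[OF V] curved_complexD[OF P] curved_complexD[OF Q]
  have s: "gdiff A (X, dX) (X, dX) (- 1) s \<in> ghom A X X 0" using D * by (simp add: A.gdiff_closed)
  let ?w = "gcomp A V X X n (- 1) s x"
  show ?thesis
  proof
    show "?w \<in> kerhom V X (n - 1)" using D * x by (auto intro: kerhom_gcomp_right)
    have "gdiff A (V, dV) (X, dX) (n - 1) ?w = gcomp A V X X n 0 (gdiff A (X, dX) (X, dX) (- 1) s) x"
      using D * x s by (simp add: A.gdiff_gcomp kerhom_ghom signed_def A.gcomp_additive
          A.ghom_group_simps A.ghom_closed)
    moreover have "gcomp A V Y X n 0 a (gcomp A V X Y n 0 b x) = gcomp A V X X n 0 (gcomp A X Y X 0 0 a b) x"
      using D * x by (simp add: A.gcomp_assoc kerhom_ghom)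
    moreover have "\<dots> = x \<otimes>\<^bsub>ghom_group A V X n\<^esub> gcomp A V X X n 0 (gdiff A (X, dX) (X, dX) (- 1) s) x"
      unfolding ab using D * x s kerhom_gcomp_kerhom[of V X X x n k 0]
      by (simp add: A.gcomp_additive kerhom_ghom A.ghom_closed A.gcomp_gident_left A.ghom_group_simps)
    ultimately show "gcomp A V Y X n 0 a (gcomp A V X Y n 0 b x) =
        x \<otimes>\<^bsub>ghom_group A V X n\<^esub> gdiff A (V, dV) (X, dX) (n - 1) ?w" by simp
  qed
qed

text \<open>
  Injectivity of \<open>b\<close> on the cohomology of the kernel: if \<open>b x = \<delta>(y)\<close> then
  \<open>a b x = a \<delta>(y) = \<delta>(a y)\<close>, as \<open>\<delta>(a)\<close> is in the kernel and hence annihilates \<open>y\<close>; and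
  \<open>a b x\<close> is cohomologous to \<open>x\<close>.
\<close>

lemma kerhom_exact_if_gcomp_exact:
  assumes V: "curved_complex (V, dV)" and P: "curved_complex (X, dX)" and Q: "curved_complex (Y, dY)"
    and inv: "left_inverse_mod_kernel (X, dX) (Y, dY) a b"
    and x: "x \<in> kerhom V X n" "gdiff A (V, dV) (X, dX) n x = \<one>\<^bsub>ghom_group A V X (n + 1)\<^esub>"
    and y: "y \<in> kerhom V Y (n - 1)" "gcomp A V X Y n 0 b x = gdiff A (V, dV) (Y, dY) (n - 1) y"
  obtains w where "w \<in> kerhom V X (n - 1)" "x = gdiff A (V, dV) (X, dX) (n - 1) w"
proof -
  note D = curved_complexD[OF V] curved_complexD[OF P] curved_complexD[OF Q]
  have a: "a \<in> ghom A Y X 0" "gdiff A (Y, dY) (X, dX) 0 a \<in> kerhom Y X 1"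
    using inv by (auto simp: left_inverse_mod_kernel_def)
  obtain w where w: "w \<in> kerhom V X (n - 1)" "gcomp A V Y X n 0 a (gcomp A V X Y n 0 b x) =
      x \<otimes>\<^bsub>ghom_group A V X n\<^esub> gdiff A (V, dV) (X, dX) (n - 1) w"
    by (rule gcomp_left_inverse_mod_kernel[OF V P Q inv x])
  \<comment> \<open>The primitive of \<open>x\<close> will be \<open>a y - w\<close>.\<close>
  let ?z = "gcomp A V Y X (n - 1) 0 a y"
  have z: "?z \<in> kerhom V X (n - 1)" using D a y by (auto intro: kerhom_gcomp_right)
  have dw: "gdiff A (V, dV) (X, dX) (n - 1) w \<in> ghom A V X n" "gdiff A (V, dV) (Y, dY) (n - 1) y \<in> ghom A V Y n"
    using D w y by (simp_all add: A.gdiff_closed kerhom_ghom)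
  have "gdiff A (V, dV) (X, dX) (n - 1) ?z = gcomp A V Y X n 0 a (gdiff A (V, dV) (Y, dY) (n - 1) y)"
    using D a y dw kerhom_gcomp_kerhom[of V Y X y "n - 1" "gdiff A (Y, dY) (X, dX) 0 a" 1]
    by (simp add: A.gdiff_gcomp kerhom_ghom signed_def A.ghom_group_simps A.ghom_closed)
  also have "\<dots> = x \<otimes>\<^bsub>ghom_group A V X n\<^esub> gdiff A (V, dV) (X, dX) (n - 1) w"
    using w(2) y(2) by simp
  finally have "x = gdiff A (V, dV) (X, dX) (n - 1) (?z \<otimes>\<^bsub>ghom_group A V X (n - 1)\<^esub> inv\<^bsub>ghom_group A V X (n - 1)\<^esub> w)"
    using D w z x dw by (simp add: A.gdiff_additive kerhom_ghom A.ghom_closed A.ghom_group_simps)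
  with D w z show ?thesis by (intro that) (simp_all add: kerhom_closed)
qed

lemma left_inverse_mod_kernelI:
  assumes P: "curved_complex (X, dX)" and Q: "curved_complex (Y, dY)"
    and a: "a \<in> ghom A Y X 0" "chain_map B (complex_map F (Y, dY)) (complex_map F (X, dX)) (garr_map F Y X 0 a)"
    and b: "b \<in> ghom A X Y 0" "chain_map B (complex_map F (X, dX)) (complex_map F (Y, dY)) (garr_map F X Y 0 b)"
    and ab: "hclass B (complex_map F (X, dX)) (complex_map F (X, dX))
        (gcomp B (gobj_map F X) (gobj_map F Y) (gobj_map F X) 0 0 (garr_map F Y X 0 a) (garr_map F X Y 0 b))
      = hclass B (complex_map F (X, dX)) (complex_map F (X, dX)) (gident B (gobj_map F X))"
  shows "left_inverse_mod_kernel (X, dX) (Y, dY) a b"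
proof -
  note D = curved_complexD[OF P] curved_complexD[OF Q]
  note FP = complex_map_curved_complex[OF P] and FQ = complex_map_curved_complex[OF Q]
  have da: "gdiff A (Y, dY) (X, dX) 0 a \<in> kerhom Y X 1" "gdiff A (X, dX) (Y, dY) 0 b \<in> kerhom X Y 1"
    using D a b by (simp_all add: kerhom_def A.gdiff_closed garr_map_gdiff chain_map_def fst_complex_map)
  obtain \<sigma> where \<sigma>: "\<sigma> \<in> ghom B (gobj_map F X) (gobj_map F X) (- 1)"
    and eq: "gcomp B (gobj_map F X) (gobj_map F Y) (gobj_map F X) 0 0 (garr_map F Y X 0 a) (garr_map F X Y 0 b)
      = gdiff B (complex_map F (X, dX)) (complex_map F (X, dX)) (- 1) \<sigma>
        \<otimes>\<^bsub>ghom_group B (gobj_map F X) (gobj_map F X) 0\<^esub> gident B (gobj_map F X)"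
    using B.hclass_eq_iff[OF FP FP B.chain_map_gcomp[OF FP FQ FP b(2) a(2)] B.chain_map_gident[OF FP]] ab
    by (auto simp: fst_complex_map)
  obtain s where s: "s \<in> ghom A X X (- 1)" "garr_map F X X (- 1) s = \<sigma>"
    using garr_map_surj[OF D(1) D(1) \<sigma>] .
  have ds: "gdiff A (X, dX) (X, dX) (- 1) s \<in> ghom A X X 0" using D s by (simp add: A.gdiff_closed)
  have "garr_map F X X 0 (gcomp A X Y X 0 0 a b) =
      garr_map F X X 0 (gident A X \<otimes>\<^bsub>ghom_group A X X 0\<^esub> gdiff A (X, dX) (X, dX) (- 1) s)"
    using D a b s \<sigma> ds eq
    by (simp add: garr_map_gcomp garr_map_mult A.ghom_closed garr_map_gident garr_map_gdiff
        B.ghom_m_comm gobj_map_closed B.gident_closed B.gdiff_closed garr_map_closed complex_map_def)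
  then obtain k where k: "k \<in> kerhom X X 0" and kab: "gcomp A X Y X 0 0 a b =
      gident A X \<otimes>\<^bsub>ghom_group A X X 0\<^esub> gdiff A (X, dX) (X, dX) (- 1) s \<otimes>\<^bsub>ghom_group A X X 0\<^esub> k"
    using D a b ds garr_map_eqE[of X X "gcomp A X Y X 0 0 a b" 0
        "gident A X \<otimes>\<^bsub>ghom_group A X X 0\<^esub> gdiff A (X, dX) (X, dX) (- 1) s"]
    by (auto simp: A.ghom_closed)
  have "gcomp A X Y X 0 0 a b =
      gident A X \<otimes>\<^bsub>ghom_group A X X 0\<^esub> (gdiff A (X, dX) (X, dX) (- 1) s \<otimes>\<^bsub>ghom_group A X X 0\<^esub> k)"
    unfolding kab using D ds k by (simp add: A.ghom_group_simps A.ghom_closed kerhom_ghom)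
  then show ?thesis
    unfolding left_inverse_mod_kernel_def fst_conv using a(1) b(1) da s(1) k by blast
qed

lemma inverse_mod_kernel_if_isos:
  assumes P: "curved_complex (X, dX)" and Q: "curved_complex (Y, dY)"
    and b: "b \<in> ghom A X Y 0" "chain_map B (complex_map F (X, dX)) (complex_map F (Y, dY)) (garr_map F X Y 0 b)"
    and iso: "hclass B (complex_map F (X, dX)) (complex_map F (Y, dY)) (garr_map F X Y 0 b)
      \<in> isos (homotopy_cat B) (complex_map F (X, dX)) (complex_map F (Y, dY))"
  obtains a where "left_inverse_mod_kernel (X, dX) (Y, dY) a b" "left_inverse_mod_kernel (Y, dY) (X, dX) b a"
proof -
  note D = curved_complexD[OF P] curved_complexD[OF Q]
  note FP = complex_map_curved_complex[OF P] and FQ = complex_map_curved_complex[OF Q]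
  let ?P = "complex_map F (X, dX)" and ?Q = "complex_map F (Y, dY)"
  obtain v where v: "v \<in> Arr (homotopy_cat B) ?Q ?P"
    "Comp (homotopy_cat B) ?P ?Q ?P v (hclass B ?P ?Q (garr_map F X Y 0 b)) = Ident (homotopy_cat B) ?P"
    "Comp (homotopy_cat B) ?Q ?P ?Q (hclass B ?P ?Q (garr_map F X Y 0 b)) v = Ident (homotopy_cat B) ?Q"
    using iso by (auto simp: isos_def)
  obtain \<alpha> where \<alpha>: "v = hclass B ?Q ?P \<alpha>" "chain_map B ?Q ?P \<alpha>"
    using v FP FQ by (auto simp: B.Arr_homotopy_cat)
  have "\<alpha> \<in> ghom B (gobj_map F Y) (gobj_map F X) 0"
    using \<alpha> by (simp add: chain_map_def fst_complex_map)
  then obtain a where a: "a \<in> ghom A Y X 0" "garr_map F Y X 0 a = \<alpha>"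
    by (rule garr_map_surj[OF D(4) D(1)])
  have "left_inverse_mod_kernel (X, dX) (Y, dY) a b" "left_inverse_mod_kernel (Y, dY) (X, dX) b a"
    using P Q a \<alpha> b v FP FQ
    by (auto intro!: left_inverse_mod_kernelI
        simp: B.Comp_homotopy_cat B.homotopy_cat_simps fst_complex_map)
  then show ?thesis by (rule that)
qed

text \<open>
  The map is homotopic to \<open>1 + k\<close>, and \<open>\<delta>(k) = 0\<close> follows from its being a chain map, so the
  unipotent case applies with equal source and target.
\<close>

lemma isos_if_id_mod_kernel:
  assumes P: "(X, d) \<in> complexes A" and f: "chain_map A (X, d) (X, d) f"
    and s: "s \<in> ghom A X X (- 1)" and k: "k \<in> kerhom X X 0"
    and eq: "f = gident A X \<otimes>\<^bsub>ghom_group A X X 0\<^esub> (gdiff A (X, d) (X, d) (- 1) s \<otimes>\<^bsub>ghom_group A X X 0\<^esub> k)"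
  shows "hclass A (X, d) (X, d) f \<in> isos (homotopy_cat A) (X, d) (X, d)"
proof -
  let ?G = "ghom_group A X X"
  note D = A.complexesD[OF P]
  have ds: "gdiff A (X, d) (X, d) (- 1) s \<in> ghom A X X 0" using D s by (simp add: A.gdiff_closed)
  have "gdiff A (X, d) (X, d) 0 f = gdiff A (X, d) (X, d) 0 k"
    unfolding eq using D ds s k A.gdiff_gdiff_complex[OF P P s, of 0]
    by (simp add: A.gdiff_mult A.ghom_closed kerhom_ghom A.gdiff_gident A.ghom_group_simps A.gdiff_closed)
  then have dk: "gdiff A (X, d) (X, d) 0 k = \<one>\<^bsub>?G 1\<^esub>" using f by (simp add: chain_map_def)
  have one: "d \<otimes>\<^bsub>?G 1\<^esub> \<one>\<^bsub>?G 1\<^esub> = d" using D by (simp add: A.ghom_group_simps)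
  note u = unipotent_isos[OF P, of "\<one>\<^bsub>?G 1\<^esub>" k, unfolded one, OF P kerhom_one[OF D(1) D(1)] k]
  have dk': "\<one>\<^bsub>?G 1\<^esub> \<otimes>\<^bsub>?G 1\<^esub> gdiff A (X, d) (X, d) 0 k = \<one>\<^bsub>?G 1\<^esub>"
    using D dk by (simp add: A.ghom_group_simps A.ghom_closed)
  have "f = gdiff A (X, d) (X, d) (- 1) s \<otimes>\<^bsub>?G 0\<^esub> (gident A X \<otimes>\<^bsub>?G 0\<^esub> k)"
    unfolding eq using D ds k by (simp add: A.ghom_m_lcomm A.ghom_closed kerhom_ghom)
  then have "hclass A (X, d) (X, d) f = hclass A (X, d) (X, d) (gident A X \<otimes>\<^bsub>?G 0\<^esub> k)"
    using A.hclass_eq_iff[OF P P f u(1)[OF dk']] s by auto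
  then show ?thesis using u(2)[OF dk'] by simp
qed

text \<open>
  Let \<open>a\<close> lift a homotopy inverse of \<open>F(f)\<close>. Its failure \<open>\<delta>(a)\<close> to be a chain map is a cocycle
  of the kernel, and \<open>f \<delta>(a) = \<delta>(f a)\<close> is the coboundary of the kernel part of \<open>f a\<close>. As \<open>f\<close>
  acts injectively on cohomology of the kernel, \<open>\<delta>(a) = \<delta>(y)\<close> with \<open>y\<close> in the kernel, and
  \<open>g = a - y\<close> is a chain map. Both composites of \<open>f\<close> and \<open>g\<close> are the identity up to homotopy
  and an element of the kernel, hence isomorphisms.
\<close>

lemma isos_reflected:
  assumes P: "P \<in> complexes A" and Q: "Q \<in> complexes A" and f: "chain_map A P Q f"
    and iso: "hclass B (complex_map F P) (complex_map F Q) (garr_map F (fst P) (fst Q) 0 f)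
      \<in> isos (homotopy_cat B) (complex_map F P) (complex_map F Q)"
  shows "hclass A P Q f \<in> isos (homotopy_cat A) P Q"
proof -
  obtain X dX Y dY where e: "P = (X, dX)" "Q = (Y, dY)" by (cases P; cases Q)
  note P' = P[unfolded e] and Q' = Q[unfolded e] and f' = f[unfolded e]
  note CP = curved_complex_if_complex[OF P'] and CQ = curved_complex_if_complex[OF Q']
  note D = A.complexesD[OF P'] A.complexesD[OF Q']
  have fc: "f \<in> ghom A X Y 0" "gdiff A (X, dX) (Y, dY) 0 f = \<one>\<^bsub>ghom_group A X Y 1\<^esub>"
    using f' by (simp_all add: chain_map_def)
  obtain a where af: "left_inverse_mod_kernel (X, dX) (Y, dY) a f"
    and fa: "left_inverse_mod_kernel (Y, dY) (X, dX) f a"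
    using inverse_mod_kernel_if_isos[OF CP CQ fc(1) chain_map_garr_map[OF P' Q' f', unfolded fst_conv]]
      iso by (auto simp: e)
  obtain s k where a: "a \<in> ghom A Y X 0" "gdiff A (Y, dY) (X, dX) 0 a \<in> kerhom Y X 1"
    and s: "s \<in> ghom A X X (- 1)" "k \<in> kerhom X X 0"
    "gcomp A X Y X 0 0 a f = gident A X \<otimes>\<^bsub>ghom_group A X X 0\<^esub>
      (gdiff A (X, dX) (X, dX) (- 1) s \<otimes>\<^bsub>ghom_group A X X 0\<^esub> k)"
    using af by (rule left_inverse_mod_kernelE)
  obtain t l where t: "t \<in> ghom A Y Y (- 1)" "l \<in> kerhom Y Y 0"
    "gcomp A Y X Y 0 0 f a = gident A Y \<otimes>\<^bsub>ghom_group A Y Y 0\<^esub>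
      (gdiff A (Y, dY) (Y, dY) (- 1) t \<otimes>\<^bsub>ghom_group A Y Y 0\<^esub> l)"
    using fa by (rule left_inverse_mod_kernelE)
  have ds: "gdiff A (X, dX) (X, dX) (- 1) s \<in> ghom A X X 0"
    "gdiff A (Y, dY) (Y, dY) (- 1) t \<in> ghom A Y Y 0" using D s t by (simp_all add: A.gdiff_closed)
  have "gdiff A (Y, dY) (X, dX) 1 (gdiff A (Y, dY) (X, dX) 0 a) = \<one>\<^bsub>ghom_group A Y X (1 + 1)\<^esub>"
    using A.gdiff_gdiff_complex[OF Q' P' a(1), of 1] by simp
  moreover have "gcomp A Y X Y 1 0 f (gdiff A (Y, dY) (X, dX) 0 a) = gdiff A (Y, dY) (Y, dY) 0 l"
  proof -
    have "gcomp A Y X Y 1 0 f (gdiff A (Y, dY) (X, dX) 0 a) = gdiff A (Y, dY) (Y, dY) 0 (gcomp A Y X Y 0 0 f a)"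
      using D a fc by (simp add: A.gdiff_gcomp signed_def A.gcomp_additive A.ghom_group_simps A.ghom_closed kerhom_ghom)
    also have "\<dots> = gdiff A (Y, dY) (Y, dY) 0 l"
      unfolding t using D ds t A.gdiff_gdiff_complex[OF Q' Q' t(1), of 0]
      by (simp add: A.gdiff_mult A.ghom_closed kerhom_ghom A.gdiff_gident A.ghom_group_simps A.gdiff_closed)
    finally show ?thesis .
  qed
  ultimately obtain y where y: "y \<in> kerhom Y X 0" "gdiff A (Y, dY) (X, dX) 0 a = gdiff A (Y, dY) (X, dX) 0 y"
    using kerhom_exact_if_gcomp_exact[OF CQ CP CQ af a(2), of l] t(2) by auto
  define g where "g = a \<otimes>\<^bsub>ghom_group A Y X 0\<^esub> inv\<^bsub>ghom_group A Y X 0\<^esub> y"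
  have g: "chain_map A (Y, dY) (X, dX) g"
    using D a y by (simp add: g_def chain_map_def A.ghom_closed kerhom_ghom A.gdiff_additive
        A.ghom_group_simps A.gdiff_closed)
  have yf: "gcomp A X Y X 0 0 y f \<in> kerhom X X 0" "gcomp A Y X Y 0 0 f y \<in> kerhom Y Y 0"
    using D y fc by (auto intro: kerhom_closed)
  have "gcomp A X Y X 0 0 g f = gident A X \<otimes>\<^bsub>ghom_group A X X 0\<^esub> (gdiff A (X, dX) (X, dX) (- 1) s
      \<otimes>\<^bsub>ghom_group A X X 0\<^esub> (k \<otimes>\<^bsub>ghom_group A X X 0\<^esub> inv\<^bsub>ghom_group A X X 0\<^esub> gcomp A X Y X 0 0 y f))"
    using D s y a fc ds yf
    by (simp add: g_def A.gcomp_additive A.ghom_closed kerhom_ghom A.ghom_group_simps)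
  then have gf: "hclass A (X, dX) (X, dX) (gcomp A X Y X 0 0 g f) \<in> isos (homotopy_cat A) (X, dX) (X, dX)"
    using D s yf A.chain_map_gcomp[OF P' Q' P' f' g]
    by (intro isos_if_id_mod_kernel[OF P' _ s(1)]) (simp_all add: kerhom_closed)
  have "gcomp A Y X Y 0 0 f g = gident A Y \<otimes>\<^bsub>ghom_group A Y Y 0\<^esub> (gdiff A (Y, dY) (Y, dY) (- 1) t
      \<otimes>\<^bsub>ghom_group A Y Y 0\<^esub> (l \<otimes>\<^bsub>ghom_group A Y Y 0\<^esub> inv\<^bsub>ghom_group A Y Y 0\<^esub> gcomp A Y X Y 0 0 f y))"
    using D t y a fc ds yf
    by (simp add: g_def A.gcomp_additive A.ghom_closed kerhom_ghom A.ghom_group_simps)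
  then have fg: "hclass A (Y, dY) (Y, dY) (gcomp A Y X Y 0 0 f g) \<in> isos (homotopy_cat A) (Y, dY) (Y, dY)"
    using D t yf A.chain_map_gcomp[OF Q' P' Q' g f']
    by (intro isos_if_id_mod_kernel[OF Q' _ t(1)]) (simp_all add: kerhom_closed)
  show ?thesis
    unfolding e
  proof (rule category.isos_if_composites_isos[OF A.category_homotopy_cat])
    show "(X, dX) \<in> Obj (homotopy_cat A)" "(Y, dY) \<in> Obj (homotopy_cat A)"
      using P' Q' by (simp_all add: A.homotopy_cat_simps)
    show "hclass A (X, dX) (Y, dY) f \<in> Arr (homotopy_cat A) (X, dX) (Y, dY)"
      "hclass A (Y, dY) (X, dX) g \<in> Arr (homotopy_cat A) (Y, dY) (X, dX)"
      using P' Q' f' g by (simp_all add: A.Arr_homotopy_cat)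
    show "Comp (homotopy_cat A) (X, dX) (Y, dY) (X, dX) (hclass A (Y, dY) (X, dX) g)
        (hclass A (X, dX) (Y, dY) f) \<in> isos (homotopy_cat A) (X, dX) (X, dX)"
      using gf A.Comp_homotopy_cat[OF P' Q' P' f' g] by simp
    show "Comp (homotopy_cat A) (Y, dY) (X, dX) (Y, dY) (hclass A (X, dX) (Y, dY) f)
        (hclass A (Y, dY) (X, dX) g) \<in> isos (homotopy_cat A) (Y, dY) (Y, dY)"
      using fg A.Comp_homotopy_cat[OF Q' P' Q' g f'] by simp
  qed
qed

end

section \<open>The obstruction and the torsor of lifts\<close>

context square_zero_extension
begin

lemma kernel_group_simps:
  "carrier (kernel_group A B F X n) = kerhom X X n"
  "x \<otimes>\<^bsub>kernel_group A B F X n\<^esub> y = x \<otimes>\<^bsub>ghom_group A X X n\<^esub> y"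
  "\<one>\<^bsub>kernel_group A B F X n\<^esub> = \<one>\<^bsub>ghom_group A X X n\<^esub>"
  by (simp_all add: kernel_group_def kerhom_def)

lemma comm_group_kernel_group:
  assumes X: "X \<in> gobjs A"
  shows "comm_group (kernel_group A B F X n)"
proof -
  interpret comm_group "ghom_group A X X n" by (rule A.comm_group_ghom[OF X X])
  have e: "kernel_group A B F X n = (ghom_group A X X n)\<lparr>carrier := kerhom X X n\<rparr>"
    by (simp add: kernel_group_def kerhom_def)
  have "subgroup (kerhom X X n) (ghom_group A X X n)"
  proof (rule subgroupI)
    show "kerhom X X n \<noteq> {}" using kerhom_one[OF X X] by blast
  qed (use X in \<open>auto simp: kerhom_closed kerhom_ghom\<close>)
  then show ?thesis unfolding e
    by (rule group.group_comm_groupI[OF subgroup_imp_group]) (use X in \<open>simp add: kerhom_ghom A.ghom_m_comm\<close>)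
qed

lemma cochain_complex_kernel:
  assumes P: "curved_complex (X, d)"
  shows "cochain_complex (kernel_group A B F X) (gdiff A (X, d) (X, d))"
  using curved_complexD[OF P] gdiff_gdiff_kerhom[OF P P]
  by (intro cochain_complex.intro)
     (auto simp: comm_group_kernel_group kernel_group_simps kerhom_closed kerhom_ghom A.gdiff_mult intro!: homI)

end

text \<open>
  The complex \<open>(X, d)\<close> to be lifted, a graded lift \<open>(Xb, c)\<close> of \<open>X\<close>, and a graded lift \<open>db\<close> of
  \<open>d\<close>, which serves as base point among the lifts of \<open>d\<close>.
\<close>

locale lifting_problem = square_zero_extension RA A RB B F
  for RA :: "'k ring" and A :: "('o, 'm, 'k) lincat"
    and RB :: "'l ring" and B :: "('p, 'n, 'l) lincat" and F :: "('o, 'm, 'p, 'n) fctr" +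
  fixes X :: "int \<Rightarrow> 'p" and d :: "int \<Rightarrow> 'n"
    and Xb :: "int \<Rightarrow> 'o" and c :: "int \<Rightarrow> 'n" and db :: "int \<Rightarrow> 'm"
  assumes X_d: "(X, d) \<in> complexes B"
    and graded_lift: "graded_lift A B F X Xb c"
    and db: "graded_map_lift A B F X d Xb c db"
begin

abbreviation FX :: "int \<Rightarrow> 'p" where "FX \<equiv> gobj_map F Xb"
abbreviation FP :: "(int \<Rightarrow> 'p) \<times> (int \<Rightarrow> 'n)" where "FP \<equiv> complex_map F (Xb, db)"
abbreviation \<gamma> :: "(int \<Rightarrow> 'n) set" where "\<gamma> \<equiv> hclass B (X, d) FP c"
abbreviation G :: "int \<Rightarrow> (int \<Rightarrow> 'm) monoid" where "G \<equiv> ghom_group A Xb Xb"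
abbreviation L :: "(((int \<Rightarrow> 'o) \<times> (int \<Rightarrow> 'm)) \<times> (int \<Rightarrow> 'n) set, (int \<Rightarrow> 'm) set) cat"
  where "L \<equiv> complex_lifts A B F X d"

lemmas Xd = B.complexesD[OF X_d]

lemma Xb: "Xb \<in> gobjs A" and FX: "FX \<in> gobjs B"
  using graded_lift by (auto simp: graded_lift_def gobj_map_closed)

lemma c_inverse:
  obtains c' where "c \<in> ghom B X FX 0" "c' \<in> ghom B FX X 0"
    "gcomp B X FX X 0 0 c' c = gident B X" "gcomp B FX X FX 0 0 c c' = gident B FX"
  using graded_lift by (auto simp: graded_lift_def isos_def graded_cat_def)

lemma lift_ghom: "graded_map_lift A B F X d Xb c d' \<Longrightarrow> d' \<in> ghom A Xb Xb 1"
  by (simp add: graded_map_lift_def)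

text \<open>
  A lift \<open>e\<close> of \<open>d\<close> satisfies \<open>F(e) = c d c'\<close>, where \<open>c'\<close> is the inverse of \<open>c\<close>; so all lifts have
  the same image, and two of them differ by an element of the kernel.
\<close>

lemma graded_map_lift_iff:
  "graded_map_lift A B F X d Xb c d' \<longleftrightarrow> (\<exists>h \<in> kerhom Xb Xb 1. d' = db \<otimes>\<^bsub>G 1\<^esub> h)"
proof
  obtain c' where c: "c \<in> ghom B X FX 0" "c' \<in> ghom B FX X 0"
    "gcomp B X FX X 0 0 c' c = gident B X" "gcomp B FX X FX 0 0 c c' = gident B FX"
    by (rule c_inverse)
  have *: "garr_map F Xb Xb 1 e = gcomp B FX X FX 0 1 (gcomp B X X FX 1 0 c d) c'"
    if "graded_map_lift A B F X d Xb c e" for e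
  proof -
    have e: "garr_map F Xb Xb 1 e \<in> ghom B FX FX 1"
      using that Xb by (simp add: graded_map_lift_def garr_map_closed)
    have "garr_map F Xb Xb 1 e = gcomp B FX FX FX 0 1 (garr_map F Xb Xb 1 e) (gcomp B FX X FX 0 0 c c')"
      using FX e c by (simp add: B.gcomp_gident_right)
    also have "\<dots> = gcomp B FX X FX 0 1 (gcomp B X FX FX 0 1 (garr_map F Xb Xb 1 e) c) c'"
      using FX e c Xd by (simp add: B.gcomp_assoc)
    finally show ?thesis using that by (simp add: graded_map_lift_def)
  qed
  assume d': "graded_map_lift A B F X d Xb c d'"
  then have "garr_map F Xb Xb 1 d' = garr_map F Xb Xb 1 db" using *[OF d'] *[OF db] by simp
  then show "\<exists>h \<in> kerhom Xb Xb 1. d' = db \<otimes>\<^bsub>G 1\<^esub> h"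
    using garr_map_eqE[OF Xb Xb lift_ghom[OF d'] lift_ghom[OF db]] by blast
next
  assume "\<exists>h \<in> kerhom Xb Xb 1. d' = db \<otimes>\<^bsub>G 1\<^esub> h"
  then show "graded_map_lift A B F X d Xb c d'"
    using db Xb by (auto simp: graded_map_lift_def garr_map_mult_kerhom A.ghom_closed kerhom_ghom)
qed

lemma complex_map_lift:
  assumes "graded_map_lift A B F X d Xb c d'"
  shows "complex_map F (Xb, d') = FP"
  using assms Xb lift_ghom[OF db] unfolding graded_map_lift_iff
  by (auto simp: complex_map_def garr_map_mult_kerhom)

lemma lift_mult_kerhom:
  assumes "graded_map_lift A B F X d Xb c d'" "h \<in> kerhom Xb Xb 1"
  shows "graded_map_lift A B F X d Xb c (d' \<otimes>\<^bsub>G 1\<^esub> h)"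
  using assms Xb lift_ghom[OF db] unfolding graded_map_lift_iff
  by (auto simp: A.ghom_group_simps kerhom_ghom intro!: bexI[of _ "_ \<otimes>\<^bsub>G 1\<^esub> h"] kerhom_mult)

text \<open>
  The isomorphism \<open>c\<close> carries \<open>F(d')\<^sup>2\<close> to \<open>d\<^sup>2 = 0\<close>.
\<close>

lemma curved_complex_lift:
  assumes "graded_map_lift A B F X d Xb c d'"
  shows "curved_complex (Xb, d')"
proof -
  obtain c' where c: "c \<in> ghom B X FX 0" "c' \<in> ghom B FX X 0"
    "gcomp B X FX X 0 0 c' c = gident B X" "gcomp B FX X FX 0 0 c c' = gident B FX"
    by (rule c_inverse)
  let ?e = "garr_map F Xb Xb 1 d'"
  have d': "d' \<in> ghom A Xb Xb 1" "gcomp B X FX FX 0 1 ?e c = gcomp B X X FX 1 0 c d"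
    using assms by (auto simp: graded_map_lift_def)
  have e: "?e \<in> ghom B FX FX 1" using d' Xb by (simp add: garr_map_closed)
  have "gcomp B X FX FX 0 2 (gcomp B FX FX FX 1 1 ?e ?e) c = gcomp B X FX FX 1 1 ?e (gcomp B X FX FX 0 1 ?e c)"
    using c e FX Xd by (simp add: B.gcomp_assoc)
  also have "\<dots> = gcomp B X FX FX 1 1 ?e (gcomp B X X FX 1 0 c d)"
    unfolding d'(2) by (rule refl)
  also have "\<dots> = gcomp B X X FX 1 1 (gcomp B X FX FX 0 1 ?e c) d"
    using c e FX Xd(1,2) by (simp add: B.gcomp_assoc)
  also have "\<dots> = gcomp B X X FX 2 0 c (gcomp B X X X 1 1 d d)"
    unfolding d'(2) using c e FX Xd by (simp add: B.gcomp_assoc)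
  also have "\<dots> = \<one>\<^bsub>ghom_group B X FX 2\<^esub>"
    unfolding Xd(3) using c FX Xd(1) B.gcomp_one_right[of X X FX c 0 2] by simp
  finally have 0: "gcomp B X FX FX 0 2 (gcomp B FX FX FX 1 1 ?e ?e) c = \<one>\<^bsub>ghom_group B X FX 2\<^esub>" .
  have "gcomp B FX FX FX 1 1 ?e ?e = gcomp B FX FX FX 0 2 (gcomp B FX FX FX 1 1 ?e ?e) (gcomp B FX X FX 0 0 c c')"
    using c e FX by (simp add: B.gcomp_gident_right B.gcomp_closed)
  also have "\<dots> = gcomp B FX X FX 0 2 (gcomp B X FX FX 0 2 (gcomp B FX FX FX 1 1 ?e ?e) c) c'"
    using c(1,2) e FX Xd by (simp add: B.gcomp_assoc B.gcomp_closed)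
  also have "\<dots> = \<one>\<^bsub>ghom_group B FX FX 2\<^esub>"
    unfolding 0 using c FX Xd(1) B.gcomp_one_left[of FX X FX c' 0 2] by simp
  finally show ?thesis
    using d' Xb by (simp add: curved_complex_def kerhom_def A.gcomp_closed garr_map_gcomp)
qed

lemmas curved_P = curved_complex_lift[OF db]
lemmas FP_complex = complex_map_curved_complex[OF curved_P]

lemma \<gamma>_isos: "\<gamma> \<in> isos (homotopy_cat B) (X, d) FP"
proof -
  obtain c' where c: "c \<in> ghom B X FX 0" "c' \<in> ghom B FX X 0"
    "gcomp B X FX X 0 0 c' c = gident B X" "gcomp B FX X FX 0 0 c c' = gident B FX"
    by (rule c_inverse)
  let ?e = "garr_map F Xb Xb 1 db"
  have e: "?e \<in> ghom B FX FX 1" "gcomp B X FX FX 0 1 ?e c = gcomp B X X FX 1 0 c d"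
    using db Xb by (auto simp: graded_map_lift_def garr_map_closed)
  have 1: "chain_map B (X, d) FP c"
    using c e Xd FX
    by (simp add: chain_map_def complex_map_def B.gdiff_eq signed_def B.ghom_group_simps B.ghom_closed)
  have "gcomp B FX FX X 1 0 c' ?e = gcomp B FX X X 0 1 d c'"
  proof -
    have "?e = gcomp B FX FX FX 0 1 ?e (gcomp B FX X FX 0 0 c c')"
      using c e FX by (simp add: B.gcomp_gident_right)
    also have "\<dots> = gcomp B FX X FX 0 1 (gcomp B X FX FX 0 1 ?e c) c'"
      using c e(1) FX Xd by (simp add: B.gcomp_assoc)
    also have "\<dots> = gcomp B FX X FX 1 0 c (gcomp B FX X X 0 1 d c')"
      unfolding e(2) using c FX Xd by (simp add: B.gcomp_assoc)
    finally have "gcomp B FX FX X 1 0 c' ?e = gcomp B FX X X 1 0 (gcomp B X FX X 0 0 c' c) (gcomp B FX X X 0 1 d c')"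
      using c(1,2) FX Xd by (simp add: B.gcomp_assoc B.gcomp_closed)
    then show ?thesis using c FX Xd by (simp add: B.gcomp_gident_left B.gcomp_closed)
  qed
  then have 2: "chain_map B FP (X, d) c'"
    using c e Xd FX
    by (simp add: chain_map_def complex_map_def B.gdiff_eq signed_def B.ghom_group_simps B.ghom_closed)
  show "\<gamma> \<in> isos (homotopy_cat B) (X, d) FP"
    using X_d FP_complex 1 2 B.Comp_homotopy_cat[OF X_d FP_complex X_d 1 2]
      B.Comp_homotopy_cat[OF FP_complex X_d FP_complex 2 1] c
    by (intro category.isosI[OF B.category_homotopy_cat, of _ _ _ "hclass B FP (X, d) c'"])
       (auto simp: B.Arr_homotopy_cat B.homotopy_cat_simps fst_complex_map)
qed

lemma L_iso_rel:
  "((P, \<beta>), (Q, \<beta>')) \<in> iso_rel L \<longleftrightarrow> P \<in> complexes A \<and> Q \<in> complexes A \<and>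
    \<beta> \<in> isos (homotopy_cat B) (X, d) (complex_map F P) \<and>
    \<beta>' \<in> isos (homotopy_cat B) (X, d) (complex_map F Q) \<and>
    (\<exists>u \<in> isos (homotopy_cat A) P Q. Comp (homotopy_cat B) (X, d) (complex_map F P) (complex_map F Q)
       (farr (homotopy_functor B F) P Q u) \<beta> = \<beta>')"
  using iso_rel_lift_groupoid[OF A.category_homotopy_cat B.category_homotopy_cat
      cat_functor_homotopy_functor, of "(X, d)"] X_d
  by (simp add: A.homotopy_cat_simps B.homotopy_cat_simps fobj_homotopy_functor)

lemma equiv_L: "equiv (Obj L) (iso_rel L)"
  using X_d by (intro equiv_iso_rel_lift_groupoid[OF A.category_homotopy_cat B.category_homotopy_cat
      cat_functor_homotopy_functor]) (simp add: B.homotopy_cat_simps)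

lemma Obj_L: "(P, \<beta>) \<in> Obj L \<longleftrightarrow>
    P \<in> complexes A \<and> \<beta> \<in> isos (homotopy_cat B) (X, d) (complex_map F P)"
  by (simp add: lift_groupoid_def A.homotopy_cat_simps fobj_homotopy_functor)

subsection \<open>Lifts on the given graded object\<close>

text \<open>
  Lifts of the differential on the given graded object that have square zero. With \<open>\<gamma>\<close>, the
  homotopy class of \<open>c\<close>, each of them gives an object of the groupoid of lifts.
\<close>

definition strict :: "(int \<Rightarrow> 'm) \<Rightarrow> bool" where
  "strict d' \<longleftrightarrow> graded_map_lift A B F X d Xb c d' \<and> (Xb, d') \<in> complexes A"

lemma strictD:
  assumes "strict d'"
  shows "graded_map_lift A B F X d Xb c d'" "(Xb, d') \<in> complexes A" "complex_map F (Xb, d') = FP"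
    "((Xb, d'), \<gamma>) \<in> Obj L"
  using assms \<gamma>_isos by (simp_all add: strict_def complex_map_lift Obj_L)

lemma gdiff_lift:
  assumes "graded_map_lift A B F X d Xb c d'" "k \<in> kerhom Xb Xb n"
  shows "gdiff A (Xb, d') (Xb, d') n k = gdiff A (Xb, db) (Xb, db) n k"
  using assms Xb lift_ghom[OF db] unfolding graded_map_lift_iff by (auto simp: gdiff_twist)

lemma gcomp_lift_mult:
  assumes "graded_map_lift A B F X d Xb c d'" "h \<in> kerhom Xb Xb 1"
  shows "gcomp A Xb Xb Xb 1 1 (d' \<otimes>\<^bsub>G 1\<^esub> h) (d' \<otimes>\<^bsub>G 1\<^esub> h) =
    gcomp A Xb Xb Xb 1 1 d' d' \<otimes>\<^bsub>G 2\<^esub> gdiff A (Xb, db) (Xb, db) 1 h"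
  using gcomp_twist[OF Xb lift_ghom[OF assms(1)] assms(2)] gdiff_lift[OF assms] by simp

lemma strict_mult_iff:
  assumes "strict d'" "h \<in> kerhom Xb Xb 1"
  shows "strict (d' \<otimes>\<^bsub>G 1\<^esub> h) \<longleftrightarrow> gdiff A (Xb, db) (Xb, db) 1 h = \<one>\<^bsub>G 2\<^esub>"
proof -
  note s = strictD[OF assms(1)]
  have "gdiff A (Xb, db) (Xb, db) 1 h \<in> ghom A Xb Xb 2"
    using Xb lift_ghom[OF db] assms by (simp add: A.gdiff_closed kerhom_ghom)
  then show ?thesis
    using s assms Xb lift_ghom[OF s(1)] A.complexesD[OF s(2)]
    by (auto simp: strict_def lift_mult_kerhom complexes_def gcomp_lift_mult A.ghom_group_simps
        A.ghom_closed kerhom_ghom)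
qed

text \<open>
  If \<open>db\<^sup>2 = \<delta>(y)\<close> then \<open>db - y\<close> has square \<open>db\<^sup>2 - \<delta>(y) = 0\<close>, and all lifts have the form
  \<open>db + h\<close>.
\<close>

lemma ex_strict_iff:
  "(\<exists>d'. strict d') \<longleftrightarrow> (\<exists>y \<in> kerhom Xb Xb 1. gcomp A Xb Xb Xb 1 1 db db = gdiff A (Xb, db) (Xb, db) 1 y)"
    (is "_ \<longleftrightarrow> (\<exists>y \<in> _. ?o = ?D y)")
proof
  have D: "?D y \<in> ghom A Xb Xb 2" if "y \<in> kerhom Xb Xb 1" for y
    using Xb lift_ghom[OF db] that by (simp add: A.gdiff_closed kerhom_ghom)
  have o: "?o \<in> ghom A Xb Xb 2" using Xb lift_ghom[OF db] by (simp add: A.gcomp_closed)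
  have i: "?D (inv\<^bsub>G 1\<^esub> y) = inv\<^bsub>G 2\<^esub> ?D y" if "y \<in> kerhom Xb Xb 1" for y
    using Xb lift_ghom[OF db] that by (simp add: A.gdiff_inv kerhom_ghom)
  {
    assume "\<exists>d'. strict d'"
    then obtain h where h: "h \<in> kerhom Xb Xb 1" "(Xb, db \<otimes>\<^bsub>G 1\<^esub> h) \<in> complexes A"
      by (auto simp: strict_def graded_map_lift_iff)
    then have "?o \<otimes>\<^bsub>G 2\<^esub> ?D h = \<one>\<^bsub>G 2\<^esub>" using gcomp_lift_mult[OF db h(1)] by (simp add: complexes_def)
    then have "?o = ?D (inv\<^bsub>G 1\<^esub> h)"
      using group.inv_equality[OF A.group_ghom[OF Xb Xb, of 2], of ?o "?D h"] o D[OF h(1)] i[OF h(1)] by simp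
    then show "\<exists>y \<in> kerhom Xb Xb 1. ?o = ?D y" using kerhom_inv[OF Xb Xb h(1)] by blast
  }
  assume "\<exists>y \<in> kerhom Xb Xb 1. ?o = ?D y"
  then obtain y where y: "y \<in> kerhom Xb Xb 1" "?o = ?D y" by blast
  let ?d = "db \<otimes>\<^bsub>G 1\<^esub> inv\<^bsub>G 1\<^esub> y"
  have "graded_map_lift A B F X d Xb c ?d"
    using db Xb y by (intro lift_mult_kerhom kerhom_inv)
  moreover have "gcomp A Xb Xb Xb 1 1 ?d ?d = \<one>\<^bsub>G 2\<^esub>"
    using gcomp_lift_mult[OF db kerhom_inv[OF Xb Xb y(1)]] D[OF y(1)] Xb
    by (simp add: i[OF y(1)] y(2) A.ghom_group_simps)
  ultimately show "\<exists>d'. strict d'"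
    using Xb by (auto simp: strict_def complexes_def dest: lift_ghom)
qed

text \<open>
  Both \<open>F(Xb, d')\<close> and \<open>F(Y, e)\<close> are identified with \<open>(X, d)\<close>, by \<open>\<gamma>\<close> and by \<open>\<beta>\<close>. The map \<open>b\<close> is a
  graded lift of the resulting homotopy equivalence \<open>\<beta> \<gamma>\<^sup>-\<^sup>1\<close>, which makes it compatible with the
  structure maps of the two lifts, and \<open>a\<close> is a graded lift of its inverse.
\<close>

lemma comparison:
  assumes Q: "((Y, e), \<beta>) \<in> Obj L" and d': "graded_map_lift A B F X d Xb c d'"
  obtains a b where "left_inverse_mod_kernel (Xb, d') (Y, e) a b"
    "left_inverse_mod_kernel (Y, e) (Xb, d') b a"
    "chain_map B FP (complex_map F (Y, e)) (garr_map F Xb Y 0 b)"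
    "hclass B FP (complex_map F (Y, e)) (garr_map F Xb Y 0 b) \<in> isos (homotopy_cat B) FP (complex_map F (Y, e))"
    "Comp (homotopy_cat B) (X, d) FP (complex_map F (Y, e))
      (hclass B FP (complex_map F (Y, e)) (garr_map F Xb Y 0 b)) \<gamma> = \<beta>"
proof -
  interpret K: category "homotopy_cat B" by (rule B.category_homotopy_cat)
  have Qc: "(Y, e) \<in> complexes A" and \<beta>: "\<beta> \<in> isos (homotopy_cat B) (X, d) (complex_map F (Y, e))"
    using Q by (simp_all add: Obj_L)
  note FQ = complex_map_closed[OF Qc]
  have ob: "(X, d) \<in> Obj (homotopy_cat B)" "FP \<in> Obj (homotopy_cat B)"
    "complex_map F (Y, e) \<in> Obj (homotopy_cat B)"
    using X_d FP_complex FQ by (simp_all add: B.homotopy_cat_simps)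
  obtain \<gamma>' where \<gamma>': "\<gamma>' \<in> isos (homotopy_cat B) FP (X, d)"
    "Comp (homotopy_cat B) (X, d) FP (X, d) \<gamma>' \<gamma> = Ident (homotopy_cat B) (X, d)"
    by (rule K.isosE[OF \<gamma>_isos])
  let ?\<psi> = "Comp (homotopy_cat B) FP (X, d) (complex_map F (Y, e)) \<beta> \<gamma>'"
  have \<psi>: "?\<psi> \<in> isos (homotopy_cat B) FP (complex_map F (Y, e))"
    using ob \<beta> \<gamma>' by (intro K.Comp_isos) auto
  have "Comp (homotopy_cat B) (X, d) FP (complex_map F (Y, e)) ?\<psi> \<gamma> =
      Comp (homotopy_cat B) (X, d) (X, d) (complex_map F (Y, e)) \<beta> (Comp (homotopy_cat B) (X, d) FP (X, d) \<gamma>' \<gamma>)"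
    using ob \<beta> \<gamma>' \<gamma>_isos by (intro K.Comp_assoc[symmetric] K.isos_Arr) auto
  then have \<psi>\<gamma>: "Comp (homotopy_cat B) (X, d) FP (complex_map F (Y, e)) ?\<psi> \<gamma> = \<beta>"
    using ob \<beta> \<gamma>' by (simp add: K.Ident_right K.isos_Arr)
  obtain f where f: "?\<psi> = hclass B FP (complex_map F (Y, e)) f" "chain_map B FP (complex_map F (Y, e)) f"
    using K.isos_Arr[OF \<psi>] FP_complex FQ by (auto simp: B.Arr_homotopy_cat)
  have "f \<in> ghom B FX (gobj_map F Y) 0" using f by (simp add: chain_map_def fst_complex_map)
  then obtain b where b: "b \<in> ghom A Xb Y 0" "garr_map F Xb Y 0 b = f"
    by (rule garr_map_surj[OF Xb A.complexesD(1)[OF Qc]])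
  obtain a where "left_inverse_mod_kernel (Xb, d') (Y, e) a b" "left_inverse_mod_kernel (Y, e) (Xb, d') b a"
    using inverse_mod_kernel_if_isos[OF curved_complex_lift[OF d'] curved_complex_if_complex[OF Qc] b(1)]
      \<psi> f b unfolding complex_map_lift[OF d'] by auto
  then show ?thesis using that[of a b] \<psi> \<psi>\<gamma> f b by simp
qed

text \<open>
  For \<open>b\<close> as in the comparison lemma, \<open>\<delta>(\<delta>(b)) = e\<^sup>2 b - b db\<^sup>2 = - b db\<^sup>2\<close>. So \<open>b db\<^sup>2\<close> is the
  coboundary of the element \<open>-\<delta>(b)\<close> of the kernel, and as \<open>b\<close> acts injectively on cohomology,
  \<open>db\<^sup>2\<close> is a coboundary itself.
\<close>

lemma ex_strict_if_lift:
  assumes "((Y, e), \<beta>) \<in> Obj L"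
  shows "\<exists>d'. strict d'"
proof -
  obtain a b where ab: "left_inverse_mod_kernel (Xb, db) (Y, e) a b"
    using comparison[OF assms db] by blast
  have b: "b \<in> ghom A Xb Y 0" "gdiff A (Xb, db) (Y, e) 0 b \<in> kerhom Xb Y 1"
    using ab by (auto simp: left_inverse_mod_kernel_def)
  have Q: "(Y, e) \<in> complexes A" using assms by (simp add: Obj_L)
  note D = A.complexesD[OF Q] and P = curved_complexD[OF curved_P]
  let ?o = "gcomp A Xb Xb Xb 1 1 db db" and ?y = "inv\<^bsub>ghom_group A Xb Y 1\<^esub> gdiff A (Xb, db) (Y, e) 0 b"
  have y: "?y \<in> kerhom Xb Y 1" using b D P by (simp add: kerhom_inv)
  have "gcomp A Xb Xb Y 2 0 b ?o = gdiff A (Xb, db) (Y, e) 1 ?y"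
    using b D P A.gdiff_gdiff[of Xb Y db e b 0]
    by (simp add: A.gdiff_inv kerhom_ghom A.gcomp_additive A.ghom_group_simps A.ghom_closed)
  then obtain w where "w \<in> kerhom Xb Xb 1" "?o = gdiff A (Xb, db) (Xb, db) 1 w"
    using kerhom_exact_if_gcomp_exact[OF curved_P curved_P curved_complex_if_complex[OF Q] ab P(3), of ?y]
      gdiff_gcomp_self[OF Xb lift_ghom[OF db]] y by auto
  then show ?thesis unfolding ex_strict_iff by blast
qed

text \<open>
  For \<open>h = \<delta>(k)\<close>, the map \<open>1 - k\<close> is an isomorphism from \<open>(Xb, d')\<close> to \<open>(Xb, d' + h)\<close>. Its image
  under \<open>F\<close> is the identity, so it respects the structure map \<open>\<gamma>\<close> on both sides.
\<close>

lemma iso_strict_if_coboundary: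
  assumes s: "strict d'" and s': "strict (d' \<otimes>\<^bsub>G 1\<^esub> h)" and h: "h \<in> kerhom Xb Xb 1"
    and k: "k \<in> kerhom Xb Xb 0" "h = gdiff A (Xb, db) (Xb, db) 0 k"
  shows "(((Xb, d'), \<gamma>), ((Xb, d' \<otimes>\<^bsub>G 1\<^esub> h), \<gamma>)) \<in> iso_rel L"
proof -
  interpret K: category "homotopy_cat B" by (rule B.category_homotopy_cat)
  let ?k = "inv\<^bsub>G 0\<^esub> k" and ?Q = "(Xb, d' \<otimes>\<^bsub>G 1\<^esub> h)"
  note S = strictD[OF s] and S' = strictD[OF s']
  have k': "?k \<in> kerhom Xb Xb 0" using Xb k by (simp add: kerhom_inv)
  have "gdiff A (Xb, d') (Xb, d') 0 ?k = inv\<^bsub>G 1\<^esub> h"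
    using gdiff_lift[OF S(1) k'] k Xb lift_ghom[OF db] by (simp add: A.gdiff_inv kerhom_ghom)
  then have hk: "h \<otimes>\<^bsub>G 1\<^esub> gdiff A (Xb, d') (Xb, d') 0 ?k = \<one>\<^bsub>G 1\<^esub>"
    using h Xb by (simp add: A.ghom_group_simps kerhom_ghom)
  note u = unipotent_isos[OF S(2) S'(2) h k' hk]
  have "farr (homotopy_functor B F) (Xb, d') ?Q (hclass A (Xb, d') ?Q (gident A Xb \<otimes>\<^bsub>G 0\<^esub> ?k))
      = hclass B FP FP (gident B FX)"
    using farr_homotopy_functor[OF S(2) S'(2) u(1)] S(3) S'(3) Xb k'
    by (simp add: garr_map_mult_kerhom A.gident_closed garr_map_gident)
  moreover have "Comp (homotopy_cat B) (X, d) FP FP (hclass B FP FP (gident B FX)) \<gamma> = \<gamma>"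
    using K.Ident_left[of "(X, d)" FP \<gamma>] X_d FP_complex K.isos_Arr[OF \<gamma>_isos]
    by (simp add: B.homotopy_cat_simps fst_complex_map)
  ultimately show ?thesis
    unfolding L_iso_rel using S S' \<gamma>_isos by (auto intro!: bexI[OF _ u(2)])
qed

text \<open>
  Cancelling \<open>\<gamma>\<close> shows that an isomorphism of lifts maps to the class of the identity. Its
  representative \<open>f\<close> thus satisfies \<open>F(f) = \<delta>(\<sigma>) + 1\<close>, and lifting the homotopy \<open>\<sigma>\<close> to \<open>t\<close> gives
  \<open>f = \<delta>(t) + 1 + k\<close> with \<open>k\<close> in the kernel. Then \<open>1 + k\<close> is a chain map as well, which means
  \<open>h = - \<delta>(k)\<close>.
\<close>

lemma coboundary_if_iso_strict:
  assumes s: "strict d'" and s': "strict (d' \<otimes>\<^bsub>G 1\<^esub> h)" and h: "h \<in> kerhom Xb Xb 1"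
    and iso: "(((Xb, d'), \<gamma>), ((Xb, d' \<otimes>\<^bsub>G 1\<^esub> h), \<gamma>)) \<in> iso_rel L"
  shows "\<exists>k \<in> kerhom Xb Xb 0. h = gdiff A (Xb, db) (Xb, db) 0 k"
proof -
  interpret K: category "homotopy_cat B" by (rule B.category_homotopy_cat)
  interpret KF: cat_functor "homotopy_cat A" "homotopy_cat B" "homotopy_functor B F"
    by (rule cat_functor_homotopy_functor)
  let ?P = "(Xb, d')" and ?Q = "(Xb, d' \<otimes>\<^bsub>G 1\<^esub> h)"
  note S = strictD[OF s] and S' = strictD[OF s']
  note D = A.complexesD[OF S(2)] A.complexesD[OF S'(2)]
  obtain u where u: "u \<in> Arr (homotopy_cat A) ?P ?Q"
    and u\<gamma>: "Comp (homotopy_cat B) (X, d) FP FP (farr (homotopy_functor B F) ?P ?Q u) \<gamma> = \<gamma>"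
    using iso S S' unfolding L_iso_rel by (auto simp: isos_def)
  obtain f where f: "u = hclass A ?P ?Q f" "chain_map A ?P ?Q f"
    using u S S' by (auto simp: A.Arr_homotopy_cat)
  have fc: "f \<in> ghom A Xb Xb 0" "gdiff A ?P ?Q 0 f = \<one>\<^bsub>G 1\<^esub>" using f by (simp_all add: chain_map_def)
  have Ff: "farr (homotopy_functor B F) ?P ?Q u = hclass B FP FP (garr_map F Xb Xb 0 f)"
    "chain_map B FP FP (garr_map F Xb Xb 0 f)"
    using farr_homotopy_functor[OF S(2) S'(2) f(2)] chain_map_garr_map[OF S(2) S'(2) f(2)] f S S' by simp_all
  have ob: "(X, d) \<in> Obj (homotopy_cat B)" "FP \<in> Obj (homotopy_cat B)"
    using X_d FP_complex by (simp_all add: B.homotopy_cat_simps)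
  obtain \<gamma>' where \<gamma>': "\<gamma>' \<in> Arr (homotopy_cat B) FP (X, d)"
    "Comp (homotopy_cat B) FP (X, d) FP \<gamma> \<gamma>' = Ident (homotopy_cat B) FP"
    using \<gamma>_isos by (auto simp: isos_def)
  let ?v = "hclass B FP FP (garr_map F Xb Xb 0 f)"
  have va: "?v \<in> Arr (homotopy_cat B) FP FP" using Ff FP_complex by (auto simp: B.Arr_homotopy_cat)
  have "?v = Comp (homotopy_cat B) FP FP FP ?v (Comp (homotopy_cat B) FP (X, d) FP \<gamma> \<gamma>')"
    using va ob \<gamma>' by (simp add: K.Ident_right)
  also have "\<dots> = Comp (homotopy_cat B) FP (X, d) FP (Comp (homotopy_cat B) (X, d) FP FP ?v \<gamma>) \<gamma>'"
    using va ob \<gamma>' K.isos_Arr[OF \<gamma>_isos] by (intro K.Comp_assoc) auto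
  also have "\<dots> = hclass B FP FP (gident B FX)"
    using u\<gamma> Ff \<gamma>' by (simp add: B.homotopy_cat_simps fst_complex_map)
  finally obtain \<sigma> where \<sigma>: "\<sigma> \<in> ghom B FX FX (- 1)"
    "garr_map F Xb Xb 0 f = gdiff B FP FP (- 1) \<sigma> \<otimes>\<^bsub>ghom_group B FX FX 0\<^esub> gident B FX"
    using B.hclass_eq_iff[OF FP_complex FP_complex Ff(2) B.chain_map_gident[OF FP_complex]]
    by (auto simp: fst_complex_map)
  obtain t where t: "t \<in> ghom A Xb Xb (- 1)" "garr_map F Xb Xb (- 1) t = \<sigma>"
    using \<sigma>(1) by (rule garr_map_surj[OF Xb Xb])
  let ?dt = "gdiff A ?P ?Q (- 1) t"
  have dt: "?dt \<in> ghom A Xb Xb 0" using D t by (simp add: A.gdiff_closed)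
  have "garr_map F Xb Xb 0 f = garr_map F Xb Xb 0 (?dt \<otimes>\<^bsub>G 0\<^esub> gident A Xb)"
    using \<sigma>(2) D t dt S(3) S'(3)
    by (simp add: garr_map_mult A.gident_closed garr_map_gdiff garr_map_gident)
  then obtain k where k: "k \<in> kerhom Xb Xb 0" "f = ?dt \<otimes>\<^bsub>G 0\<^esub> gident A Xb \<otimes>\<^bsub>G 0\<^esub> k"
    using garr_map_eqE[OF Xb Xb fc(1), of "?dt \<otimes>\<^bsub>G 0\<^esub> gident A Xb"] Xb dt by (auto simp: A.ghom_closed)
  have k0: "k \<in> ghom A Xb Xb 0" using k by (simp add: kerhom_ghom)
  have ddt: "gdiff A ?P ?Q 0 ?dt = \<one>\<^bsub>G 1\<^esub>"
    using A.gdiff_gdiff_complex[OF S(2) S'(2) t(1), of 0] by simp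
  have "\<one>\<^bsub>G 1\<^esub> = gdiff A ?P ?Q 0 (?dt \<otimes>\<^bsub>G 0\<^esub> (gident A Xb \<otimes>\<^bsub>G 0\<^esub> k))"
    using fc(2) k dt k0 Xb by (simp add: A.ghom_group_simps A.gident_closed)
  also have "\<dots> = gdiff A ?P ?Q 0 (gident A Xb \<otimes>\<^bsub>G 0\<^esub> k)"
    using ddt dt k0 Xb D
      A.gdiff_mult[OF Xb Xb D(2) D(5) dt, of "gident A Xb \<otimes>\<^bsub>G 0\<^esub> k"]
      A.gdiff_closed[OF Xb Xb D(2) D(5), of "gident A Xb \<otimes>\<^bsub>G 0\<^esub> k" 0 1]
    by (simp add: A.ghom_group_simps A.ghom_closed)
  also have "\<dots> = h \<otimes>\<^bsub>G 1\<^esub> gdiff A (Xb, db) (Xb, db) 0 k"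
    using gdiff_unipotent[OF Xb D(2) h k(1)] gdiff_lift[OF S(1) k(1)] by simp
  finally have "h = inv\<^bsub>G 1\<^esub> gdiff A (Xb, db) (Xb, db) 0 k"
    using group.inv_equality[OF A.group_ghom[OF Xb Xb, of 1], of h "gdiff A (Xb, db) (Xb, db) 0 k"] h k0 Xb
      lift_ghom[OF db] by (simp add: A.gdiff_closed kerhom_ghom)
  also have "\<dots> = gdiff A (Xb, db) (Xb, db) 0 (inv\<^bsub>G 0\<^esub> k)"
    using k0 Xb lift_ghom[OF db] by (simp add: A.gdiff_inv)
  finally show ?thesis using kerhom_inv[OF Xb Xb k(1)] by blast
qed

text \<open>
  The failure \<open>z = \<delta>(b)\<close> of the comparison map \<open>b\<close> to be a chain map is a cocycle of the kernel,
  and \<open>h = a z\<close> satisfies \<open>b h = b a z = z + \<delta>(w)\<close>. Changing the differential to \<open>d' + h\<close> changes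
  \<open>\<delta>(b)\<close> by \<open>- b h\<close>, and replacing \<open>b\<close> by \<open>b + w\<close> adds \<open>\<delta>(w)\<close>; so \<open>b + w\<close> is a chain map out of
  \<open>(Xb, d' + h)\<close>. It has the same image as \<open>b\<close>, hence is an isomorphism of lifts.
\<close>

lemma lift_iso_strict:
  assumes s: "strict d'" and Q: "((Y, e), \<beta>) \<in> Obj L"
  obtains h where "h \<in> kerhom Xb Xb 1" "strict (d' \<otimes>\<^bsub>G 1\<^esub> h)"
    "(((Xb, d' \<otimes>\<^bsub>G 1\<^esub> h), \<gamma>), ((Y, e), \<beta>)) \<in> iso_rel L"
proof -
  note S = strictD[OF s]
  obtain a b where ab: "left_inverse_mod_kernel (Xb, d') (Y, e) a b"
    and ba: "left_inverse_mod_kernel (Y, e) (Xb, d') b a"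
    and Fb: "chain_map B FP (complex_map F (Y, e)) (garr_map F Xb Y 0 b)"
    "hclass B FP (complex_map F (Y, e)) (garr_map F Xb Y 0 b) \<in> isos (homotopy_cat B) FP (complex_map F (Y, e))"
    "Comp (homotopy_cat B) (X, d) FP (complex_map F (Y, e))
      (hclass B FP (complex_map F (Y, e)) (garr_map F Xb Y 0 b)) \<gamma> = \<beta>"
    by (rule comparison[OF Q S(1)])
  have Qc: "(Y, e) \<in> complexes A" and \<beta>: "\<beta> \<in> isos (homotopy_cat B) (X, d) (complex_map F (Y, e))"
    using Q by (simp_all add: Obj_L)
  note D = A.complexesD[OF S(2)] A.complexesD[OF Qc]
  note CP = curved_complex_if_complex[OF S(2)] and CQ = curved_complex_if_complex[OF Qc]
  let ?z = "gdiff A (Xb, d') (Y, e) 0 b"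
  have b: "b \<in> ghom A Xb Y 0" "?z \<in> kerhom Xb Y 1"
    and a: "a \<in> ghom A Y Xb 0" "gdiff A (Y, e) (Xb, d') 0 a \<in> kerhom Y Xb 1"
    using ab by (auto simp: left_inverse_mod_kernel_def)
  have dz: "gdiff A (Xb, d') (Y, e) 1 ?z = \<one>\<^bsub>ghom_group A Xb Y (1 + 1)\<^esub>"
    using A.gdiff_gdiff_complex[OF S(2) Qc b(1), of 1] by simp
  \<comment> \<open>The lift of the inverse of \<open>b\<close> carries the failure of \<open>b\<close> to be a chain map back to \<open>Xb\<close>.\<close>
  define h where "h = gcomp A Xb Y Xb 1 0 a ?z"
  have h: "h \<in> kerhom Xb Xb 1" unfolding h_def using D a b by (simp add: kerhom_gcomp_right)
  have "gdiff A (Xb, d') (Xb, d') 1 h = \<one>\<^bsub>G 2\<^esub>"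
    unfolding h_def using D a b dz kerhom_gcomp_kerhom[OF D(1,4,1) b(2) a(2)]
    by (simp add: A.gdiff_gcomp kerhom_ghom signed_def A.gcomp_additive A.ghom_group_simps A.ghom_closed)
  then have s': "strict (d' \<otimes>\<^bsub>G 1\<^esub> h)"
    using strict_mult_iff[OF s h] gdiff_lift[OF S(1) h] by simp
  note S' = strictD[OF s']
  obtain w where w: "w \<in> kerhom Xb Y 0"
    "gcomp A Xb Xb Y 1 0 b h = ?z \<otimes>\<^bsub>ghom_group A Xb Y 1\<^esub> gdiff A (Xb, d') (Y, e) 0 w"
    using gcomp_left_inverse_mod_kernel[OF CP CQ CP ba b(2) dz] unfolding h_def by auto
  let ?f = "b \<otimes>\<^bsub>ghom_group A Xb Y 0\<^esub> w"
  have cl: "w \<in> ghom A Xb Y 0" "gdiff A (Xb, d') (Y, e) 0 w \<in> ghom A Xb Y 1" "?z \<in> ghom A Xb Y 1"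
    using w D b by (simp_all add: A.gdiff_closed kerhom_ghom)
  have "gdiff A (Xb, d' \<otimes>\<^bsub>G 1\<^esub> h) (Y, e) 0 ?f = \<one>\<^bsub>ghom_group A Xb Y 1\<^esub>"
    using D b cl h w kerhom_gcomp_kerhom[OF D(1,1,4) h w(1)]
    by (simp add: gdiff_twist_source kerhom_ghom A.ghom_closed A.gdiff_mult A.gcomp_additive
        A.ghom_group_simps A.ghom_cancel A.ghom_m_comm A.ghom_m_lcomm)
  then have f: "chain_map A (Xb, d' \<otimes>\<^bsub>G 1\<^esub> h) (Y, e) ?f"
    using D b cl by (simp add: chain_map_def A.ghom_closed)
  have Ff: "garr_map F Xb Y 0 ?f = garr_map F Xb Y 0 b"
    using D b w by (simp add: garr_map_mult_kerhom)
  have "hclass A (Xb, d' \<otimes>\<^bsub>G 1\<^esub> h) (Y, e) ?f \<in> isos (homotopy_cat A) (Xb, d' \<otimes>\<^bsub>G 1\<^esub> h) (Y, e)"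
    using isos_reflected[OF S'(2) Qc f] Fb(2) Ff S'(3) by simp
  moreover have "farr (homotopy_functor B F) (Xb, d' \<otimes>\<^bsub>G 1\<^esub> h) (Y, e) (hclass A (Xb, d' \<otimes>\<^bsub>G 1\<^esub> h) (Y, e) ?f)
      = hclass B FP (complex_map F (Y, e)) (garr_map F Xb Y 0 b)"
    using farr_homotopy_functor[OF S'(2) Qc f] Ff S'(3) by simp
  ultimately have "(((Xb, d' \<otimes>\<^bsub>G 1\<^esub> h), \<gamma>), ((Y, e), \<beta>)) \<in> iso_rel L"
    unfolding L_iso_rel using S' Qc \<beta> \<gamma>_isos Fb(3) by (auto intro!: bexI)
  with h s' show ?thesis by (rule that)
qed

end

context lifting_problem
begin

sublocale kernel: cochain_complex "kernel_group A B F Xb" "gdiff A (Xb, db) (Xb, db)"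
  by (rule cochain_complex_kernel[OF curved_P])

lemma kernel_cocycles_iff:
  "h \<in> kernel_cocycles A B F Xb db n \<longleftrightarrow>
    h \<in> kerhom Xb Xb n \<and> gdiff A (Xb, db) (Xb, db) n h = \<one>\<^bsub>G (n + 1)\<^esub>"
  by (simp add: cocycles_def kernel_group_simps)

text \<open>
  The element is in the kernel since \<open>F(d')\<^sup>2 = 0\<close>, and it is a cocycle since \<open>d'\<close> commutes with
  its own square.
\<close>

lemma gcomp_lift_cocycle:
  assumes "graded_map_lift A B F X d Xb c d'"
  shows "gcomp A Xb Xb Xb 1 1 d' d' \<in> kernel_cocycles A B F Xb db 2"
  using curved_complexD[OF curved_complex_lift[OF assms]] gdiff_lift[OF assms]
    gdiff_gcomp_self[OF Xb lift_ghom[OF assms]]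
  by (simp add: kernel_cocycles_iff)

lemma obstruction_independent:
  assumes "graded_map_lift A B F X d Xb c d'"
  shows "kernel_class A B F Xb db 2 (gcomp A Xb Xb Xb 1 1 d' d') =
    kernel_class A B F Xb db 2 (gcomp A Xb Xb Xb 1 1 db db)"
proof -
  obtain h where h: "h \<in> kerhom Xb Xb 1" "d' = db \<otimes>\<^bsub>G 1\<^esub> h"
    using assms graded_map_lift_iff by blast
  have "gdiff A (Xb, db) (Xb, db) 1 h \<in> ghom A Xb Xb 2" "gcomp A Xb Xb Xb 1 1 db db \<in> ghom A Xb Xb 2"
    using h Xb lift_ghom[OF db] by (simp_all add: A.gdiff_closed A.gcomp_closed kerhom_ghom)
  then have "gcomp A Xb Xb Xb 1 1 d' d' =
      gdiff A (Xb, db) (Xb, db) 1 h \<otimes>\<^bsub>G 2\<^esub> gcomp A Xb Xb Xb 1 1 db db"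
    using gcomp_lift_mult[OF db h(1)] Xb by (simp add: h(2) A.ghom_m_comm)
  then show ?thesis
    using h kernel.coh_class_eq_iff[OF gcomp_lift_cocycle[OF assms] gcomp_lift_cocycle[OF db]]
    by (auto simp: kernel_group_simps)
qed

lemma obstruction_trivial_iff_strict:
  "kernel_class A B F Xb db 2 (gcomp A Xb Xb Xb 1 1 db db) = \<one>\<^bsub>kernel_cohomology A B F Xb db 2\<^esub>
    \<longleftrightarrow> (\<exists>d'. strict d')"
  unfolding ex_strict_iff kernel.coh_class_trivial_iff[OF gcomp_lift_cocycle[OF db]]
  by (simp add: kernel_group_simps)

lemma ex_strict_iff_lift: "(\<exists>d'. strict d') \<longleftrightarrow> Obj L \<noteq> {}"
proof
  assume "\<exists>d'. strict d'"
  then show "Obj L \<noteq> {}" using strictD(4) by blast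
next
  assume "Obj L \<noteq> {}"
  then obtain Y e \<beta> where "((Y, e), \<beta>) \<in> Obj L" by fastforce
  then show "\<exists>d'. strict d'" by (rule ex_strict_if_lift)
qed

abbreviation lift_class :: "(int \<Rightarrow> 'm) \<Rightarrow> (((int \<Rightarrow> 'o) \<times> (int \<Rightarrow> 'm)) \<times> (int \<Rightarrow> 'n) set) set"
  where "lift_class \<equiv> strict_lift_class A B F X d Xb c"

lemma lift_class_eq: "strict d' \<Longrightarrow> lift_class d' = iso_rel L `` {((Xb, d'), \<gamma>)}"
  by (simp add: strict_lift_class_def strictD(3))

lemma lift_class_eq_iff:
  assumes "strict d'" "strict d''"
  shows "lift_class d' = lift_class d'' \<longleftrightarrow> (((Xb, d'), \<gamma>), ((Xb, d''), \<gamma>)) \<in> iso_rel L"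
  unfolding lift_class_eq[OF assms(1)] lift_class_eq[OF assms(2)]
  by (rule eq_equiv_class_iff[OF equiv_L strictD(4)[OF assms(1)] strictD(4)[OF assms(2)]])

lemma strict_mult_cocycle_iff:
  assumes "strict d'"
  shows "h \<in> kernel_cocycles A B F Xb db 1 \<longleftrightarrow> h \<in> kerhom Xb Xb 1 \<and> strict (d' \<otimes>\<^bsub>G 1\<^esub> h)"
  using strict_mult_iff[OF assms] by (auto simp: kernel_cocycles_iff)

text \<open>
  With \<open>d' + h\<close> as new base point, the other lift is \<open>(d' + h) + (h' - h)\<close>; the two are
  isomorphic exactly when \<open>h' - h\<close> is a coboundary.
\<close>

lemma lift_class_mult_eq_iff:
  assumes s: "strict d'" and h: "h \<in> kernel_cocycles A B F Xb db 1"
    and h': "h' \<in> kernel_cocycles A B F Xb db 1"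
  shows "lift_class (d' \<otimes>\<^bsub>G 1\<^esub> h') = lift_class (d' \<otimes>\<^bsub>G 1\<^esub> h) \<longleftrightarrow>
    kernel_class A B F Xb db 1 h' = kernel_class A B F Xb db 1 h"
proof -
  have sh: "strict (d' \<otimes>\<^bsub>G 1\<^esub> h)" and sh': "strict (d' \<otimes>\<^bsub>G 1\<^esub> h')"
    and k: "h \<in> kerhom Xb Xb 1" "h' \<in> kerhom Xb Xb 1"
    using h h' strict_mult_cocycle_iff[OF s] by auto
  let ?g = "inv\<^bsub>G 1\<^esub> h \<otimes>\<^bsub>G 1\<^esub> h'"
  note cl = lift_ghom[OF strictD(1)[OF s]] kerhom_ghom[OF k(1)] kerhom_ghom[OF k(2)] Xb
  have g: "?g \<in> kerhom Xb Xb 1" using k Xb by (simp add: kerhom_closed)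
  have e: "(d' \<otimes>\<^bsub>G 1\<^esub> h) \<otimes>\<^bsub>G 1\<^esub> ?g = d' \<otimes>\<^bsub>G 1\<^esub> h'"
    using cl by (simp add: A.ghom_group_simps A.ghom_closed A.ghom_cancel)
  have "lift_class (d' \<otimes>\<^bsub>G 1\<^esub> h) = lift_class (d' \<otimes>\<^bsub>G 1\<^esub> h') \<longleftrightarrow>
      (\<exists>k \<in> kerhom Xb Xb 0. ?g = gdiff A (Xb, db) (Xb, db) 0 k)"
    unfolding lift_class_eq_iff[OF sh sh']
    using iso_strict_if_coboundary[OF sh _ g, unfolded e, OF sh']
      coboundary_if_iso_strict[OF sh _ g, unfolded e, OF sh'] by blast
  also have "\<dots> \<longleftrightarrow> (\<exists>k \<in> kerhom Xb Xb 0. h' = gdiff A (Xb, db) (Xb, db) 0 k \<otimes>\<^bsub>G 1\<^esub> h)"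
  proof (intro bex_cong refl)
    fix k assume "k \<in> kerhom Xb Xb 0"
    then have dk: "gdiff A (Xb, db) (Xb, db) 0 k \<in> ghom A Xb Xb 1"
      using lift_ghom[OF db] Xb by (simp add: A.gdiff_closed kerhom_ghom)
    have "h' = h \<otimes>\<^bsub>G 1\<^esub> ?g" using cl by (simp add: A.ghom_cancel)
    then show "?g = gdiff A (Xb, db) (Xb, db) 0 k \<longleftrightarrow> h' = gdiff A (Xb, db) (Xb, db) 0 k \<otimes>\<^bsub>G 1\<^esub> h"
      using cl dk A.ghom_m_comm[OF Xb Xb dk cl(2)] A.ghom_cancel(2)[OF Xb Xb cl(2) dk] by metis
  qed
  also have "\<dots> \<longleftrightarrow> kernel_class A B F Xb db 1 h' = kernel_class A B F Xb db 1 h"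
    using kernel.coh_class_eq_iff[OF h' h] by (simp add: kernel_group_simps)
  finally show ?thesis by auto
qed

lemma lift_class_in_Sk: "strict d' \<Longrightarrow> lift_class d' \<in> Sk L"
  unfolding Sk_def by (simp add: lift_class_eq quotientI strictD(4))

lemma Sk_L:
  assumes s: "strict d'" and E: "E \<in> Sk L"
  obtains h where "h \<in> kernel_cocycles A B F Xb db 1" "E = lift_class (d' \<otimes>\<^bsub>G 1\<^esub> h)"
proof -
  obtain Y e \<beta> where Q: "((Y, e), \<beta>) \<in> Obj L" and E': "E = iso_rel L `` {((Y, e), \<beta>)}"
    using E unfolding Sk_def by (auto elim!: quotientE)
  obtain h where h: "h \<in> kerhom Xb Xb 1" "strict (d' \<otimes>\<^bsub>G 1\<^esub> h)"
    "(((Xb, d' \<otimes>\<^bsub>G 1\<^esub> h), \<gamma>), ((Y, e), \<beta>)) \<in> iso_rel L"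
    by (rule lift_iso_strict[OF s Q])
  then show ?thesis
    using that strict_mult_cocycle_iff[OF s] lift_class_eq equiv_class_eq[OF equiv_L h(3)] E' by auto
qed

text \<open>
  The map \<open>\<psi>\<close> sends the class of \<open>h\<close> to the isomorphism class of \<open>(Xb, d0 + h)\<close>. It is a bijection
  from the first cohomology to the isomorphism classes of lifts, along which the translation action
  is transported. The formula for the action holds for every base point \<open>d'\<close>, because
  \<open>d' = d0 + g\<close> for a cocycle \<open>g\<close> and then \<open>d' + h = d0 + (h + g)\<close>.
\<close>

lemma lift_classes_affine:
  assumes s: "strict d0"
  shows "\<exists>\<phi>. affine_over (kernel_cohomology A B F Xb db 1) (Sk L) \<phi> \<and>
    (\<forall>d' h. graded_map_lift A B F X d Xb c d' \<longrightarrow> (Xb, d') \<in> complexes A \<longrightarrow>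
       h \<in> kernel_cocycles A B F Xb db 1 \<longrightarrow>
       \<phi> (kernel_class A B F Xb db 1 h) (lift_class d') = lift_class (d' \<otimes>\<^bsub>G 1\<^esub> h))"
proof -
  let ?Z = "kernel_cocycles A B F Xb db 1" and ?cl = "kernel_class A B F Xb db 1"
  let ?H = "kernel_cohomology A B F Xb db 1"
  define \<psi> where "\<psi> U = lift_class (d0 \<otimes>\<^bsub>G 1\<^esub> (SOME h. h \<in> ?Z \<and> ?cl h = U))" for U
  have \<psi>: "\<psi> (?cl h) = lift_class (d0 \<otimes>\<^bsub>G 1\<^esub> h)" if h: "h \<in> ?Z" for h
  proof -
    have "(SOME h'. h' \<in> ?Z \<and> ?cl h' = ?cl h) \<in> ?Z \<and> ?cl (SOME h'. h' \<in> ?Z \<and> ?cl h' = ?cl h) = ?cl h"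
      by (rule someI[of _ h]) (simp add: h)
    then show ?thesis unfolding \<psi>_def using lift_class_mult_eq_iff[OF s h] by blast
  qed
  have H: "carrier ?H = ?cl ` ?Z" by (rule kernel.carrier_cohomology)
  have "bij_betw \<psi> (carrier ?H) (Sk L)"
  proof (rule bij_betw_imageI)
    show "inj_on \<psi> (carrier ?H)"
      unfolding H by (rule inj_onI) (auto simp: \<psi> lift_class_mult_eq_iff[OF s])
    have "\<psi> (?cl h) \<in> Sk L" if "h \<in> ?Z" for h
      using that strict_mult_cocycle_iff[OF s] by (auto simp: \<psi> intro: lift_class_in_Sk)
    moreover have "E \<in> \<psi> ` ?cl ` ?Z" if E: "E \<in> Sk L" for E
      by (rule Sk_L[OF s E]) (auto simp flip: \<psi>)
    ultimately show "\<psi> ` carrier ?H = Sk L" unfolding H by auto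
  qed
  then obtain \<phi> where aff: "affine_over ?H (Sk L) \<phi>"
    and \<phi>: "\<And>g h. \<lbrakk>g \<in> carrier ?H; h \<in> carrier ?H\<rbrakk> \<Longrightarrow> \<phi> g (\<psi> h) = \<psi> (g \<otimes>\<^bsub>?H\<^esub> h)"
    by (rule affine_over_if_bij_betw[OF kernel.cohomology_comm_group]) (rule that)
  have "\<phi> (?cl h) (lift_class d') = lift_class (d' \<otimes>\<^bsub>G 1\<^esub> h)"
    if d': "graded_map_lift A B F X d Xb c d'" "(Xb, d') \<in> complexes A" and h: "h \<in> ?Z" for d' h
  proof -
    have s': "strict d'" using d' by (simp add: strict_def)
    note cl = lift_ghom[OF strictD(1)[OF s]] lift_ghom[OF d'(1)] lift_ghom[OF db]
    obtain k0 where k0: "k0 \<in> kerhom Xb Xb 1" "d0 = db \<otimes>\<^bsub>G 1\<^esub> k0"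
      using graded_map_lift_iff strictD(1)[OF s] by blast
    obtain k' where k': "k' \<in> kerhom Xb Xb 1" "d' = db \<otimes>\<^bsub>G 1\<^esub> k'"
      using graded_map_lift_iff d'(1) by blast
    let ?g = "inv\<^bsub>G 1\<^esub> k0 \<otimes>\<^bsub>G 1\<^esub> k'"
    have e: "d' = d0 \<otimes>\<^bsub>G 1\<^esub> ?g"
      using cl k0 k' Xb by (simp add: A.ghom_group_simps A.ghom_closed A.ghom_cancel kerhom_ghom)
    have g: "?g \<in> ?Z"
      using strict_mult_cocycle_iff[OF s] s' e k0 k' Xb by (simp add: kerhom_closed)
    have hg: "h \<in> ghom A Xb Xb 1" "?g \<in> ghom A Xb Xb 1"
      using h g by (auto simp: kernel_cocycles_iff kerhom_ghom)
    have "\<phi> (?cl h) (lift_class d') = \<phi> (?cl h) (\<psi> (?cl ?g))"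
      using \<psi>[OF g] e by simp
    also have "\<dots> = \<psi> (?cl h \<otimes>\<^bsub>?H\<^esub> ?cl ?g)" using h g by (intro \<phi>) (simp_all add: H)
    also have "\<dots> = \<psi> (?cl (h \<otimes>\<^bsub>G 1\<^esub> ?g))"
      using kernel.coh_class_mult[OF h g] by (simp add: kernel_group_simps)
    also have "\<dots> = lift_class (d0 \<otimes>\<^bsub>G 1\<^esub> (h \<otimes>\<^bsub>G 1\<^esub> ?g))"
      using subgroup.m_closed[OF kernel.cocycles_subgroup h g] by (intro \<psi>) (simp add: kernel_group_simps)
    also have "d0 \<otimes>\<^bsub>G 1\<^esub> (h \<otimes>\<^bsub>G 1\<^esub> ?g) = d' \<otimes>\<^bsub>G 1\<^esub> h"
    proof -
      have "d0 \<otimes>\<^bsub>G 1\<^esub> (?g \<otimes>\<^bsub>G 1\<^esub> h) = (d0 \<otimes>\<^bsub>G 1\<^esub> ?g) \<otimes>\<^bsub>G 1\<^esub> h"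
        using cl hg k0(1) k'(1) Xb by (simp add: A.ghom_group_simps(1) A.ghom_closed kerhom_ghom)
      then show ?thesis
        using e by (simp add: A.ghom_m_comm[OF Xb Xb hg])
    qed
    finally show ?thesis .
  qed
  then show ?thesis using aff by blast
qed

end

theorem theorem4p1:
  fixes Rb :: "'k ring" and R :: "'l ring"
    and Cb :: "('o, 'm, 'k) lincat" and C :: "('p, 'n, 'l) lincat"
    and F :: "('o, 'm, 'p, 'n) fctr"
    and X :: "int \<Rightarrow> 'p" and d :: "int \<Rightarrow> 'n"
    and Xb :: "int \<Rightarrow> 'o" and c :: "int \<Rightarrow> 'n" and db :: "int \<Rightarrow> 'm"
  assumes "linear_category Rb Cb" and "linear_category R C"
    and "additive_functor Cb C F"
    and "essentially_surjective Cb C F" and "full_functor Cb C F"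
    and "square_zero_kernel Cb C F"
    and "(X, d) \<in> Obj (homotopy_cat C)"
    and "graded_lift Cb C F X Xb c"
    and "graded_map_lift Cb C F X d Xb c db"
  shows "\<exists>obs \<in> carrier (kernel_cohomology Cb C F Xb db 2).
    (\<forall>d'. graded_map_lift Cb C F X d Xb c d' \<longrightarrow>
       obs = kernel_class Cb C F Xb db 2 (gcomp Cb Xb Xb Xb 1 1 d' d')) \<and>
    (obs = \<one>\<^bsub>kernel_cohomology Cb C F Xb db 2\<^esub> \<longleftrightarrow> Obj (complex_lifts Cb C F X d) \<noteq> {}) \<and>
    (obs = \<one>\<^bsub>kernel_cohomology Cb C F Xb db 2\<^esub> \<longrightarrow>
      (\<exists>\<phi>. affine_over (kernel_cohomology Cb C F Xb db 1) (Sk (complex_lifts Cb C F X d)) \<phi> \<and>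
        (\<forall>d' h. graded_map_lift Cb C F X d Xb c d' \<longrightarrow> (Xb, d') \<in> complexes Cb \<longrightarrow>
           h \<in> kernel_cocycles Cb C F Xb db 1 \<longrightarrow>
           \<phi> (kernel_class Cb C F Xb db 1 h) (strict_lift_class Cb C F X d Xb c d') =
           strict_lift_class Cb C F X d Xb c (d' \<otimes>\<^bsub>ghom_group Cb Xb Xb 1\<^esub> h))))"
proof -
  interpret lifting_problem Rb Cb R C F X d Xb c db
    using assms
    by (simp add: lifting_problem_def lifting_problem_axioms_def square_zero_extension_def
        square_zero_extension_axioms_def linear_functor_def homotopy_cat_def)
  let ?obs = "kernel_class Cb C F Xb db 2 (gcomp Cb Xb Xb Xb 1 1 db db)"
  show ?thesis
  proof (intro bexI[of _ ?obs] conjI allI impI)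
    show "?obs \<in> carrier (kernel_cohomology Cb C F Xb db 2)"
      using gcomp_lift_cocycle[OF db] by (auto simp: kernel.carrier_cohomology)
    show "?obs = kernel_class Cb C F Xb db 2 (gcomp Cb Xb Xb Xb 1 1 d' d')"
      if "graded_map_lift Cb C F X d Xb c d'" for d'
      using obstruction_independent[OF that] by (rule sym)
    show "?obs = \<one>\<^bsub>kernel_cohomology Cb C F Xb db 2\<^esub> \<longleftrightarrow> Obj L \<noteq> {}"
      unfolding obstruction_trivial_iff_strict by (rule ex_strict_iff_lift)
    assume "?obs = \<one>\<^bsub>kernel_cohomology Cb C F Xb db 2\<^esub>"
    then obtain d0 where "strict d0" using obstruction_trivial_iff_strict by blast
    then show "\<exists>\<phi>. affine_over (kernel_cohomology Cb C F Xb db 1) (Sk L) \<phi> \<and>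
        (\<forall>d' h. graded_map_lift Cb C F X d Xb c d' \<longrightarrow> (Xb, d') \<in> complexes Cb \<longrightarrow>
           h \<in> kernel_cocycles Cb C F Xb db 1 \<longrightarrow>
           \<phi> (kernel_class Cb C F Xb db 1 h) (lift_class d') = lift_class (d' \<otimes>\<^bsub>G 1\<^esub> h))"
      by (rule lift_classes_affine)
  qed
qed

end
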